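(* There exists, up to normalization (that is, up to the choice of the value $t_1(1)\in R$), a unique Markov trace $(t_n)_{n\ge1}$ satisfying the inclusion property with $d=\delta$ on the tower of algebras $(BMW_n)_{n\ge1}$. In other words, for every $c\in R$ there is exactly one Markov trace $(t_n)_{n\ge 1}$ on $(BMW_n)_{n\ge1}$ satisfying the inclusion property with $d=\delta$ and $t_1(1)=c$.
   Context: Let $R=\mathbb{C}[a^{\pm1},q^{\pm1},(q-q^{-1})^{\pm1}]$ and $\delta=\frac{a-a^{-1}}{q-q^{-1}}+1$. The Birman-Murakami-Wenzl algebra $BMW_n$ ($n\ge 2$) is the $R$-algebra generated by invertible elements $s_1,\dots,s_{n-1}$ subject to the relations $s_is_j=s_js_i$ for $|i-j|\ge 2$, $s_is_{i+1}s_i=s_{i+1}s_is_{i+1}$ for $1\le i\le n-2$, and, with $e_i:=\frac{s_i^{-1}-s_i}{q-q^{-1}}+1$, the relations $e_is_i=a^{-1}e_i$ for $1\le i\le n-1$, and $e_is_{i+1}e_i=a\,e_i$ and $e_is_{i+1}^{-1}e_i=a^{-1}e_i$ for $1\le i\le n-2$. Set $BMW_1=R$. The algebra $BMW_n$ is identified with its image in $BMW_{n+1}$ under the algebra embedding $\iota_n$, $s_i\mapsto s_i$ ($i=1,\dots,n-1$). A Markov trace on $(BMW_n)_{n\ge1}$ is a family $(t_n)_{n\ge1}$ of $R$-linear maps $t_n:BMW_n\to R$ such that, for all $n\ge1$ and $u,v\in BMW_n$: (trace property) $t_n(uv)=t_n(vu)$; (stabilization property) $t_{n+1}(us_n^{\pm1}v)=a^{\pm1}t_n(uv)$.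 The inclusion property with $d=\delta$ is: $t_{n+1}(u)=\delta\,t_n(u)$ for all $n\ge1$ and $u\in BMW_n$. *)

theory Defs
  imports
    "HOL-Computational_Algebra.Computational_Algebra"
    "HOL-Library.Poly_Mapping"
    "HOL-Algebra.QuotRing"
begin

section \<open>The coefficient ring\<close>

text \<open>
  The field \<open>complex poly poly fract\<close> is the field of rational functions in two
  algebraically independent indeterminates over the complex numbers; the inner polynomial
  variable is called a and the outer one q.
\<close>

type_synonym ratfun = "complex poly poly fract"

definition rf_const :: "complex \<Rightarrow> ratfun" where
  "rf_const c = Fract [:[:c:]:] 1"

definition rf_a :: ratfun where
  "rf_a = Fract [:[:0, 1:]:] 1"

definition rf_q :: ratfun where
  "rf_q = Fract [:0, 1:] 1"

inductive_set scalar_set :: "ratfun set" where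
  const: "rf_const c \<in> scalar_set"
| a: "rf_a \<in> scalar_set"
| a_inv: "inverse rf_a \<in> scalar_set"
| q: "rf_q \<in> scalar_set"
| q_inv: "inverse rf_q \<in> scalar_set"
| z_inv: "inverse (rf_q - inverse rf_q) \<in> scalar_set"
| add: "x \<in> scalar_set \<Longrightarrow> y \<in> scalar_set \<Longrightarrow> x + y \<in> scalar_set"
| mult: "x \<in> scalar_set \<Longrightarrow> y \<in> scalar_set \<Longrightarrow> x * y \<in> scalar_set"

lemma rf_const_0: "rf_const 0 = 0"
  by (simp add: rf_const_def Zero_fract_def)

lemma rf_const_1: "rf_const 1 = 1"
  by (simp add: rf_const_def One_fract_def one_pCons)

lemma scalar_set_0: "0 \<in> scalar_set"
  using scalar_set.const[of 0] by (simp add: rf_const_0)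

lemma scalar_set_1: "1 \<in> scalar_set"
  using scalar_set.const[of 1] by (simp add: rf_const_1)

lemma scalar_set_uminus:
  assumes "x \<in> scalar_set"
  shows "- x \<in> scalar_set"
proof -
  have "rf_const (- 1) = - 1"
    by (simp add: rf_const_def One_fract_def one_pCons)
  then show ?thesis
    using scalar_set.mult[OF scalar_set.const[of "- 1"] assms] by simp
qed

lemma scalar_set_diff: "x \<in> scalar_set \<Longrightarrow> y \<in> scalar_set \<Longrightarrow> x - y \<in> scalar_set"
  using scalar_set.add[OF _ scalar_set_uminus[of y], of x] by simp

typedef scalar = scalar_set
  using scalar_set_0 by blast

setup_lifting type_definition_scalar

instantiation scalar :: idom
begin

lift_definition zero_scalar :: scalar is 0
  by (rule scalar_set_0)

lift_definition one_scalar :: scalar is 1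
  by (rule scalar_set_1)

lift_definition plus_scalar :: "scalar \<Rightarrow> scalar \<Rightarrow> scalar" is "(+)"
  by (rule scalar_set.add)

lift_definition minus_scalar :: "scalar \<Rightarrow> scalar \<Rightarrow> scalar" is "(-)"
  by (rule scalar_set_diff)

lift_definition uminus_scalar :: "scalar \<Rightarrow> scalar" is uminus
  by (rule scalar_set_uminus)

lift_definition times_scalar :: "scalar \<Rightarrow> scalar \<Rightarrow> scalar" is "(*)"
  by (rule scalar_set.mult)

instance
  by standard (transfer; simp add: algebra_simps)+

end

lift_definition sc_a :: scalar is rf_a
  by (rule scalar_set.a)

lift_definition sc_a_inv :: scalar is "inverse rf_a"
  by (rule scalar_set.a_inv)

lift_definition sc_q :: scalar is rf_q
  by (rule scalar_set.q)

lift_definition sc_q_inv :: scalar is "inverse rf_q"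
  by (rule scalar_set.q_inv)

lift_definition sc_z_inv :: scalar is "inverse (rf_q - inverse rf_q)"
  by (rule scalar_set.z_inv)

lemma rf_a_nonzero: "rf_a \<noteq> 0"
  by (simp add: rf_a_def Zero_fract_def eq_fract)

lemma rf_q_nonzero: "rf_q \<noteq> 0"
  by (simp add: rf_q_def Zero_fract_def eq_fract)

lemma rf_z_nonzero: "rf_q - inverse rf_q \<noteq> 0"
proof
  assume "rf_q - inverse rf_q = 0"
  then have "rf_q * rf_q = 1"
    using rf_q_nonzero by (simp add: field_simps)
  then show False
    by (simp add: rf_q_def One_fract_def eq_fract one_pCons)
qed

lemma sc_a_inverse: "sc_a * sc_a_inv = 1"
  by transfer (simp add: rf_a_nonzero)

lemma sc_q_inverse: "sc_q * sc_q_inv = 1"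
  by transfer (simp add: rf_q_nonzero)

lemma sc_z_inverse: "(sc_q - sc_q_inv) * sc_z_inv = 1"
  by transfer (rule right_inverse[OF rf_z_nonzero])

definition bmw_delta :: scalar where
  "bmw_delta = (sc_a - sc_a_inv) * sc_z_inv + 1"


section \<open>Free algebras\<close>

text \<open>
  The free monoid is written additively, so that the convolution product of
  \<open>HOL-Library.Poly_Mapping\<close> turns the finitely supported functions on it into the free
  associative unital algebra.
\<close>

datatype letter = Gen nat | GenInv nat

fun letter_index :: "letter \<Rightarrow> nat" where
  "letter_index (Gen i) = i"
| "letter_index (GenInv i) = i"

datatype braid_word = BWord (letters: "letter list")

instantiation braid_word :: monoid_add
begin

definition zero_braid_word :: braid_word where
  "zero_braid_word = BWord []"

definition plus_braid_word :: "braid_word \<Rightarrow> braid_word \<Rightarrow> braid_word" where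
  "plus_braid_word u v = BWord (letters u @ letters v)"

instance
  by standard (simp_all add: zero_braid_word_def plus_braid_word_def)

end

type_synonym free_alg = "braid_word \<Rightarrow>\<^sub>0 scalar"

definition fa_const :: "scalar \<Rightarrow> free_alg" where
  "fa_const r = Poly_Mapping.single 0 r"

definition fa_gen :: "nat \<Rightarrow> free_alg" where
  "fa_gen i = Poly_Mapping.single (BWord [Gen i]) 1"

definition fa_gen_inv :: "nat \<Rightarrow> free_alg" where
  "fa_gen_inv i = Poly_Mapping.single (BWord [GenInv i]) 1"

definition fa_e :: "nat \<Rightarrow> free_alg" where
  "fa_e i = fa_const sc_z_inv * (fa_gen_inv i - fa_gen i) + 1"

definition words :: "nat \<Rightarrow> braid_word set" where
  "words n = {w. \<forall>l \<in> set (letters w). letter_index l \<in> {1..<n}}"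

text \<open>The free algebra on the letters \<open>Gen i\<close> and \<open>GenInv i\<close> with \<open>1 \<le> i < n\<close>.\<close>

definition FA :: "nat \<Rightarrow> free_alg ring" where
  "FA n = \<lparr>carrier = {f. Poly_Mapping.keys f \<subseteq> words n}, mult = (*), one = 1, zero = 0, add = (+)\<rparr>"


section \<open>Birman-Murakami-Wenzl algebras\<close>

text \<open>
  The first two families of relators express that \<open>GenInv i\<close> is a two-sided inverse of
  \<open>Gen i\<close>. For \<open>n = 1\<close> there are neither generators nor relators.
\<close>

definition bmw_relators :: "nat \<Rightarrow> free_alg set" where
  "bmw_relators n =
     {fa_gen i * fa_gen_inv i - 1 | i. 1 \<le> i \<and> i < n}
   \<union> {fa_gen_inv i * fa_gen i - 1 | i. 1 \<le> i \<and> i < n}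
   \<union> {fa_gen i * fa_gen j - fa_gen j * fa_gen i | i j.
        1 \<le> i \<and> i < n \<and> 1 \<le> j \<and> j < n \<and> 2 \<le> \<bar>int i - int j\<bar>}
   \<union> {fa_gen i * fa_gen (i + 1) * fa_gen i - fa_gen (i + 1) * fa_gen i * fa_gen (i + 1) | i.
        1 \<le> i \<and> i + 1 < n}
   \<union> {fa_e i * fa_gen i - fa_const sc_a_inv * fa_e i | i. 1 \<le> i \<and> i < n}
   \<union> {fa_e i * fa_gen (i + 1) * fa_e i - fa_const sc_a * fa_e i | i. 1 \<le> i \<and> i + 1 < n}
   \<union> {fa_e i * fa_gen_inv (i + 1) * fa_e i - fa_const sc_a_inv * fa_e i | i.
        1 \<le> i \<and> i + 1 < n}"

definition bmw_ideal :: "nat \<Rightarrow> free_alg set" where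
  "bmw_ideal n = genideal (FA n) (bmw_relators n)"

definition BMW :: "nat \<Rightarrow> free_alg set ring" where
  "BMW n = FA n Quot bmw_ideal n"

definition bmw_class :: "nat \<Rightarrow> free_alg \<Rightarrow> free_alg set" where
  "bmw_class n x = bmw_ideal n +>\<^bsub>FA n\<^esub> x"

definition bmw_smult :: "nat \<Rightarrow> scalar \<Rightarrow> free_alg set \<Rightarrow> free_alg set" where
  "bmw_smult n r X = bmw_class n (fa_const r) \<otimes>\<^bsub>BMW n\<^esub> X"

definition bmw_gen :: "nat \<Rightarrow> nat \<Rightarrow> free_alg set" where
  "bmw_gen n i = bmw_class n (fa_gen i)"

text \<open>
  The union in \<open>bmw_incl\<close> is that of a constant family; see \<open>bmw_incl_class\<close> below.
\<close>

definition bmw_incl :: "nat \<Rightarrow> free_alg set \<Rightarrow> free_alg set" where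
  "bmw_incl n X = (\<Union>x\<in>X. bmw_class (n + 1) x)"


section \<open>Markov traces\<close>

definition linear_functional :: "nat \<Rightarrow> (free_alg set \<Rightarrow> scalar) \<Rightarrow> bool" where
  "linear_functional n \<phi> \<longleftrightarrow>
     (\<forall>u\<in>carrier (BMW n). \<forall>v\<in>carrier (BMW n). \<phi> (u \<oplus>\<^bsub>BMW n\<^esub> v) = \<phi> u + \<phi> v) \<and>
     (\<forall>r. \<forall>u\<in>carrier (BMW n). \<phi> (bmw_smult n r u) = r * \<phi> u)"

definition trace_property :: "nat \<Rightarrow> (free_alg set \<Rightarrow> scalar) \<Rightarrow> bool" where
  "trace_property n \<phi> \<longleftrightarrow>
     (\<forall>u\<in>carrier (BMW n). \<forall>v\<in>carrier (BMW n).
        \<phi> (u \<otimes>\<^bsub>BMW n\<^esub> v) = \<phi> (v \<otimes>\<^bsub>BMW n\<^esub> u))"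

definition stabilization_property ::
    "nat \<Rightarrow> (free_alg set \<Rightarrow> scalar) \<Rightarrow> (free_alg set \<Rightarrow> scalar) \<Rightarrow> bool" where
  "stabilization_property n \<phi> \<psi> \<longleftrightarrow>
     (\<forall>u\<in>carrier (BMW n). \<forall>v\<in>carrier (BMW n).
        \<psi> (bmw_incl n u \<otimes>\<^bsub>BMW (n + 1)\<^esub> bmw_gen (n + 1) n \<otimes>\<^bsub>BMW (n + 1)\<^esub> bmw_incl n v)
          = sc_a * \<phi> (u \<otimes>\<^bsub>BMW n\<^esub> v) \<and>
        \<psi> (bmw_incl n u \<otimes>\<^bsub>BMW (n + 1)\<^esub> inv\<^bsub>BMW (n + 1)\<^esub> (bmw_gen (n + 1) n)
              \<otimes>\<^bsub>BMW (n + 1)\<^esub> bmw_incl n v)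
          = sc_a_inv * \<phi> (u \<otimes>\<^bsub>BMW n\<^esub> v))"

definition markov_trace :: "(nat \<Rightarrow> free_alg set \<Rightarrow> scalar) \<Rightarrow> bool" where
  "markov_trace t \<longleftrightarrow>
     (\<forall>n\<ge>1. linear_functional n (t n) \<and> trace_property n (t n) \<and>
        stabilization_property n (t n) (t (n + 1)))"

definition inclusion_property :: "scalar \<Rightarrow> (nat \<Rightarrow> free_alg set \<Rightarrow> scalar) \<Rightarrow> bool" where
  "inclusion_property d t \<longleftrightarrow>
     (\<forall>n\<ge>1. \<forall>u\<in>carrier (BMW n). t (n + 1) (bmw_incl n u) = d * t n u)"


section \<open>Basic properties of the constructions\<close>

lemma words_mono: "words n \<subseteq> words (n + 1)"
  by (auto simp: words_def)

lemma words_plus: "u \<in> words n \<Longrightarrow> v \<in> words n \<Longrightarrow> u + v \<in> words n"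
  by (auto simp: words_def plus_braid_word_def)

lemma words_0: "0 \<in> words n"
  by (simp add: words_def zero_braid_word_def)

lemma FA_simps [simp]:
  "mult (FA n) = (*)" "one (FA n) = 1" "zero (FA n) = 0" "add (FA n) = (+)"
  by (simp_all add: FA_def)

lemma FA_carrier: "x \<in> carrier (FA n) \<longleftrightarrow> Poly_Mapping.keys x \<subseteq> words n"
  by (simp add: FA_def)

lemma FA_closed:
  "0 \<in> carrier (FA n)" "1 \<in> carrier (FA n)" "fa_const r \<in> carrier (FA n)"
  "x \<in> carrier (FA n) \<Longrightarrow> y \<in> carrier (FA n) \<Longrightarrow> x + y \<in> carrier (FA n)"
  "x \<in> carrier (FA n) \<Longrightarrow> y \<in> carrier (FA n) \<Longrightarrow> x * y \<in> carrier (FA n)"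
  "x \<in> carrier (FA n) \<Longrightarrow> - x \<in> carrier (FA n)"
  "x \<in> carrier (FA n) \<Longrightarrow> y \<in> carrier (FA n) \<Longrightarrow> x - y \<in> carrier (FA n)"
proof -
  show add: "x + y \<in> carrier (FA n)" if "x \<in> carrier (FA n)" "y \<in> carrier (FA n)" for x y
    using that Poly_Mapping.keys_add[of x y] by (auto simp: FA_carrier)
  show uminus: "- x \<in> carrier (FA n)" if "x \<in> carrier (FA n)" for x
    using that by (simp add: FA_carrier)
  show "x - y \<in> carrier (FA n)" if "x \<in> carrier (FA n)" "y \<in> carrier (FA n)"
    using add[OF that(1) uminus[OF that(2)]] by simp
  show "x * y \<in> carrier (FA n)" if "x \<in> carrier (FA n)" "y \<in> carrier (FA n)"
    using that Poly_Mapping.keys_mult[of x y] words_plus by (fastforce simp: FA_carrier)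
qed (simp_all add: FA_carrier fa_const_def words_0)

lemma FA_gen_closed:
  assumes "1 \<le> i" "i < n"
  shows "fa_gen i \<in> carrier (FA n)" "fa_gen_inv i \<in> carrier (FA n)" "fa_e i \<in> carrier (FA n)"
proof -
  show 1: "fa_gen i \<in> carrier (FA n)" "fa_gen_inv i \<in> carrier (FA n)"
    using assms by (simp_all add: FA_carrier fa_gen_def fa_gen_inv_def words_def)
  then show "fa_e i \<in> carrier (FA n)"
    by (simp add: fa_e_def FA_closed)
qed

lemma FA_mono: "x \<in> carrier (FA n) \<Longrightarrow> x \<in> carrier (FA (n + 1))"
  using words_mono[of n] by (auto simp: FA_carrier)

lemma FA_ring: "ring (FA n)"
proof (rule ringI)
  show "abelian_group (FA n)"
  proof (rule abelian_groupI)
    show "\<exists>y\<in>carrier (FA n). y \<oplus>\<^bsub>FA n\<^esub> x = \<zero>\<^bsub>FA n\<^esub>" if "x \<in> carrier (FA n)" for x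
      using that by (intro bexI[of _ "- x"]) (simp_all add: FA_closed)
  qed (simp_all add: FA_closed algebra_simps)
  show "monoid (FA n)"
    by (rule monoidI) (simp_all add: FA_closed algebra_simps)
qed (simp_all add: FA_closed algebra_simps)

lemma bmw_relators_closed: "bmw_relators n \<subseteq> carrier (FA n)"
  by (auto simp: bmw_relators_def intro!: FA_closed FA_gen_closed)

lemma bmw_relators_mono: "bmw_relators n \<subseteq> bmw_relators (n + 1)"
  unfolding bmw_relators_def by (intro Un_mono) fastforce+

lemma bmw_ideal_ideal: "ideal (bmw_ideal n) (FA n)"
  unfolding bmw_ideal_def by (rule ring.genideal_ideal[OF FA_ring bmw_relators_closed])

lemma bmw_relators_ideal: "bmw_relators n \<subseteq> bmw_ideal n"
  unfolding bmw_ideal_def by (rule ring.genideal_self[OF FA_ring bmw_relators_closed])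

lemma BMW_ring: "ring (BMW n)"
  unfolding BMW_def by (rule ideal.quotient_is_ring[OF bmw_ideal_ideal])

lemma bmw_ideal_mono: "bmw_ideal n \<subseteq> bmw_ideal (n + 1)"
proof -
  interpret J: ideal "bmw_ideal (n + 1)" "FA (n + 1)"
    by (rule bmw_ideal_ideal)
  have neg: "- x \<in> bmw_ideal (n + 1)" if "x \<in> bmw_ideal (n + 1)" for x
  proof -
    have "(- 1) * x \<in> bmw_ideal (n + 1)"
      using J.I_l_closed[OF that, of "- 1"] by (simp add: FA_closed)
    then show ?thesis by simp
  qed
  have "ideal (bmw_ideal (n + 1) \<inter> carrier (FA n)) (FA n)"
  proof (rule idealI[OF FA_ring])
    show "subgroup (bmw_ideal (n + 1) \<inter> carrier (FA n)) (add_monoid (FA n))"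
    proof (rule group.subgroupI)
      show "group (add_monoid (FA n))"
        using abelian_group.a_group[OF ring.is_abelian_group[OF FA_ring]] .
      show "bmw_ideal (n + 1) \<inter> carrier (FA n) \<noteq> {}"
        using additive_subgroup.zero_closed[OF J.additive_subgroup_axioms] FA_closed(1)[of n]
        by auto
      show "inv\<^bsub>add_monoid (FA n)\<^esub> x \<in> bmw_ideal (n + 1) \<inter> carrier (FA n)"
        if "x \<in> bmw_ideal (n + 1) \<inter> carrier (FA n)" for x
      proof -
        have "inv\<^bsub>add_monoid (FA n)\<^esub> x = - x"
          using that
          by (intro group.inv_equality
                abelian_group.a_group[OF ring.is_abelian_group[OF FA_ring]])
             (simp_all add: FA_closed)
        then show ?thesis using that neg by (simp add: FA_closed)
      qed
      show "x \<otimes>\<^bsub>add_monoid (FA n)\<^esub> y \<in> bmw_ideal (n + 1) \<inter> carrier (FA n)"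
        if "x \<in> bmw_ideal (n + 1) \<inter> carrier (FA n)" "y \<in> bmw_ideal (n + 1) \<inter> carrier (FA n)"
        for x y
        using that additive_subgroup.a_closed[OF J.additive_subgroup_axioms, of x y]
        by (auto intro: FA_closed)
    qed auto
    show "x \<otimes>\<^bsub>FA n\<^esub> y \<in> bmw_ideal (n + 1) \<inter> carrier (FA n)"
      if "y \<in> bmw_ideal (n + 1) \<inter> carrier (FA n)" "x \<in> carrier (FA n)" for x y
      using that J.I_l_closed[of y x] FA_mono[of x n] by (auto intro: FA_closed)
    show "y \<otimes>\<^bsub>FA n\<^esub> x \<in> bmw_ideal (n + 1) \<inter> carrier (FA n)"
      if "y \<in> bmw_ideal (n + 1) \<inter> carrier (FA n)" "x \<in> carrier (FA n)" for x y
      using that J.I_r_closed[of y x] FA_mono[of x n] by (auto intro: FA_closed)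
  qed
  moreover have "bmw_relators n \<subseteq> bmw_ideal (n + 1) \<inter> carrier (FA n)"
    using bmw_relators_mono[of n] bmw_relators_ideal[of "n + 1"] bmw_relators_closed[of n]
    by blast
  ultimately have "bmw_ideal n \<subseteq> bmw_ideal (n + 1) \<inter> carrier (FA n)"
    unfolding bmw_ideal_def[of n] by (rule ring.genideal_minimal[OF FA_ring])
  then show ?thesis by blast
qed

lemma bmw_class_hom: "bmw_class n \<in> ring_hom (FA n) (BMW n)"
  using ideal.rcos_ring_hom[OF bmw_ideal_ideal, of n] by (simp add: bmw_class_def[abs_def] BMW_def)

lemma bmw_carrier: "carrier (BMW n) = bmw_class n ` carrier (FA n)"
  by (auto simp: BMW_def FactRing_def A_RCOSETS_def' bmw_class_def)

lemma bmw_incl_class: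
  assumes x: "x \<in> carrier (FA n)"
  shows "bmw_incl n (bmw_class n x) = bmw_class (n + 1) x"
proof -
  interpret I: ideal "bmw_ideal n" "FA n"
    by (rule bmw_ideal_ideal)
  interpret J: ideal "bmw_ideal (n + 1)" "FA (n + 1)"
    by (rule bmw_ideal_ideal)
  have "x \<in> bmw_class n x"
    unfolding bmw_class_def by (rule I.a_rcos_self[OF x])
  moreover have "bmw_class (n + 1) y = bmw_class (n + 1) x" if "y \<in> bmw_class n x" for y
  proof -
    have "y \<in> bmw_class (n + 1) x"
      using that bmw_ideal_mono[of n] by (auto simp: bmw_class_def a_r_coset_def r_coset_def)
    then show ?thesis
      unfolding bmw_class_def using J.a_repr_independence'[OF _ FA_mono[OF x]] by simp
  qed
  ultimately show ?thesis
    unfolding bmw_incl_def by blast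
qed

lemma bmw_incl_hom: "bmw_incl n \<in> ring_hom (BMW n) (BMW (n + 1))"
proof (rule ring_hom_memI)
  note class_hom = ring_hom_add[OF bmw_class_hom] ring_hom_mult[OF bmw_class_hom]
    ring_hom_one[OF bmw_class_hom] ring_hom_closed[OF bmw_class_hom]
  show "bmw_incl n u \<in> carrier (BMW (n + 1))" if "u \<in> carrier (BMW n)" for u
    using that FA_mono[of _ n] by (auto simp: bmw_carrier bmw_incl_class)
  show "bmw_incl n (u \<otimes>\<^bsub>BMW n\<^esub> v) = bmw_incl n u \<otimes>\<^bsub>BMW (n + 1)\<^esub> bmw_incl n v"
    if "u \<in> carrier (BMW n)" "v \<in> carrier (BMW n)" for u v
  proof -
    from that obtain x y where "x \<in> carrier (FA n)" "y \<in> carrier (FA n)"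
      and [simp]: "u = bmw_class n x" "v = bmw_class n y"
      by (auto simp: bmw_carrier)
    then show ?thesis
      using class_hom(2)[of x n y] class_hom(2)[of x "n + 1" y]
      by (metis FA_closed(5) FA_mono FA_simps(1) \<open>u = _\<close> \<open>v = _\<close> bmw_incl_class)
  qed
  show "bmw_incl n (u \<oplus>\<^bsub>BMW n\<^esub> v) = bmw_incl n u \<oplus>\<^bsub>BMW (n + 1)\<^esub> bmw_incl n v"
    if "u \<in> carrier (BMW n)" "v \<in> carrier (BMW n)" for u v
  proof -
    from that obtain x y where "x \<in> carrier (FA n)" "y \<in> carrier (FA n)"
      and [simp]: "u = bmw_class n x" "v = bmw_class n y"
      by (auto simp: bmw_carrier)
    then show ?thesis
      using class_hom(1)[of x n y] class_hom(1)[of x "n + 1" y]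
      by (metis FA_closed(4) FA_mono FA_simps(4) \<open>u = _\<close> \<open>v = _\<close> bmw_incl_class)
  qed
  show "bmw_incl n \<one>\<^bsub>BMW n\<^esub> = \<one>\<^bsub>BMW (n + 1)\<^esub>"
    using class_hom(3)[of n] class_hom(3)[of "n + 1"] bmw_incl_class[of 1 n]
    by (simp add: FA_closed)
qed

lemma bmw_smult_class:
  "x \<in> carrier (FA n) \<Longrightarrow> bmw_smult n r (bmw_class n x) = bmw_class n (fa_const r * x)"
  using ring_hom_mult[OF bmw_class_hom FA_closed(3)] by (simp add: bmw_smult_def)

lemma bmw_class_eq_one:
  assumes "x - 1 \<in> bmw_ideal n" "x \<in> carrier (FA n)"
  shows "bmw_class n x = \<one>\<^bsub>BMW n\<^esub>"
proof -
  interpret I: ideal "bmw_ideal n" "FA n"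
    by (rule bmw_ideal_ideal)
  have "x \<in> bmw_class n 1"
    using assms(1) by (force simp: bmw_class_def a_r_coset_def r_coset_def)
  then have "bmw_class n 1 = bmw_class n x"
    unfolding bmw_class_def
    by (rule I.a_repr_independence'[OF _ FA_closed(2)])
  then show ?thesis
    using ring_hom_one[OF bmw_class_hom, of n] by simp
qed

lemma bmw_gen_inverse:
  assumes i: "1 \<le> i" "i < n"
  shows "bmw_gen n i \<in> Units (BMW n)" "inv\<^bsub>BMW n\<^esub> (bmw_gen n i) = bmw_class n (fa_gen_inv i)"
proof -
  interpret B: ring "BMW n"
    by (rule BMW_ring)
  have rel: "fa_gen i * fa_gen_inv i - 1 \<in> bmw_ideal n" "fa_gen_inv i * fa_gen i - 1 \<in> bmw_ideal n"
    using i bmw_relators_ideal[of n] by (auto simp: bmw_relators_def)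
  note mem = FA_gen_closed[OF i]
  have car: "bmw_gen n i \<in> carrier (BMW n)" "bmw_class n (fa_gen_inv i) \<in> carrier (BMW n)"
    using mem by (auto simp: bmw_gen_def bmw_carrier)
  have 1: "bmw_gen n i \<otimes>\<^bsub>BMW n\<^esub> bmw_class n (fa_gen_inv i) = \<one>\<^bsub>BMW n\<^esub>"
    using ring_hom_mult[OF bmw_class_hom mem(1,2)] bmw_class_eq_one[OF rel(1)] mem
    by (simp add: bmw_gen_def FA_closed)
  have 2: "bmw_class n (fa_gen_inv i) \<otimes>\<^bsub>BMW n\<^esub> bmw_gen n i = \<one>\<^bsub>BMW n\<^esub>"
    using ring_hom_mult[OF bmw_class_hom mem(2,1)] bmw_class_eq_one[OF rel(2)] mem
    by (simp add: bmw_gen_def FA_closed)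
  show "bmw_gen n i \<in> Units (BMW n)"
    unfolding Units_def using 1 2 car by blast
  show "inv\<^bsub>BMW n\<^esub> (bmw_gen n i) = bmw_class n (fa_gen_inv i)"
    by (rule B.inv_char[OF car 1 2])
qed

text \<open>\<open>BMW 1\<close> is the coefficient ring, via the structure map.\<close>

lemma BMW_1_bij: "bij_betw (\<lambda>r. bmw_class 1 (fa_const r)) UNIV (carrier (BMW 1))"
proof -
  interpret A: ring "FA 1"
    by (rule FA_ring)
  have "bmw_relators 1 = {}"
    by (auto simp: bmw_relators_def)
  then have "bmw_ideal 1 \<subseteq> {0}"
    unfolding bmw_ideal_def using A.genideal_minimal[OF A.zeroideal, of "{}"] by simp
  moreover have "0 \<in> bmw_ideal 1"
    using additive_subgroup.zero_closed[OF ideal.axioms(1)[OF bmw_ideal_ideal[of 1]]] by simp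
  ultimately have "bmw_ideal 1 = {0}"
    by blast
  then have cls: "bmw_class 1 x = {x}" for x
    by (simp add: bmw_class_def a_r_coset_def r_coset_def)
  have "letters w = [] \<longleftrightarrow> w = 0" for w
    by (cases w) (simp add: zero_braid_word_def)
  then have "words 1 = {0}"
    by (auto simp: words_def zero_braid_word_def)
  then have "x \<in> range fa_const" if "x \<in> carrier (FA 1)" for x
    using that unfolding FA_carrier fa_const_def
    by (intro range_eqI[of _ _ "Poly_Mapping.lookup x 0"] poly_mapping_eqI)
       (auto simp: lookup_single when_def in_keys_iff)
  then have "carrier (FA 1) = range fa_const"
    using FA_closed(3) by blast
  moreover have "inj fa_const"
    by (rule injI) (metis fa_const_def lookup_single_eq)
  ultimately show ?thesis
    by (auto simp: bij_betw_def bmw_carrier inj_on_def cls[unfolded One_nat_def])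
qed

end

theory Submission
  imports Defs
begin

text \<open>
  Uniqueness: modulo the relations, every element of the algebra on n + 1 strands is a sum of
  elements u, \<open>u s\<^sub>n v\<close> and \<open>u s\<^sub>n\<^sup>-\<^sup>1 v\<close> with u, v on n strands, so the
  stabilization and inclusion properties determine the trace on n + 1 strands from the one on n.

  Existence: by the same spanning property each element f has a recipe for its trace value, and only
  the independence of the recipe is at stake. A scalar is determined by its values at the points
  \<open>q = x\<close>, \<open>a = x\<^sup>2\<^sup>m\<^sup>+\<^sup>1\<close> with x > 1 real, and at such a point an honest trace
  exists: the pivotal trace of the action on tensor powers by the R-matrix of the orthogonal quantum
  group in dimension 2m + 2. The value of f is thus the unique scalar that specializes to all of
  these. The R-matrices are constructed by induction on the dimension, adding one isotropic pair of
  basis vectors at a time, so that the braid relation reduces to tangle identities in the smaller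
  space and no sums over indices occur.
\<close>

section \<open>R-matrices of orthogonal type\<close>

text \<open>The obstacle to existence is independence of the recipe: proving it on words would
  rebuild the two-variable Kauffman polynomial, and a basis of the algebras or faithful
  representations would be no cheaper. What has to be separated here is only scalars, not algebra
  elements, and these are separated by evaluation: for fixed x the powers \<open>x^(2m+1)\<close>
  give infinitely many values of a, and infinitely many x remain for q. The division of labour is
  that the spanning property keeps the value inside R, while the specializations certify that it
  depends on f alone and satisfies the trace axioms. The restriction to real x > 1 makes
  \<open>a - 1/a + q - 1/q\<close> positive. Hence the quantum dimension, which is the
  specialization of \<open>bmw_delta\<close>, is nonzero and the operator trace can be divided by it
  to have value 1 at the unit on one strand. Multiplication by c then gives the prescribed
  normalization.\<close>

definition cap_form :: "'i set \<Rightarrow> ('i \<Rightarrow> 'k) \<Rightarrow> ('i \<Rightarrow> 'i) \<Rightarrow> ('i \<Rightarrow> 'i \<Rightarrow> 'k) \<Rightarrow> 'k::field" where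
  "cap_form I c bar f = (\<Sum>i\<in>I. c i * f i (bar i))"

text \<open>This is the inverse of the Gram matrix used by \<open>cap_form\<close>, so that both
  zigzags of a cap and a cup straighten to the identity strand.\<close>

definition cup_vec :: "('i \<Rightarrow> 'k) \<Rightarrow> ('i \<Rightarrow> 'i) \<Rightarrow> 'i \<Rightarrow> 'i \<Rightarrow> 'k::field" where
  "cup_vec c bar k l = (if l = bar k then inverse (c l) else 0)"

text \<open>The diagonal entry of the pivotal element: the weight picked up by a strand labelled i
  when a cap and a cup close it. The sum over all labels is the value of a loop.\<close>

definition pivot :: "('i \<Rightarrow> 'k) \<Rightarrow> ('i \<Rightarrow> 'i) \<Rightarrow> 'i \<Rightarrow> 'k::field" where
  "pivot c bar i = c i * inverse (c (bar i))"

text \<open>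
  A function \<open>f i j\<close> is a vector of the tensor square of the space with basis I, and \<open>S f\<close> its
  image under the braiding; r and b are the inverses of q and a. The assumptions \<open>rot_cup\<close> and
  \<open>rot_cap\<close> say that rotating a crossing by a quarter turn inverts it, with the inverse of S
  eliminated by means of the skein relation.
\<close>

locale kauffman_matrix =
  fixes q r a b :: "'k::field" and I :: "'i set"
    and S :: "('i \<Rightarrow> 'i \<Rightarrow> 'k) \<Rightarrow> 'i \<Rightarrow> 'i \<Rightarrow> 'k"
    and c :: "'i \<Rightarrow> 'k" and bar :: "'i \<Rightarrow> 'i"
  assumes qr: "q * r = 1" and ab: "a * b = 1" and fin: "finite I"
    and bar_in: "i \<in> I \<Longrightarrow> bar i \<in> I"
    and bar_bar: "i \<in> I \<Longrightarrow> bar (bar i) = i"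
    and c_nz: "i \<in> I \<Longrightarrow> c i \<noteq> 0"
    and S_cong: "(\<And>i j. i \<in> I \<Longrightarrow> j \<in> I \<Longrightarrow> f i j = g i j) \<Longrightarrow> k \<in> I \<Longrightarrow> l \<in> I \<Longrightarrow> S f k l = S g k l"
    and S_add: "k \<in> I \<Longrightarrow> l \<in> I \<Longrightarrow> S (\<lambda>i j. f i j + g i j) k l = S f k l + S g k l"
    and S_scale: "k \<in> I \<Longrightarrow> l \<in> I \<Longrightarrow> S (\<lambda>i j. x * f i j) k l = x * S f k l"
    and S_pivot: "k \<in> I \<Longrightarrow> l \<in> I \<Longrightarrow>
        S (\<lambda>i j. pivot c bar i * pivot c bar j * f i j) k l = pivot c bar k * pivot c bar l * S f k l"
    and S_S: "k \<in> I \<Longrightarrow> l \<in> I \<Longrightarrow>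
        S (S f) k l = f k l + (q - r) * S f k l - (q - r) * b * (cap_form I c bar f * cup_vec c bar k l)"
    and S_cup: "k \<in> I \<Longrightarrow> l \<in> I \<Longrightarrow> S (cup_vec c bar) k l = b * cup_vec c bar k l"
    and cap_S: "cap_form I c bar (S f) = b * cap_form I c bar f"
    and cap_cup: "(q - r) * cap_form I c bar (cup_vec c bar) = a - b + q - r"
    and rot_cup: "k \<in> I \<Longrightarrow> l \<in> I \<Longrightarrow> m \<in> I \<Longrightarrow>
        S (\<lambda>i j. cup_vec c bar k i * h j) l m = S (\<lambda>i j. h i * cup_vec c bar j m) k l
          + (q - r) * (cup_vec c bar k l * h m - h k * cup_vec c bar l m)"
    and rot_cap: "k \<in> I \<Longrightarrow>
        cap_form I c bar (\<lambda>i j. S (F i) j k) = cap_form I c bar (\<lambda>i j. S (\<lambda>x y. F x y j) k i)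
          + (q - r) * (cap_form I c bar (\<lambda>i j. F i j k) - cap_form I c bar (F k))"
    and braid: "k \<in> I \<Longrightarrow> l \<in> I \<Longrightarrow> m \<in> I \<Longrightarrow>
        S (\<lambda>k l. S (\<lambda>l m. S (\<lambda>k l. F k l m) k l) l m) k l =
        S (\<lambda>l m. S (\<lambda>k l. S (\<lambda>l m. F k l m) l m) k l) l m"
begin

section \<open>Planar calculus with caps, cups and crossings\<close>

abbreviation "cap \<equiv> cap_form I c bar"
abbreviation "cup \<equiv> cup_vec c bar"

lemma cap_cong: "(\<And>i j. i \<in> I \<Longrightarrow> j \<in> I \<Longrightarrow> f i j = g i j) \<Longrightarrow> cap f = cap g"
  unfolding cap_form_def by (intro sum.cong) (auto simp: bar_in)

lemma cap_add: "cap (\<lambda>i j. f i j + g i j) = cap f + cap g"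
  by (simp add: cap_form_def sum.distrib algebra_simps)

lemma cap_scale: "cap (\<lambda>i j. x * f i j) = x * cap f"
  unfolding cap_form_def sum_distrib_left by (rule sum.cong) simp_all

lemma S_diff:
  assumes "k \<in> I" "l \<in> I" shows "S (\<lambda>i j. f i j - g i j) k l = S f k l - S g k l"
  using S_add[OF assms, of f "\<lambda>i j. (-1) * g i j"] S_scale[OF assms, of "-1" g] by simp

lemma S_zero:
  assumes "k \<in> I" "l \<in> I" shows "S (\<lambda>i j. 0) k l = 0"
  using S_scale[OF assms, of 0 "\<lambda>_ _. 0"] by simp

lemma S_scale_right:
  assumes "k \<in> I" "l \<in> I" shows "S (\<lambda>i j. f i j * x) k l = S f k l * x"
  using S_scale[OF assms, of x f] by (simp add: mult.commute)

lemma cap_diff: "cap (\<lambda>i j. f i j - g i j) = cap f - cap g"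
  by (simp add: cap_form_def sum_subtractf algebra_simps)

lemma cap_zero: "cap (\<lambda>i j. 0) = 0"
  by (simp add: cap_form_def)

lemma cap_scale_right: "cap (\<lambda>i j. f i j * x) = cap f * x"
  by (simp add: cap_form_def sum_distrib_right mult.assoc)

lemmas linear = S_add S_scale S_diff S_zero S_scale_right
  cap_add cap_scale cap_diff cap_zero cap_scale_right

lemma zigzag1:
  assumes "k \<in> I" shows "cap (\<lambda>i j. f i * cup j k) = f k" "cap (\<lambda>i j. cup j k * f i) = f k"
proof -
  have "cap (\<lambda>i j. f i * cup j k) = (\<Sum>i\<in>I. if i = k then f i else 0)"
    unfolding cap_form_def cup_vec_def
    by (rule sum.cong) (use assms bar_bar c_nz in auto)
  then show "cap (\<lambda>i j. f i * cup j k) = f k"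
    using assms fin by simp
  then show "cap (\<lambda>i j. cup j k * f i) = f k" by (simp add: mult.commute)
qed

lemma zigzag2:
  assumes "k \<in> I" shows "cap (\<lambda>i j. cup k i * f j) = f k" "cap (\<lambda>i j. f j * cup k i) = f k"
proof -
  have "cap (\<lambda>i j. cup k i * f j) = (\<Sum>i\<in>I. if i = bar k then f k else 0)"
    unfolding cap_form_def cup_vec_def
    by (rule sum.cong) (use assms bar_bar c_nz in auto)
  then show "cap (\<lambda>i j. cup k i * f j) = f k"
    using assms fin bar_in by simp
  then show "cap (\<lambda>i j. f j * cup k i) = f k" by (simp add: mult.commute)
qed

lemma rot_cup_comm: "k \<in> I \<Longrightarrow> l \<in> I \<Longrightarrow> m \<in> I \<Longrightarrow>
        S (\<lambda>i j. h j * cup k i) l m = S (\<lambda>i j. h i * cup j m) k l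
          + (q - r) * (cup k l * h m - h k * cup l m)"
  using rot_cup[of k l m h] by (simp only: mult.commute)

declare S_cong[cong] cap_cong[cong]

text \<open>A strand slides across a cap: \<open>rot_cap\<close> moves the outer crossing onto the
  strands of the inner one, \<open>S_S\<close> expands the resulting square, and the skein
  corrections cancel by \<open>cap_S\<close> and a zigzag. The slide across a cup is dual.\<close>

lemma slide_cap:
  assumes k: "k \<in> I"
  shows "cap (\<lambda>i j. S (\<lambda>x y. S (F x) y j) k i) = cap (\<lambda>i j. F i j k)"
  using rot_cap[OF k, of "\<lambda>i. S (F i)"] k
  by (simp add: S_S cap_S linear zigzag1 algebra_simps)

lemma slide_cup:
  assumes "k \<in> I" "l \<in> I" "m \<in> I"
  shows "S (\<lambda>i j. S (\<lambda>x y. h x * cup y j) k i) l m = cup k l * h m"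
proof -
  have "S (S (\<lambda>i j. cup k i * h j)) l m =
      S (\<lambda>i j. S (\<lambda>x y. h x * cup y j) k i + (q - r) * (cup k i * h j - h k * cup i j)) l m"
    using assms by (intro S_cong) (auto simp: rot_cup)
  then show ?thesis
    using assms by (simp add: S_S S_cup linear zigzag2 algebra_simps)
qed

lemma qr': "q * (r * x) = x" and ab': "a * (b * x) = x"
  using qr ab by (simp_all flip: mult.assoc)

text \<open>The axioms give the loop only multiplied by \<open>q - r\<close>. These oriented rules
  normalize its multiples by \<open>q\<close> and \<open>r\<close> without a division.\<close>

lemma cap_cup_simps:
  "r * cap cup = q * cap cup - (a - b + q - r)"
  "r * (x * cap cup) = q * (x * cap cup) - x * (a - b + q - r)"
  "q * (q * cap cup) = cap cup + q * (a - b + q - r)"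
  "q * (q * (x * cap cup)) = x * cap cup + q * (x * (a - b + q - r))"
proof -
  show 1: "r * cap cup = q * cap cup - (a - b + q - r)"
    using cap_cup by (simp add: algebra_simps)
  have "q * (q * cap cup) = q * (r * cap cup + (a - b + q - r))"
    by (simp only: 1 diff_add_cancel)
  then show 2: "q * (q * cap cup) = cap cup + q * (a - b + q - r)"
    by (simp only: distrib_left[of q "r * cap cup"] qr')
  show "r * (x * cap cup) = q * (x * cap cup) - x * (a - b + q - r)"
    using arg_cong[OF 1, of "\<lambda>t. x * t"] by (simp only: algebra_simps)
  show "q * (q * (x * cap cup)) = x * cap cup + q * (x * (a - b + q - r))"
    using arg_cong[OF 2, of "\<lambda>t. x * t"] by (simp only: algebra_simps)
qed

text \<open>The value of a kink: \<open>rot_cup\<close> carries the crossing under the cap, which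
  absorbs it with factor b, and by \<open>cap_cup\<close> the skein terms contribute
  \<open>a - b\<close>.\<close>

lemma cap_S_cup:
  assumes k: "k \<in> I"
  shows "cap (\<lambda>i j. S (\<lambda>x y. h x * cup y j) k i) = a * h k"
proof -
  have "cap (\<lambda>i j. S (\<lambda>x y. h x * cup y j) k i) =
      cap (\<lambda>i j. S (\<lambda>x y. cup k x * h y) i j - (q - r) * (cup k i * h j - h k * cup i j))"
    using k by (intro cap_cong) (simp add: rot_cup)
  then show ?thesis
    using k by (simp add: cap_S linear zigzag2 cap_cup_simps algebra_simps)
qed

lemma cap_cup_simp: "q * (x * cap cup) = r * (x * cap cup) + x * (a - b + q - r)"
  by (simp add: cap_cup_simps(2))

lemma pivot_bar: "i \<in> I \<Longrightarrow> pivot c bar i * pivot c bar (bar i) = 1"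
  using c_nz[of i] c_nz[OF bar_in, of i] by (simp add: pivot_def bar_bar field_simps)

lemma cap_pivot: "cap (\<lambda>i j. pivot c bar i * pivot c bar j * f i j) = cap f"
  unfolding cap_form_def by (rule sum.cong) (simp_all add: pivot_bar)

lemma cup_pivot: "k \<in> I \<Longrightarrow> l \<in> I \<Longrightarrow> pivot c bar k * (pivot c bar l * cup k l) = cup k l"
  by (simp add: cup_vec_def pivot_bar flip: mult.assoc)

lemmas tangle = zigzag1 zigzag2 S_S S_cup cap_S rot_cup rot_cup_comm rot_cap slide_cap slide_cup cap_S_cup

end

section \<open>Extension by one dual pair of basis vectors\<close>

locale kauffman_extension = kauffman_matrix q r a b I S c bar
  for q r a b :: "'k::field" and I :: "'i set" and S c bar +
  fixes p m :: 'i
  assumes p: "p \<notin> I" and m: "m \<notin> I" and pm: "p \<noteq> m"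
begin

text \<open>
  The new basis vectors p and m are dual to each other; p is the largest and m the smallest in the
  order underlying the triangular part of the R-matrix.
\<close>

definition "I' = insert p (insert m I)"
text \<open>The coefficient of m is dictated by the new parameter \<open>a * q * q\<close>: the pair
  adds the pivots \<open>a * q\<close> and \<open>b * r\<close>, and
  \<open>(q - r) * (a * q + b * r)\<close> is exactly the resulting change of
  \<open>a - b + q - r\<close>.\<close>

definition "c' = c(p := 1, m := b * r)"
definition "bar' = bar(p := m, m := p)"
text \<open>The Hecke-like part has q on a repeated new vector, r on the exchange of the dual pair,
  and \<open>q - r\<close> in the triangular entries. The terms with \<open>cap f\<close>,
  \<open>cup k l\<close> and \<open>b * r\<close> are, with factor \<open>- (q - r)\<close>, those
  entries of the new cap followed by the new cup that survive the triangular truncation.\<close>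

definition S' :: "('i \<Rightarrow> 'i \<Rightarrow> 'k) \<Rightarrow> 'i \<Rightarrow> 'i \<Rightarrow> 'k" where
  "S' f k l =
    (if k = p then if l = p then q * f p p else if l = m then r * f m p else f l p
     else if k = m then
       if l = p then r * f p m + (q - r) * (1 - b * r) * f m p - (q - r) * cap f
       else if l = m then q * f m m else f l m + (q - r) * f m l
     else if l = p then f p k + (q - r) * f k p
     else if l = m then f m k
     else S f k l - (q - r) * b * r * f m p * cup k l)"

lemma new_distinct: "i \<in> I \<Longrightarrow> i \<noteq> p" "i \<in> I \<Longrightarrow> i \<noteq> m" "i \<in> I \<Longrightarrow> p \<noteq> i" "i \<in> I \<Longrightarrow> m \<noteq> i" "p \<noteq> m" "m \<noteq> p"
  using p m pm by auto

lemma S'_simps: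
  "S' f p p = q * f p p"
  "S' f m m = q * f m m"
  "S' f p m = r * f m p"
  "S' f m p = r * f p m + (q - r) * (1 - b * r) * f m p - (q - r) * cap f"
  "u \<in> I \<Longrightarrow> S' f p u = f u p"
  "u \<in> I \<Longrightarrow> S' f u p = f p u + (q - r) * f u p"
  "u \<in> I \<Longrightarrow> S' f m u = f u m + (q - r) * f m u"
  "u \<in> I \<Longrightarrow> S' f u m = f m u"
  "u \<in> I \<Longrightarrow> v \<in> I \<Longrightarrow> S' f u v = S f u v - (q - r) * b * r * f m p * cup u v"
  by (auto simp: S'_def new_distinct)

lemma cup'_simps:
  "cup_vec c' bar' p p = 0"
  "cup_vec c' bar' m m = 0"
  "cup_vec c' bar' p m = a * q"
  "cup_vec c' bar' m p = 1"
  "u \<in> I \<Longrightarrow> cup_vec c' bar' p u = 0"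
  "u \<in> I \<Longrightarrow> cup_vec c' bar' u p = 0"
  "u \<in> I \<Longrightarrow> cup_vec c' bar' m u = 0"
  "u \<in> I \<Longrightarrow> cup_vec c' bar' u m = 0"
  "u \<in> I \<Longrightarrow> v \<in> I \<Longrightarrow> cup_vec c' bar' u v = cup u v"
  using bar_in[of u] p m by (auto simp: cup_vec_def bar'_def c'_def new_distinct inverse_unique[of b a] inverse_unique[of r q] qr ab mult.commute)

lemma cap'_simp: "cap_form I' c' bar' f = f p m + b * r * f m p + cap f"
proof -
  have "(\<Sum>i\<in>I. c' i * f i (bar' i)) = cap f"
    unfolding cap_form_def by (rule sum.cong) (auto simp: c'_def bar'_def new_distinct)
  then show ?thesis
    using fin p m pm by (simp add: cap_form_def I'_def) (simp add: c'_def bar'_def)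
qed

lemmas extension_simps = S'_simps linear tangle qr ab qr' ab' algebra_simps

lemma I'_cases:
  assumes "k \<in> I'" obtains "k = p" | "k = m" | "k \<in> I"
  using assms by (auto simp: I'_def)

lemma I'_mem: "p \<in> I'" "m \<in> I'" "i \<in> I \<Longrightarrow> i \<in> I'"
  by (auto simp: I'_def)

lemma S'_cong:
  assumes "\<And>i j. i \<in> I' \<Longrightarrow> j \<in> I' \<Longrightarrow> f i j = g i j" "k \<in> I'" "l \<in> I'"
  shows "S' f k l = S' g k l"
  using assms(2,3)
  by (elim I'_cases; simp add: S'_simps assms(1) I'_mem)

lemma S'_add:
  assumes "k \<in> I'" "l \<in> I'"
  shows "S' (\<lambda>i j. f i j + g i j) k l = S' f k l + S' g k l"
  using assms by (elim I'_cases; simp add: S'_simps linear algebra_simps)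

lemma S'_scale:
  assumes "k \<in> I'" "l \<in> I'"
  shows "S' (\<lambda>i j. x * f i j) k l = x * S' f k l"
  using assms by (elim I'_cases; simp add: S'_simps linear algebra_simps)

lemma pivot'_simps:
  "pivot c' bar' p = a * q" "pivot c' bar' m = b * r"
  "i \<in> I \<Longrightarrow> pivot c' bar' i = pivot c bar i"
  using bar_in[of i] by (auto simp: pivot_def c'_def bar'_def new_distinct inverse_unique[of b a] inverse_unique[of r q] qr ab mult.commute)

lemma S'_pivot:
  assumes "k \<in> I'" "l \<in> I'"
  shows "S' (\<lambda>i j. pivot c' bar' i * pivot c' bar' j * f i j) k l = pivot c' bar' k * pivot c' bar' l * S' f k l"
  using assms
  by (elim I'_cases; simp add: S'_simps pivot'_simps S_pivot cap_pivot;
      simp add: cup_pivot algebra_simps qr ab qr' ab' S_pivot)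

lemma S'_S':
  assumes "k \<in> I'" "l \<in> I'"
  shows "S' (S' f) k l = f k l + (q - r) * S' f k l
           - (q - r) * (b * r * r) * (cap_form I' c' bar' f * cup_vec c' bar' k l)"
  using assms by (elim I'_cases; simp add: extension_simps cap_cup_simps cap'_simp cup'_simps)

lemma S'_cup:
  assumes "k \<in> I'" "l \<in> I'"
  shows "S' (cup_vec c' bar') k l = b * r * r * cup_vec c' bar' k l"
  using assms by (elim I'_cases; simp add: extension_simps cap_cup_simps cap'_simp cup'_simps)

lemma cap'_S': "cap_form I' c' bar' (S' f) = b * r * r * cap_form I' c' bar' f"
  by (simp add: extension_simps cap_cup_simps cap'_simp)

lemma cap'_cup': "(q - r) * cap_form I' c' bar' (cup_vec c' bar') = a * q * q - b * r * r + q - r"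
  by (simp add: extension_simps cap_cup_simps cap'_simp cup'_simps)

lemma rot_cup':
  assumes "k \<in> I'" "l \<in> I'" "n \<in> I'"
  shows "S' (\<lambda>i j. cup_vec c' bar' k i * h j) l n = S' (\<lambda>i j. h i * cup_vec c' bar' j n) k l
          + (q - r) * (cup_vec c' bar' k l * h n - h k * cup_vec c' bar' l n)"
  using assms by (elim I'_cases; simp add: extension_simps cap_cup_simps cap'_simp cup'_simps)

lemma rot_cap':
  assumes "k \<in> I'"
  shows "cap_form I' c' bar' (\<lambda>i j. S' (F i) j k) = cap_form I' c' bar' (\<lambda>i j. S' (\<lambda>x y. F x y j) k i)
          + (q - r) * (cap_form I' c' bar' (\<lambda>i j. F i j k) - cap_form I' c' bar' (F k))"
  using assms by (elim I'_cases; simp add: extension_simps cap_cup_simps cap'_simp cup'_simps)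

text \<open>Deciding which of the three output labels are new leaves identities over the smaller
  space: slides across caps and cups, kinks and loops. The old braid relation enters when all three
  labels are old.\<close>

lemma braid':
  assumes "k \<in> I'" "l \<in> I'" "n \<in> I'"
  shows "S' (\<lambda>k l. S' (\<lambda>l m. S' (\<lambda>k l. F k l m) k l) l n) k l =
        S' (\<lambda>l m. S' (\<lambda>k l. S' (\<lambda>l m. F k l m) l m) k l) l n"
  \<comment> \<open>A case is either closed by the first simplification, which eliminates
    \<open>q\<close> times the loop, or left untouched for the second one, which has
    \<open>braid\<close> in place of the loop rule.\<close>
  using assms by (elim I'_cases; (simp add: extension_simps cap_cup_simp; fail)?; simp add: extension_simps braid)

lemma extension: "kauffman_matrix q r (a * q * q) (b * r * r) I' S' c' bar'"
proof
  show "q * r = 1" by (rule qr)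
  show "a * q * q * (b * r * r) = 1" by (simp add: algebra_simps qr ab qr' ab')
  show "finite I'" using fin by (simp add: I'_def)
  show "bar' i \<in> I'" if "i \<in> I'" for i
    using that bar_in by (auto simp: I'_def bar'_def)
  show "bar' (bar' i) = i" if "i \<in> I'" for i
    using that bar_in[of i] p m pm by (auto simp: I'_def bar'_def bar_bar)
  show "c' i \<noteq> 0" if "i \<in> I'" for i
    using that c_nz qr ab by (auto simp: I'_def c'_def)
qed (fact S'_cong S'_add S'_scale S'_pivot S'_S' S'_cup cap'_S' cap'_cup' rot_cup' rot_cap' braid' | assumption)+

end

text \<open>The space of dimension 0, where \<open>a = q\<^sup>-\<^sup>1\<close>; each extension multiplies a by \<open>q\<^sup>2\<close>.\<close>

lemma kauffman_matrix_empty: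
  fixes q r :: "'k::field" assumes "q * r = 1"
  shows "kauffman_matrix q r r q {} (\<lambda>f k l. 0) (\<lambda>_. 1) id"
  using assms by unfold_locales (auto simp: cap_form_def mult.commute)

lemma kauffman_matrix_exists:
  fixes q r :: "'k::field"
  assumes "q * r = 1" "infinite (UNIV :: 'i set)"
  shows "\<exists>(I :: 'i set) S c bar. kauffman_matrix q r (q ^ (2 * n) * r) (r ^ (2 * n) * q) I S c bar"
proof (induction n)
  case 0
  then show ?case using kauffman_matrix_empty[OF assms(1)] by auto
next
  case (Suc n)
  then obtain I :: "'i set" and S c bar
    where K: "kauffman_matrix q r (q ^ (2 * n) * r) (r ^ (2 * n) * q) I S c bar"
    by blast
  have fin: "finite I" by (rule kauffman_matrix.fin[OF K])
  obtain p where p: "p \<notin> I" using ex_new_if_finite[OF assms(2) fin] by blast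
  obtain m where m: "m \<notin> insert p I" using ex_new_if_finite[OF assms(2)] fin by blast
  from K p m have "kauffman_extension q r (q ^ (2 * n) * r) (r ^ (2 * n) * q) I S c bar p m"
    by (auto simp: kauffman_extension_def kauffman_extension_axioms_def)
  from kauffman_extension.extension[OF this] show ?case
    by (auto simp: algebra_simps)
qed

section \<open>Action on tensor powers and its trace\<close>

context kauffman_matrix begin

text \<open>Operators act on functions of arbitrary labels, hence the congruence clause for labels
  in \<open>I\<close>. Commuting with the pivot on both factors is what makes the weighted trace
  cyclic later.\<close>

definition local_operator :: "(('i \<Rightarrow> 'i \<Rightarrow> 'k) \<Rightarrow> 'i \<Rightarrow> 'i \<Rightarrow> 'k) \<Rightarrow> bool" where
  "local_operator T \<longleftrightarrow>
     (\<forall>f g. \<forall>k\<in>I. \<forall>l\<in>I. (\<forall>i\<in>I. \<forall>j\<in>I. f i j = g i j) \<longrightarrow> T f k l = T g k l) \<and>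
     (\<forall>f g. \<forall>k\<in>I. \<forall>l\<in>I. T (\<lambda>i j. f i j + g i j) k l = T f k l + T g k l) \<and>
     (\<forall>f x. \<forall>k\<in>I. \<forall>l\<in>I. T (\<lambda>i j. x * f i j) k l = x * T f k l) \<and>
     (\<forall>f. \<forall>k\<in>I. \<forall>l\<in>I. T (\<lambda>i j. pivot c bar i * pivot c bar j * f i j) k l
                 = pivot c bar k * pivot c bar l * T f k l)"

lemma
  assumes "local_operator T" "k \<in> I" "l \<in> I"
  shows local_cong: "(\<And>i j. i \<in> I \<Longrightarrow> j \<in> I \<Longrightarrow> f i j = g i j) \<Longrightarrow> T f k l = T g k l"
    and local_add: "T (\<lambda>i j. f i j + g i j) k l = T f k l + T g k l"
    and local_scale: "T (\<lambda>i j. x * f i j) k l = x * T f k l"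
    and local_pivot: "T (\<lambda>i j. pivot c bar i * pivot c bar j * f i j) k l
                 = pivot c bar k * pivot c bar l * T f k l"
  using assms unfolding local_operator_def by blast+

definition E :: "('i \<Rightarrow> 'i \<Rightarrow> 'k) \<Rightarrow> 'i \<Rightarrow> 'i \<Rightarrow> 'k" where
  "E f k l = cap f * cup k l"

text \<open>The definition of \<open>fa_e\<close> solved for the inverse generator, with
  \<open>E\<close> in the role of \<open>fa_e\<close>.\<close>

definition Sinv :: "('i \<Rightarrow> 'i \<Rightarrow> 'k) \<Rightarrow> 'i \<Rightarrow> 'i \<Rightarrow> 'k" where
  "Sinv f k l = S f k l - (q - r) * (f k l - E f k l)"

lemma local_S: "local_operator S"
  using S_cong S_add S_scale S_pivot unfolding local_operator_def by auto

lemma local_Sinv: "local_operator Sinv"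
proof -
  have "Sinv (\<lambda>i j. pivot c bar i * pivot c bar j * f i j) k l = pivot c bar k * pivot c bar l * Sinv f k l"
    if "k \<in> I" "l \<in> I" for f k l
    unfolding Sinv_def E_def S_pivot[OF that] cap_pivot
    using that by (simp add: algebra_simps cup_pivot)
  moreover have "Sinv f k l = Sinv g k l"
    if "k \<in> I" "l \<in> I" "\<forall>i\<in>I. \<forall>j\<in>I. f i j = g i j" for f g k l
    using that S_cong[of f g k l] cap_cong[of f g] by (simp add: Sinv_def E_def)
  ultimately show ?thesis
    unfolding local_operator_def by (simp add: Sinv_def E_def linear algebra_simps)
qed

lemma S_Sinv: "k \<in> I \<Longrightarrow> l \<in> I \<Longrightarrow> S (Sinv f) k l = f k l"
  unfolding Sinv_def E_def by (simp add: linear tangle algebra_simps)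

lemma Sinv_S: "k \<in> I \<Longrightarrow> l \<in> I \<Longrightarrow> Sinv (S f) k l = f k l"
  unfolding Sinv_def E_def by (simp add: linear tangle algebra_simps)

lemma E_S: "E (S f) k l = b * E f k l"
  unfolding E_def by (simp add: tangle)

lemma cap_cup_simp_right: "q * (x * (cap cup * y)) = r * (x * (cap cup * y)) + x * (a - b + q - r) * y"
  using cap_cup_simp[of "x * y"] by (simp only: mult_ac)

text \<open>As for the kink, \<open>rot_cup\<close> puts the middle crossing under the outer cap,
  and the value of the loop turns b into a.\<close>

lemma E_S_E: "k \<in> I \<Longrightarrow> l \<in> I \<Longrightarrow> m \<in> I \<Longrightarrow>
  E (\<lambda>k l. S (\<lambda>l m. E (\<lambda>k l. F k l m) k l) l m) k l = a * E (\<lambda>k l. F k l m) k l"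
  unfolding E_def by (simp add: linear tangle algebra_simps cap_cup_simp_right)

lemma E_Sinv_E: "k \<in> I \<Longrightarrow> l \<in> I \<Longrightarrow> m \<in> I \<Longrightarrow>
  E (\<lambda>k l. Sinv (\<lambda>l m. E (\<lambda>k l. F k l m) k l) l m) k l = b * E (\<lambda>k l. F k l m) k l"
  unfolding E_def Sinv_def by (simp add: linear tangle algebra_simps cap_cup_simp_right)

lemma cup_bar: "y \<in> I \<Longrightarrow> j \<in> I \<Longrightarrow> cup y (bar j) = (if y = j then inverse (c (bar j)) else 0)"
  unfolding cup_vec_def by (metis bar_bar)

text \<open>This is the kink \<open>cap_S_cup\<close> in coordinates: a cup ending in
  \<open>bar j\<close> is the indicator of j divided by \<open>c (bar j)\<close>, which turns the
  weight \<open>c j\<close> of the cap into \<open>pivot c bar j\<close>.\<close>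

lemma partial_trace_S:
  assumes k: "k \<in> I"
  shows "(\<Sum>j\<in>I. pivot c bar j * S (\<lambda>u v. if v = j then h u else 0) k j) = a * h k"
proof -
  have "c j * S (\<lambda>x y. h x * cup y (bar j)) k j = pivot c bar j * S (\<lambda>u v. if v = j then h u else 0) k j"
    if j: "j \<in> I" for j
  proof -
    have "S (\<lambda>x y. h x * cup y (bar j)) k j = S (\<lambda>u v. inverse (c (bar j)) * (if v = j then h u else 0)) k j"
      using j k by (intro S_cong) (auto simp: cup_bar)
    then show ?thesis using j k by (simp add: S_scale pivot_def)
  qed
  then show ?thesis
    using cap_S_cup[OF k, of h] by (simp add: cap_form_def)
qed

lemma partial_trace_1: "(q - r) * (\<Sum>j\<in>I. pivot c bar j) = a - b + q - r"
proof -
  have "cap cup = (\<Sum>j\<in>I. pivot c bar j)"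
    unfolding cap_form_def by (rule sum.cong) (auto simp: pivot_def cup_bar)
  then show ?thesis using cap_cup by simp
qed

text \<open>By the skein relation \<open>Sinv\<close> is a combination of \<open>S\<close>, the
  identity and \<open>E\<close>, whose partial traces are a, the loop and 1; hence
  \<open>a - (a - b + q - r) + (q - r) = b\<close>.\<close>

lemma partial_trace_Sinv:
  assumes k: "k \<in> I"
  shows "(\<Sum>j\<in>I. pivot c bar j * Sinv (\<lambda>u v. if v = j then h u else 0) k j) = b * h k"
proof -
  have "(\<Sum>j\<in>I. pivot c bar j * E (\<lambda>u v. if v = j then h u else 0) k j) =
     (\<Sum>j\<in>I. if bar k = j then h k else 0)"
  proof (rule sum.cong[OF refl])
    fix j assume j: "j \<in> I"
    have "cap (\<lambda>u v. if v = j then h u else 0) = (\<Sum>i\<in>I. if i = bar j then c i * h i else 0)"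
      unfolding cap_form_def by (rule sum.cong) (use j bar_bar in auto)
    also have "\<dots> = c (bar j) * h (bar j)"
      using fin j bar_in by simp
    finally show "pivot c bar j * E (\<lambda>u v. if v = j then h u else 0) k j = (if bar k = j then h k else 0)"
      using j k c_nz[OF j] c_nz[OF bar_in[OF j]] by (auto simp: E_def pivot_def cup_vec_def bar_bar field_simps)
  qed
  also have "\<dots> = h k" using fin bar_in[OF k] by simp
  finally have 1: "(\<Sum>j\<in>I. pivot c bar j * E (\<lambda>u v. if v = j then h u else 0) k j) = h k" .
  have "(\<Sum>j\<in>I. pivot c bar j * Sinv (\<lambda>u v. if v = j then h u else 0) k j) =
     (\<Sum>j\<in>I. pivot c bar j * S (\<lambda>u v. if v = j then h u else 0) k j)
      - (q - r) * (\<Sum>j\<in>I. pivot c bar j) * h k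
      + (q - r) * (\<Sum>j\<in>I. pivot c bar j * E (\<lambda>u v. if v = j then h u else 0) k j)"
    unfolding Sinv_def by (simp add: algebra_simps sum.distrib sum_subtractf sum_distrib_left)
  then show ?thesis
    unfolding partial_trace_S[OF k] partial_trace_1 1 by (simp add: algebra_simps)
qed

section \<open>Action of braid words on tensor powers\<close>

definition confs :: "nat \<Rightarrow> (nat \<Rightarrow> 'i) set" where
  "confs n = (\<Pi>\<^sub>E i\<in>{1..n}. I)"

lemma finite_confs: "finite (confs n)"
  unfolding confs_def using fin by (simp add: finite_PiE)

lemma confs_mem: "x \<in> confs n \<Longrightarrow> 1 \<le> i \<Longrightarrow> i \<le> n \<Longrightarrow> x i \<in> I"
  unfolding confs_def by auto

lemma confs_upd: "x \<in> confs n \<Longrightarrow> 1 \<le> i \<Longrightarrow> i \<le> n \<Longrightarrow> u \<in> I \<Longrightarrow> x(i := u) \<in> confs n"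
  unfolding confs_def by (auto simp: PiE_def extensional_def)

lemma confs_mem': "x \<in> confs n \<Longrightarrow> 1 \<le> i \<Longrightarrow> i < n \<Longrightarrow> x i \<in> I"
  "x \<in> confs n \<Longrightarrow> 1 \<le> i \<Longrightarrow> i < n \<Longrightarrow> x (Suc i) \<in> I"
  by (auto intro: confs_mem)

lemma confs_upd2: "x \<in> confs n \<Longrightarrow> 1 \<le> i \<Longrightarrow> i < n \<Longrightarrow> u \<in> I \<Longrightarrow> v \<in> I \<Longrightarrow> x(i := u, Suc i := v) \<in> confs n"
  by (intro confs_upd) auto

text \<open>Tensors are coordinate functions on labelings of all positions, so that one definition
  serves every n; the congruence lemmas confine attention to \<open>confs n\<close>.\<close>

definition act :: "nat \<Rightarrow> (('i \<Rightarrow> 'i \<Rightarrow> 'k) \<Rightarrow> 'i \<Rightarrow> 'i \<Rightarrow> 'k) \<Rightarrow> ((nat \<Rightarrow> 'i) \<Rightarrow> 'k) \<Rightarrow> (nat \<Rightarrow> 'i) \<Rightarrow> 'k" where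
  "act i T F x = T (\<lambda>u v. F (x(i := u, Suc i := v))) (x i) (x (Suc i))"

fun letter_op :: "letter \<Rightarrow> ((nat \<Rightarrow> 'i) \<Rightarrow> 'k) \<Rightarrow> (nat \<Rightarrow> 'i) \<Rightarrow> 'k" where
  "letter_op (Gen i) = act i S"
| "letter_op (GenInv i) = act i Sinv"

definition letter_local :: "letter \<Rightarrow> ('i \<Rightarrow> 'i \<Rightarrow> 'k) \<Rightarrow> 'i \<Rightarrow> 'i \<Rightarrow> 'k" where
  "letter_local l = (case l of Gen _ \<Rightarrow> S | GenInv _ \<Rightarrow> Sinv)"

lemma letter_op_act: "letter_op l = act (letter_index l) (letter_local l)"
  by (cases l) (auto simp: letter_local_def)

lemma local_letter: "local_operator (letter_local l)"
  by (cases l) (auto simp: letter_local_def local_S local_Sinv)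

primrec word_op :: "letter list \<Rightarrow> ((nat \<Rightarrow> 'i) \<Rightarrow> 'k) \<Rightarrow> (nat \<Rightarrow> 'i) \<Rightarrow> 'k" where
  "word_op [] F = F"
| "word_op (l # ls) F = letter_op l (word_op ls F)"

lemma word_op_append: "word_op (us @ vs) F = word_op us (word_op vs F)"
  by (induction us) auto

lemma
  assumes T: "local_operator T" and x: "x \<in> confs n" "1 \<le> i" "i < n"
  shows act_cong: "(\<And>y. y \<in> confs n \<Longrightarrow> F y = G y) \<Longrightarrow> act i T F x = act i T G x"
    and act_add: "act i T (\<lambda>y. F y + G y) x = act i T F x + act i T G x"
    and act_scale: "act i T (\<lambda>y. s * F y) x = s * act i T F x"
  unfolding act_def
  using confs_mem'[OF x] confs_upd2[OF x]
  by (auto intro!: local_cong[OF T] local_add[OF T] local_scale[OF T])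

text \<open>The diagonal of the n-th tensor power of the pivotal element.\<close>

definition pivots :: "nat \<Rightarrow> (nat \<Rightarrow> 'i) \<Rightarrow> 'k" where
  "pivots n x = (\<Prod>i\<in>{1..n}. pivot c bar (x i))"

lemma pivots_upd2:
  assumes "1 \<le> i" "i < n"
  shows "pivots n (x(i := u, Suc i := v)) =
    (\<Prod>j\<in>{1..n} - {i, Suc i}. pivot c bar (x j)) * (pivot c bar u * pivot c bar v)"
proof -
  have "{1..n} = insert i (insert (Suc i) ({1..n} - {i, Suc i}))" using assms by auto
  then have "pivots n (x(i := u, Suc i := v)) =
     (\<Prod>j\<in>insert i (insert (Suc i) ({1..n} - {i, Suc i})). pivot c bar ((x(i := u, Suc i := v)) j))"
    unfolding pivots_def by metis
  also have "\<dots> = pivot c bar u * (pivot c bar v * (\<Prod>j\<in>{1..n} - {i, Suc i}. pivot c bar ((x(i := u, Suc i := v)) j)))"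
    by simp
  also have "(\<Prod>j\<in>{1..n} - {i, Suc i}. pivot c bar ((x(i := u, Suc i := v)) j)) = (\<Prod>j\<in>{1..n} - {i, Suc i}. pivot c bar (x j))"
    by (rule prod.cong) auto
  finally show ?thesis by (simp only: mult_ac)
qed

lemma act_pivots:
  assumes T: "local_operator T" and x: "x \<in> confs n" "1 \<le> i" "i < n"
  shows "act i T (\<lambda>y. pivots n y * F y) x = pivots n x * act i T F x"
proof -
  let ?P = "\<Prod>j\<in>{1..n} - {i, Suc i}. pivot c bar (x j)"
  have "act i T (\<lambda>y. pivots n y * F y) x = T (\<lambda>u v. ?P * (pivot c bar u * pivot c bar v * F (x(i := u, Suc i := v)))) (x i) (x (Suc i))"
    unfolding act_def pivots_upd2[OF x(2,3)] by (simp only: mult.assoc)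
  also have "\<dots> = ?P * (pivot c bar (x i) * pivot c bar (x (Suc i))) * act i T F x"
    unfolding local_scale[OF T confs_mem'[OF x]] local_pivot[OF T confs_mem'[OF x]] act_def
    by (simp only: mult.assoc)
  also have "\<dots> = pivots n x * act i T F x"
    using pivots_upd2[OF x(2,3), of x "x i" "x (Suc i)"] by simp
  finally show ?thesis .
qed

text \<open>Matrix entries of an abstract local operator. They turn a product of two operators at
  distant positions into a double sum, whose order of summation can be exchanged in
  \<open>act_commute\<close>.\<close>

lemma local_kernel:
  assumes T: "local_operator T" and k: "k \<in> I" "l \<in> I"
  shows "T f k l = (\<Sum>p\<in>I \<times> I. f (fst p) (snd p) * T (\<lambda>u v. if u = fst p \<and> v = snd p then 1 else 0) k l)"
proof -
  have zero: "T (\<lambda>i j. 0) k l = 0"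
    using local_scale[OF T k, of 0 "\<lambda>_ _. 0"] by simp
  have sum: "T (\<lambda>u v. \<Sum>p\<in>A. g p u v) k l = (\<Sum>p\<in>A. T (g p) k l)" if "finite A" for A :: "('i \<times> 'i) set" and g
    using that by induction (simp_all add: zero local_add[OF T k])
  have "T f k l = T (\<lambda>u v. \<Sum>p\<in>I \<times> I. f (fst p) (snd p) * (if u = fst p \<and> v = snd p then 1 else 0)) k l"
  proof (rule local_cong[OF T k])
    fix i j assume ij: "i \<in> I" "j \<in> I"
    have "(\<Sum>p\<in>I \<times> I. f (fst p) (snd p) * (if i = fst p \<and> j = snd p then 1 else 0)) =
          (\<Sum>p\<in>I \<times> I. if (i, j) = p then f i j else 0)"
      by (rule sum.cong) auto
    then show "f i j = (\<Sum>p\<in>I \<times> I. f (fst p) (snd p) * (if i = fst p \<and> j = snd p then 1 else 0))"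
      using ij fin by simp
  qed
  also have "\<dots> = (\<Sum>p\<in>I \<times> I. f (fst p) (snd p) * T (\<lambda>u v. if u = fst p \<and> v = snd p then 1 else 0) k l)"
    using fin by (simp add: sum local_scale[OF T k])
  finally show ?thesis .
qed

lemma act_commute:
  assumes T: "local_operator T" "local_operator U" and x: "x \<in> confs n" "1 \<le> i" "i < n" "1 \<le> j" "j < n"
    and far: "2 \<le> \<bar>int i - int j\<bar>"
  shows "act i T (act j U F) x = act j U (act i T F) x"
proof -
  have ne: "i \<noteq> j" "Suc i \<noteq> j" "i \<noteq> Suc j" "j \<noteq> i" "Suc j \<noteq> i" "j \<noteq> Suc i" using far by auto
  note mi = confs_mem'[OF x(1,2,3)] and mj = confs_mem'[OF x(1,4,5)]
  let ?t = "\<lambda>p. T (\<lambda>u v. if u = fst p \<and> v = snd p then 1 else 0) (x i) (x (Suc i))"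
  let ?u = "\<lambda>p. U (\<lambda>u v. if u = fst p \<and> v = snd p then 1 else 0) (x j) (x (Suc j))"
  let ?F = "\<lambda>p p'. F (x(i := fst p, Suc i := snd p, j := fst p', Suc j := snd p'))"
  have eq: "x(j := u', Suc j := v', i := u, Suc i := v) = x(i := u, Suc i := v, j := u', Suc j := v')" for u v u' v'
    using ne by (auto simp: fun_eq_iff)
  have 1: "act i T (act j U F) x = (\<Sum>p\<in>I \<times> I. \<Sum>p'\<in>I \<times> I. ?F p p' * ?u p' * ?t p)"
    unfolding act_def using ne
    by (subst local_kernel[OF T(1) mi])
       (simp add: local_kernel[OF T(2) mj, of "\<lambda>u v. F (x(i := _, Suc i := _, j := u, Suc j := v))"] sum_distrib_right)
  have 2: "act j U (act i T F) x = (\<Sum>p'\<in>I \<times> I. \<Sum>p\<in>I \<times> I. ?F p p' * ?t p * ?u p')"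
    unfolding act_def using ne
    by (subst local_kernel[OF T(2) mj])
       (simp add: eq local_kernel[OF T(1) mi, of "\<lambda>u v. F (x(i := u, Suc i := v, j := _, Suc j := _))"] sum_distrib_right)
  show ?thesis
    unfolding 1 2 by (subst sum.swap) (simp only: mult_ac)
qed

end

lemma FA_induct [consumes 1, case_names zero add single]:
  assumes "f \<in> carrier (FA n)"
    and "P 0"
    and "\<And>f g. f \<in> carrier (FA n) \<Longrightarrow> g \<in> carrier (FA n) \<Longrightarrow> P f \<Longrightarrow> P g \<Longrightarrow> P (f + g)"
    and "\<And>w s. w \<in> words n \<Longrightarrow> P (Poly_Mapping.single w s)"
  shows "P f"
proof -
  have 1: "P (\<Sum>w\<in>A. Poly_Mapping.single w (s w)) \<and> (\<Sum>w\<in>A. Poly_Mapping.single w (s w)) \<in> carrier (FA n)"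
    if "finite A" "A \<subseteq> words n" for A and s :: "braid_word \<Rightarrow> scalar"
    using that
  proof induction
    case empty
    then show ?case using assms(2) by (simp add: FA_closed)
  next
    case (insert w A)
    moreover have "Poly_Mapping.single w (s w) \<in> carrier (FA n)"
      using insert by (auto simp: FA_carrier)
    ultimately show ?case
      using assms(3,4) by (simp add: FA_closed)
  qed
  have "f = (\<Sum>w\<in>Poly_Mapping.keys f. Poly_Mapping.single w (Poly_Mapping.lookup f w))"
    by (rule poly_mapping_eqI)
       (auto simp: lookup_sum lookup_single when_def in_keys_iff sum.If_cases)
  then show ?thesis
    using 1[of "Poly_Mapping.keys f" "Poly_Mapping.lookup f"] assms(1) by (auto simp: FA_carrier)
qed

lemma FA_Suc: "f \<in> carrier (FA n) \<Longrightarrow> f \<in> carrier (FA (Suc n))"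
  using FA_mono[of f n] by simp

section \<open>Representation of the free algebra over specialized scalars\<close>

locale kauffman_specialization = kauffman_matrix q r a b I S c bar
  for q r a b :: "'k::field" and I :: "'i set" and S c bar +
  fixes ev :: "scalar \<Rightarrow> 'k"
  assumes ev_1: "ev 1 = 1" and ev_add: "ev (s + t) = ev s + ev t" and ev_mult: "ev (s * t) = ev s * ev t"
    and ev_a: "ev sc_a = a" and ev_q: "ev sc_q = q"
begin

lemma ev_0: "ev 0 = 0"
proof -
  have "ev 0 + ev 0 = ev 0 + 0" by (simp flip: ev_add)
  then show ?thesis by (rule add_left_imp_eq)
qed

lemma ev_uminus: "ev (- s) = - ev s"
  using ev_add[of s "- s"] by (simp add: ev_0 eq_neg_iff_add_eq_0 add.commute)

lemma ev_diff: "ev (s - t) = ev s - ev t"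
  using ev_add[of s "- t"] by (simp add: ev_uminus)

lemma ev_q_inv: "ev sc_q_inv = r"
  using arg_cong[OF sc_q_inverse, of ev] qr by (simp add: ev_mult ev_1 ev_q) (metis mult.left_commute mult_1_right)

lemma ev_a_inv: "ev sc_a_inv = b"
  using arg_cong[OF sc_a_inverse, of ev] ab by (simp add: ev_mult ev_1 ev_a) (metis mult.left_commute mult_1_right)

lemma ev_z_inv: "(q - r) * ev sc_z_inv = 1"
  using arg_cong[OF sc_z_inverse, of ev] by (simp add: ev_mult ev_1 ev_diff ev_q ev_q_inv)

lemma
  assumes w: "w \<in> words n" and x: "x \<in> confs n"
  shows word_cong: "(\<And>y. y \<in> confs n \<Longrightarrow> F y = G y) \<Longrightarrow> word_op (letters w) F x = word_op (letters w) G x"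
    and word_add: "word_op (letters w) (\<lambda>y. F y + G y) x = word_op (letters w) F x + word_op (letters w) G x"
    and word_scale: "word_op (letters w) (\<lambda>y. s * F y) x = s * word_op (letters w) F x"
    and word_pivots: "word_op (letters w) (\<lambda>y. pivots n y * F y) x = pivots n x * word_op (letters w) F x"
proof -
  have idx: "\<forall>l\<in>set (letters w). 1 \<le> letter_index l \<and> letter_index l < n"
    using w by (auto simp: words_def)
  have 1: "(\<forall>y\<in>confs n. F y = G y) \<longrightarrow> (\<forall>x\<in>confs n. word_op ls F x = word_op ls G x)"
    if "\<forall>l\<in>set ls. 1 \<le> letter_index l \<and> letter_index l < n" for ls
    using that
    by (induction ls) (auto simp: letter_op_act intro!: act_cong[OF local_letter])
  then show "word_op (letters w) F x = word_op (letters w) G x" if "\<And>y. y \<in> confs n \<Longrightarrow> F y = G y"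
    using idx x that by blast
  have "\<forall>x\<in>confs n. word_op ls (\<lambda>y. F y + G y) x = word_op ls F x + word_op ls G x"
    if "\<forall>l\<in>set ls. 1 \<le> letter_index l \<and> letter_index l < n" for ls
    using that
  proof (induction ls)
    case (Cons l ls)
    show ?case
    proof
      fix x assume x: "x \<in> confs n"
      have "letter_op l (word_op ls (\<lambda>y. F y + G y)) x = letter_op l (\<lambda>y. word_op ls F y + word_op ls G y) x"
        unfolding letter_op_act using x Cons by (intro act_cong[OF local_letter]) auto
      also have "\<dots> = letter_op l (word_op ls F) x + letter_op l (word_op ls G) x"
        unfolding letter_op_act using x Cons by (intro act_add[OF local_letter]) auto
      finally show "word_op (l # ls) (\<lambda>y. F y + G y) x = word_op (l # ls) F x + word_op (l # ls) G x" by simp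
    qed
  qed simp
  then show "word_op (letters w) (\<lambda>y. F y + G y) x = word_op (letters w) F x + word_op (letters w) G x"
    using idx x by blast
  have "\<forall>x\<in>confs n. word_op ls (\<lambda>y. s * F y) x = s * word_op ls F x"
    if "\<forall>l\<in>set ls. 1 \<le> letter_index l \<and> letter_index l < n" for ls
    using that
  proof (induction ls)
    case (Cons l ls)
    show ?case
    proof
      fix x assume x: "x \<in> confs n"
      have "letter_op l (word_op ls (\<lambda>y. s * F y)) x = letter_op l (\<lambda>y. s * word_op ls F y) x"
        unfolding letter_op_act using x Cons by (intro act_cong[OF local_letter]) auto
      also have "\<dots> = s * letter_op l (word_op ls F) x"
        unfolding letter_op_act using x Cons by (intro act_scale[OF local_letter]) auto
      finally show "word_op (l # ls) (\<lambda>y. s * F y) x = s * word_op (l # ls) F x" by simp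
    qed
  qed simp
  then show "word_op (letters w) (\<lambda>y. s * F y) x = s * word_op (letters w) F x"
    using idx x by blast
  have "\<forall>x\<in>confs n. word_op ls (\<lambda>y. pivots n y * F y) x = pivots n x * word_op ls F x"
    if "\<forall>l\<in>set ls. 1 \<le> letter_index l \<and> letter_index l < n" for ls
    using that
  proof (induction ls)
    case (Cons l ls)
    show ?case
    proof
      fix x assume x: "x \<in> confs n"
      have "letter_op l (word_op ls (\<lambda>y. pivots n y * F y)) x = letter_op l (\<lambda>y. pivots n y * word_op ls F y) x"
        unfolding letter_op_act using x Cons by (intro act_cong[OF local_letter]) auto
      also have "\<dots> = pivots n x * letter_op l (word_op ls F) x"
        unfolding letter_op_act using x Cons by (intro act_pivots[OF local_letter]) auto
      finally show "word_op (l # ls) (\<lambda>y. pivots n y * F y) x = pivots n x * word_op (l # ls) F x" by simp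
    qed
  qed simp
  then show "word_op (letters w) (\<lambda>y. pivots n y * F y) x = pivots n x * word_op (letters w) F x"
    using idx x by blast
qed

definition alg_op :: "free_alg \<Rightarrow> ((nat \<Rightarrow> 'i) \<Rightarrow> 'k) \<Rightarrow> (nat \<Rightarrow> 'i) \<Rightarrow> 'k" where
  "alg_op f F x = (\<Sum>w\<in>Poly_Mapping.keys f. ev (Poly_Mapping.lookup f w) * word_op (letters w) F x)"

lemma alg_op_superset:
  assumes "finite A" "Poly_Mapping.keys f \<subseteq> A"
  shows "alg_op f F x = (\<Sum>w\<in>A. ev (Poly_Mapping.lookup f w) * word_op (letters w) F x)"
  unfolding alg_op_def
  by (rule sum.mono_neutral_left) (use assms in \<open>auto simp: in_keys_iff ev_0\<close>)

lemma alg_op_add: "alg_op (f + g) F x = alg_op f F x + alg_op g F x"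
proof -
  let ?A = "Poly_Mapping.keys f \<union> Poly_Mapping.keys g"
  have "Poly_Mapping.keys (f + g) \<subseteq> ?A" by (rule Poly_Mapping.keys_add)
  then show ?thesis
    by (simp add: alg_op_superset[of ?A] lookup_add ev_add distrib_right sum.distrib)
qed

lemma alg_op_single: "alg_op (Poly_Mapping.single w s) F x = ev s * word_op (letters w) F x"
  by (simp add: alg_op_superset[of "{w}"])

lemma alg_op_0: "alg_op 0 F x = 0"
  by (simp add: alg_op_def)

lemma alg_op_uminus: "alg_op (- f) F x = - alg_op f F x"
  using alg_op_add[of f "- f"] by (simp add: alg_op_0 eq_neg_iff_add_eq_0 add.commute)

lemma alg_op_diff: "alg_op (f - g) F x = alg_op f F x - alg_op g F x"
  using alg_op_add[of f "- g"] by (simp add: alg_op_uminus)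

lemma alg_op_const: "alg_op (fa_const s) F x = ev s * F x"
  by (simp add: fa_const_def alg_op_single zero_braid_word_def)

lemma alg_op_1: "alg_op 1 F x = F x"
  using alg_op_const[of 1] by (simp add: fa_const_def ev_1)

lemma alg_op_gen: "alg_op (fa_gen i) F x = act i S F x" "alg_op (fa_gen_inv i) F x = act i Sinv F x"
  by (simp_all add: fa_gen_def fa_gen_inv_def alg_op_single ev_1)

lemma
  assumes f: "f \<in> carrier (FA n)" and x: "x \<in> confs n"
  shows alg_op_cong: "(\<And>y. y \<in> confs n \<Longrightarrow> F y = G y) \<Longrightarrow> alg_op f F x = alg_op f G x"
    and alg_op_plus: "alg_op f (\<lambda>y. F y + G y) x = alg_op f F x + alg_op f G x"
    and alg_op_scale: "alg_op f (\<lambda>y. s * F y) x = s * alg_op f F x"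
    and alg_op_pivots: "alg_op f (\<lambda>y. pivots n y * F y) x = pivots n x * alg_op f F x"
proof -
  have w: "w \<in> words n" if "w \<in> Poly_Mapping.keys f" for w
    using f that by (auto simp: FA_carrier)
  show "alg_op f F x = alg_op f G x" if "\<And>y. y \<in> confs n \<Longrightarrow> F y = G y"
    unfolding alg_op_def by (intro sum.cong refl) (use w x that word_cong in metis)
  show "alg_op f (\<lambda>y. F y + G y) x = alg_op f F x + alg_op f G x"
    unfolding alg_op_def by (simp add: word_add[OF w x] distrib_left sum.distrib cong: sum.cong)
  show "alg_op f (\<lambda>y. s * F y) x = s * alg_op f F x"
    unfolding alg_op_def by (simp add: word_scale[OF w x] sum_distrib_left mult.left_commute cong: sum.cong)
  show "alg_op f (\<lambda>y. pivots n y * F y) x = pivots n x * alg_op f F x"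
    unfolding alg_op_def by (simp add: word_pivots[OF w x] sum_distrib_left mult.left_commute cong: sum.cong)
qed

lemma alg_op_sum:
  assumes f: "f \<in> carrier (FA n)" and x: "x \<in> confs n" and "finite A"
  shows "alg_op f (\<lambda>y. \<Sum>i\<in>A. G i y) x = (\<Sum>i\<in>A. alg_op f (G i) x)"
  using \<open>finite A\<close>
proof induction
  case empty
  then show ?case using alg_op_scale[OF f x, of 0 "\<lambda>_. 0"] by simp
qed (simp add: alg_op_plus[OF f x])

lemma alg_op_mult:
  assumes f: "f \<in> carrier (FA n)" and g: "g \<in> carrier (FA n)" and x: "x \<in> confs n"
  shows "alg_op (f * g) F x = alg_op f (alg_op g F) x"
  using f
proof (induction rule: FA_induct)
  case (single w s)
  then have s: "Poly_Mapping.single w s \<in> carrier (FA n)" by (auto simp: FA_carrier)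
  show ?case using g
  proof (induction rule: FA_induct)
    case zero
    then show ?case using alg_op_scale[OF s x, of 0 "\<lambda>_. 0"] by (simp add: alg_op_0[abs_def])
  next
    case (add f g)
    then show ?case
      by (simp add: distrib_left alg_op_add[abs_def] alg_op_plus[OF s x])
  next
    case (single v t)
    have "alg_op (Poly_Mapping.single v t) F = (\<lambda>y. ev t * word_op (letters v) F y)"
      by (simp add: fun_eq_iff alg_op_single)
    then have 1: "alg_op (Poly_Mapping.single w s) (alg_op (Poly_Mapping.single v t) F) x
          = ev s * (ev t * word_op (letters w) (word_op (letters v) F) x)"
      by (simp only: alg_op_single word_scale[OF \<open>w \<in> words n\<close> x])
    show ?case
      unfolding 1
      by (simp add: mult_single alg_op_single plus_braid_word_def word_op_append ev_mult mult.assoc)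
  qed
qed (simp_all add: alg_op_0 alg_op_add distrib_right)

lemma alg_op_e: "alg_op (fa_e i) F x = act i E F x"
proof -
  have "fa_e i = Poly_Mapping.single (BWord [GenInv i]) sc_z_inv - Poly_Mapping.single (BWord [Gen i]) sc_z_inv + 1"
    by (simp add: fa_e_def fa_const_def fa_gen_def fa_gen_inv_def right_diff_distrib mult_single)
  then have "alg_op (fa_e i) F x = ev sc_z_inv * (act i Sinv F x - act i S F x) + F x"
    by (simp add: alg_op_add alg_op_1 alg_op_diff alg_op_single right_diff_distrib)
  also have "act i Sinv F x - act i S F x = (q - r) * (act i E F x - F x)"
    by (simp add: act_def Sinv_def algebra_simps)
  finally show ?thesis
    using ev_z_inv by (simp add: mult.commute flip: mult.assoc)
qed

lemma act_comp: "act i T (act i U F) x = act i (\<lambda>f. T (U f)) F x"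
  unfolding act_def by simp

text \<open>Successive updates at overlapping positions collapse to one labeling of three
  neighbours, the shape in which \<open>braid\<close>, \<open>E_S_E\<close> and
  \<open>E_Sinv_E\<close> are stated.\<close>

lemma act_three: "act i T (act (Suc i) U (act i V F)) x =
    T (\<lambda>k l. U (\<lambda>l m. V (\<lambda>k l. F (x(i := k, Suc i := l, Suc (Suc i) := m))) k l) l (x (Suc (Suc i)))) (x i) (x (Suc i))"
   "act (Suc i) T (act i U (act (Suc i) V F)) x =
    T (\<lambda>l m. U (\<lambda>k l. V (\<lambda>l m. F (x(i := k, Suc i := l, Suc (Suc i) := m))) l m) (x i) l) (x (Suc i)) (x (Suc (Suc i)))"
proof -
  have "x(i := u, Suc i := v, Suc i := v', Suc (Suc i) := w, i := u', Suc i := v'') = x(i := u', Suc i := v'', Suc (Suc i) := w)"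
     "x(Suc i := u, Suc (Suc i) := v, i := u', Suc i := v', Suc i := v'', Suc (Suc i) := w) = x(i := u', Suc i := v'', Suc (Suc i) := w)"
    for u v v' w u' v''
    by (auto simp: fun_eq_iff)
  then show "act i T (act (Suc i) U (act i V F)) x =
    T (\<lambda>k l. U (\<lambda>l m. V (\<lambda>k l. F (x(i := k, Suc i := l, Suc (Suc i) := m))) k l) l (x (Suc (Suc i)))) (x i) (x (Suc i))"
   "act (Suc i) T (act i U (act (Suc i) V F)) x =
    T (\<lambda>l m. U (\<lambda>k l. V (\<lambda>l m. F (x(i := k, Suc i := l, Suc (Suc i) := m))) l m) (x i) l) (x (Suc i)) (x (Suc (Suc i)))"
    unfolding act_def by simp_all
qed

lemma relator_zero:
  assumes "f \<in> bmw_relators n" and x: "x \<in> confs n"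
  shows "alg_op f F x = 0"
proof -
  note op = alg_op_diff alg_op_mult[of _ n, OF _ _ x] alg_op_1 alg_op_const FA_closed FA_gen_closed
  note mem = confs_mem'[OF x]
  have three: "x i \<in> I" "x (Suc i) \<in> I" "x (Suc (Suc i)) \<in> I" if "1 \<le> i" "i + 1 < n" for i
    using that confs_mem[OF x] by auto
  have triv: "x(i := k, Suc i := l, Suc (Suc i) := x (Suc (Suc i))) = x(i := k, Suc i := l)" for i k l
    by (auto simp: fun_eq_iff)
  note ops = op alg_op_gen alg_op_gen[abs_def] alg_op_e alg_op_e[abs_def]
  consider i where "f = fa_gen i * fa_gen_inv i - 1" "1 \<le> i" "i < n"
    | i where "f = fa_gen_inv i * fa_gen i - 1" "1 \<le> i" "i < n"
    | i j where "f = fa_gen i * fa_gen j - fa_gen j * fa_gen i"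
        "1 \<le> i" "i < n" "1 \<le> j" "j < n" "2 \<le> \<bar>int i - int j\<bar>"
    | i where "f = fa_gen i * fa_gen (i + 1) * fa_gen i - fa_gen (i + 1) * fa_gen i * fa_gen (i + 1)"
        "1 \<le> i" "i + 1 < n"
    | i where "f = fa_e i * fa_gen i - fa_const sc_a_inv * fa_e i" "1 \<le> i" "i < n"
    | i where "f = fa_e i * fa_gen (i + 1) * fa_e i - fa_const sc_a * fa_e i" "1 \<le> i" "i + 1 < n"
    | i where "f = fa_e i * fa_gen_inv (i + 1) * fa_e i - fa_const sc_a_inv * fa_e i" "1 \<le> i" "i + 1 < n"
    using assms(1) unfolding bmw_relators_def by blast
  then show ?thesis
  proof cases
    case 1
    then show ?thesis using mem
      by (simp add: ops act_comp) (simp add: act_def S_Sinv)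
  next
    case 2
    then show ?thesis using mem
      by (simp add: ops act_comp) (simp add: act_def Sinv_S)
  next
    case 3
    then show ?thesis
      using act_commute[OF local_S local_S x]
      by (simp add: ops)
  next
    case 4
    then show ?thesis using three[of i] braid[of "x i" "x (Suc i)" "x (Suc (Suc i))"]
      by (simp add: ops) (simp add: act_three)
  next
    case 5
    then show ?thesis using mem
      by (simp add: ops act_comp ev_a_inv) (simp add: act_def E_S)
  next
    case 6
    then show ?thesis using three[of i]
      by (simp add: ops ev_a) (simp add: act_three E_S_E, simp add: act_def triv)
  next
    case 7
    then show ?thesis using three[of i]
      by (simp add: ops ev_a_inv) (simp add: act_three E_Sinv_E, simp add: act_def triv)
  qed
qed

text \<open>The elements that act by zero on every tensor form an ideal containing the
  relators.\<close>

lemma ideal_zero: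
  assumes f: "f \<in> bmw_ideal n" and x: "x \<in> confs n"
  shows "alg_op f F x = 0"
proof -
  let ?K = "{f \<in> carrier (FA n). \<forall>F. \<forall>x\<in>confs n. alg_op f F x = 0}"
  have "ideal ?K (FA n)"
  proof (rule idealI[OF FA_ring])
    show "subgroup ?K (add_monoid (FA n))"
    proof (rule group.subgroupI)
      show "group (add_monoid (FA n))"
        using abelian_group.a_group[OF ring.is_abelian_group[OF FA_ring]] .
      show "?K \<noteq> {}" using FA_closed(1)[of n] alg_op_0 by auto
      show "inv\<^bsub>add_monoid (FA n)\<^esub> f \<in> ?K" if "f \<in> ?K" for f
      proof -
        have "inv\<^bsub>add_monoid (FA n)\<^esub> f = - f"
          using that
          by (intro group.inv_equality
                abelian_group.a_group[OF ring.is_abelian_group[OF FA_ring]])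
             (simp_all add: FA_closed)
        then show ?thesis using that by (simp add: FA_closed alg_op_uminus)
      qed
    qed (auto simp: FA_closed alg_op_add)
    show "g \<otimes>\<^bsub>FA n\<^esub> f \<in> ?K" if "f \<in> ?K" "g \<in> carrier (FA n)" for f g
    proof -
      have "alg_op (g * f) F x = 0" if "x \<in> confs n" for F x
        using \<open>f \<in> ?K\<close> \<open>g \<in> carrier (FA n)\<close> that
          alg_op_cong[of g n x "alg_op f F" "\<lambda>_. 0"] alg_op_scale[of g n x 0 "\<lambda>_. 0"]
        by (simp add: alg_op_mult[of _ n])
      then show ?thesis using that by (simp add: FA_closed)
    qed
    show "f \<otimes>\<^bsub>FA n\<^esub> g \<in> ?K" if "f \<in> ?K" "g \<in> carrier (FA n)" for f g
      using that by (simp add: FA_closed alg_op_mult[of _ n])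
  qed
  moreover have "bmw_relators n \<subseteq> ?K"
    using bmw_relators_closed relator_zero by blast
  ultimately have "bmw_ideal n \<subseteq> ?K"
    unfolding bmw_ideal_def by (rule ring.genideal_minimal[OF FA_ring])
  then show ?thesis using f x by blast
qed

section \<open>The quantum trace and its Markov property\<close>

definition tr :: "nat \<Rightarrow> free_alg \<Rightarrow> 'k" where
  "tr n f = (\<Sum>x\<in>confs n. pivots n x * alg_op f (\<lambda>y. if y = x then 1 else 0) x)"

lemma tr_add: "tr n (f + g) = tr n f + tr n g"
  by (simp add: tr_def alg_op_add distrib_left sum.distrib)

lemma tr_scale:
  assumes "f \<in> carrier (FA n)" shows "tr n (fa_const s * f) = ev s * tr n f"
  using assms by (simp add: tr_def alg_op_mult[of _ n] FA_closed alg_op_const sum_distrib_left mult.left_commute)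

lemma tr_ideal: "f \<in> bmw_ideal n \<Longrightarrow> tr n f = 0"
  by (simp add: tr_def ideal_zero)

text \<open>Expansion in the basis of indicator functions: applied to the indicator of z and read
  off at x, the operator yields its matrix entry at x, z. The diagonal entries are those summed in
  \<open>tr\<close>.\<close>

lemma alg_op_expand:
  assumes f: "f \<in> carrier (FA n)" and x: "x \<in> confs n"
  shows "alg_op f F x = (\<Sum>z\<in>confs n. F z * alg_op f (\<lambda>y. if y = z then 1 else 0) x)"
proof -
  have "alg_op f F x = alg_op f (\<lambda>y. \<Sum>z\<in>confs n. F z * (if y = z then 1 else 0)) x"
    by (rule alg_op_cong[OF f x]) (simp add: finite_confs if_distrib[of "\<lambda>t. _ * t"] cong: if_cong)
  also have "\<dots> = (\<Sum>z\<in>confs n. F z * alg_op f (\<lambda>y. if y = z then 1 else 0) x)"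
    by (simp add: alg_op_sum[OF f x finite_confs] alg_op_scale[OF f x])
  finally show ?thesis .
qed

text \<open>The usual cyclicity of a matrix trace, once the weight has been moved from row x to row
  y. This is possible because f commutes with \<open>pivots n\<close>, so its entry at x, y vanishes
  unless the two weights agree.\<close>

lemma tr_commute:
  assumes f: "f \<in> carrier (FA n)" and g: "g \<in> carrier (FA n)"
  shows "tr n (f * g) = tr n (g * f)"
proof -
  let ?d = "\<lambda>z y. if y = z then 1 else 0"
  have comm: "pivots n x * alg_op f (?d y) x = pivots n y * alg_op f (?d y) x" if x: "x \<in> confs n" for x y
  proof -
    have "pivots n x * alg_op f (?d y) x = alg_op f (\<lambda>z. pivots n z * ?d y z) x"
      by (rule alg_op_pivots[OF f x, symmetric])
    also have "(\<lambda>z. pivots n z * ?d y z) = (\<lambda>z. pivots n y * ?d y z)"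
      by auto
    also have "alg_op f \<dots> x = pivots n y * alg_op f (?d y) x"
      by (rule alg_op_scale[OF f x])
    finally show ?thesis .
  qed
  have "tr n (f * g) = (\<Sum>x\<in>confs n. \<Sum>y\<in>confs n. pivots n x * alg_op f (?d y) x * alg_op g (?d x) y)"
    unfolding tr_def
  proof (rule sum.cong[OF refl])
    fix x assume x: "x \<in> confs n"
    show "pivots n x * alg_op (f * g) (?d x) x = (\<Sum>y\<in>confs n. pivots n x * alg_op f (?d y) x * alg_op g (?d x) y)"
      unfolding alg_op_mult[OF f g x]
      by (subst alg_op_expand[OF f x]) (simp add: sum_distrib_left mult_ac)
  qed
  also have "\<dots> = (\<Sum>x\<in>confs n. \<Sum>y\<in>confs n. pivots n y * alg_op f (?d y) x * alg_op g (?d x) y)"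
    by (intro sum.cong refl arg_cong2[of _ _ _ _ "(*)"] comm)
  also have "\<dots> = (\<Sum>y\<in>confs n. \<Sum>x\<in>confs n. pivots n y * alg_op g (?d x) y * alg_op f (?d y) x)"
    by (subst sum.swap) (simp add: mult_ac)
  also have "\<dots> = tr n (g * f)"
    unfolding tr_def
  proof (rule sum.cong[OF refl])
    fix x assume x: "x \<in> confs n"
    show "(\<Sum>y\<in>confs n. pivots n x * alg_op g (?d y) x * alg_op f (?d x) y) = pivots n x * alg_op (g * f) (?d x) x"
      unfolding alg_op_mult[OF g f x]
      by (subst alg_op_expand[OF g x]) (simp add: sum_distrib_left mult_ac)
  qed
  finally show ?thesis .
qed

lemma sum_confs_Suc:
  "(\<Sum>x\<in>confs (Suc n). f x) = (\<Sum>x\<in>confs n. \<Sum>j\<in>I. f (x(Suc n := j)))"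
proof -
  have *: "{1..Suc n} = insert (Suc n) {1..n}" by auto
  have "inj_on (\<lambda>(y, g). g(Suc n := y)) (I \<times> confs n)"
    unfolding confs_def using inj_combinator[of "Suc n" "{1..n}" "\<lambda>_. I"] by simp
  moreover have "confs (Suc n) = (\<lambda>(y, g). g(Suc n := y)) ` (I \<times> confs n)"
    unfolding confs_def * PiE_insert_eq ..
  ultimately have "(\<Sum>x\<in>confs (Suc n). f x) = (\<Sum>p\<in>I \<times> confs n. f ((snd p)(Suc n := fst p)))"
    by (simp add: sum.reindex split_def)
  also have "\<dots> = (\<Sum>x\<in>confs n. \<Sum>j\<in>I. f (x(Suc n := j)))"
    by (subst sum.swap) (simp add: sum.cartesian_product split_def)
  finally show ?thesis .
qed

lemma pivots_Suc: "pivots (Suc n) (x(Suc n := j)) = pivots n x * pivot c bar j"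
proof -
  have "(\<Prod>i\<in>{1..n}. pivot c bar ((x(Suc n := j)) i)) = pivots n x"
    unfolding pivots_def by (rule prod.cong) auto
  then show ?thesis by (simp add: pivots_def)
qed

text \<open>Letters of index below n act on positions up to n, so the label at \<open>Suc n\<close>
  is only a parameter.\<close>

lemma alg_op_last:
  assumes f: "f \<in> carrier (FA n)"
  shows "alg_op f F (x(Suc n := v)) = alg_op f (\<lambda>y. F (y(Suc n := v))) x"
proof -
  have "word_op ls F (x(Suc n := v)) = word_op ls (\<lambda>y. F (y(Suc n := v))) x"
    if "\<forall>l\<in>set ls. letter_index l < n" for ls x
    using that
  proof (induction ls arbitrary: x)
    case (Cons l ls)
    then have l: "letter_index l < n" by simp
    have eq: "x(Suc n := v, letter_index l := u, Suc (letter_index l) := w) =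
        x(letter_index l := u, Suc (letter_index l) := w, Suc n := v)" for u w
      using l by (auto simp: fun_eq_iff)
    have IH: "word_op ls F (y(Suc n := v)) = word_op ls (\<lambda>y. F (y(Suc n := v))) y" for y
      by (rule Cons.IH) (use Cons.prems in simp)
    show ?case
      unfolding word_op.simps letter_op_act act_def eq IH using l by simp
  qed simp
  then show ?thesis
    unfolding alg_op_def using f by (intro sum.cong refl) (auto simp: FA_carrier words_def)
qed

lemma confs_Suc_upd: "x \<in> confs n \<Longrightarrow> j \<in> I \<Longrightarrow> x(Suc n := j) \<in> confs (Suc n)"
  unfolding confs_def by (auto simp: PiE_def extensional_def)

lemma confs_last_eq:
  assumes "x \<in> confs n" "y \<in> confs n"
  shows "y(Suc n := v) = x(Suc n := j) \<longleftrightarrow> v = j \<and> y = x"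
proof
  assume eq: "y(Suc n := v) = x(Suc n := j)"
  have "x (Suc n) = undefined" "y (Suc n) = undefined"
    using assms unfolding confs_def by (auto simp: PiE_def extensional_def)
  then have "y = x" using eq by (metis fun_upd_triv fun_upd_upd)
  moreover have "v = j" using eq by (metis fun_upd_same)
  ultimately show "v = j \<and> y = x" by simp
qed simp

lemma alg_op_delta_last:
  assumes f: "f \<in> carrier (FA n)" and x: "x \<in> confs n" and y: "y \<in> confs n"
  shows "alg_op f (\<lambda>z. if z = x(Suc n := j) then 1 else 0) (y(Suc n := v)) =
     (if v = j then alg_op f (\<lambda>z. if z = x then 1 else 0) y else 0)"
proof -
  have "alg_op f (\<lambda>z. if z = x(Suc n := j) then 1 else 0) (y(Suc n := v)) =
      alg_op f (\<lambda>z. (if v = j then 1 else 0) * (if z = x then 1 else 0)) y"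
    unfolding alg_op_last[OF f] by (rule alg_op_cong[OF f y]) (simp add: confs_last_eq x)
  then show ?thesis by (simp only: alg_op_scale[OF f y]) simp
qed

lemma tr_Suc:
  assumes f: "f \<in> carrier (FA n)"
  shows "tr (Suc n) f = (\<Sum>j\<in>I. pivot c bar j) * tr n f"
proof -
  have "tr (Suc n) f = (\<Sum>x\<in>confs n. \<Sum>j\<in>I. pivots n x * pivot c bar j * alg_op f (\<lambda>y. if y = x then 1 else 0) x)"
    unfolding tr_def sum_confs_Suc pivots_Suc
    by (intro sum.cong refl) (simp add: alg_op_delta_last[OF f])
  also have "\<dots> = (\<Sum>j\<in>I. pivot c bar j) * tr n f"
    by (simp add: tr_def sum_distrib_left sum_distrib_right mult_ac)
  finally show ?thesis .
qed

lemma ev_delta: "(q - r) * ev bmw_delta = a - b + q - r"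
  using ev_z_inv by (simp add: bmw_delta_def ev_add ev_mult ev_diff ev_1 ev_a ev_a_inv distrib_left mult.left_commute)

lemma tr_delta:
  assumes f: "f \<in> carrier (FA n)"
  shows "tr (Suc n) f = ev bmw_delta * tr n f"
proof -
  have "(q - r) * ev bmw_delta = (q - r) * (\<Sum>j\<in>I. pivot c bar j)"
    by (simp only: ev_delta partial_trace_1)
  moreover have "q - r \<noteq> 0" using ev_z_inv by auto
  ultimately have "ev bmw_delta = (\<Sum>j\<in>I. pivot c bar j)" by simp
  then show ?thesis using tr_Suc[OF f] by simp
qed

text \<open>Summing over the last label first is a partial trace. Since f does not touch that
  factor, it enters only through the function \<open>?h\<close> of the label at position n, and the
  third part of assumption \<open>T\<close> replaces the operator by the scalar t.\<close>

lemma tr_act_last: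
  assumes f: "f \<in> carrier (FA n)" and n: "1 \<le> n" and g: "g \<in> carrier (FA (Suc n))"
    and T: "local_operator T" "\<And>F x. alg_op g F x = act n T F x"
      "\<And>k h. k \<in> I \<Longrightarrow> (\<Sum>j\<in>I. pivot c bar j * T (\<lambda>u v. if v = j then h u else 0) k j) = t * h k"
  shows "tr (Suc n) (g * f) = t * tr n f"
proof -
  have "tr (Suc n) (g * f) = (\<Sum>x\<in>confs n. pivots n x * (t * alg_op f (\<lambda>y. if y = x then 1 else 0) x))"
    unfolding tr_def sum_confs_Suc
  proof (rule sum.cong[OF refl])
    fix x assume x: "x \<in> confs n"
    have xn: "x n \<in> I" using confs_mem[OF x] n by simp
    let ?h = "\<lambda>u. alg_op f (\<lambda>y. if y = x then 1 else 0) (x(n := u))"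
    have "alg_op (g * f) (\<lambda>y. if y = x(Suc n := j) then 1 else 0) (x(Suc n := j)) =
        T (\<lambda>u v. if v = j then ?h u else 0) (x n) j" if j: "j \<in> I" for j
    proof -
      have "alg_op (g * f) (\<lambda>y. if y = x(Suc n := j) then 1 else 0) (x(Suc n := j)) =
        T (\<lambda>u v. alg_op f (\<lambda>y. if y = x(Suc n := j) then 1 else 0) (x(n := u, Suc n := v))) (x n) j"
        using alg_op_mult[OF g FA_Suc[OF f] confs_Suc_upd[OF x j]]
        by (simp add: T(2) act_def fun_upd_twist[of "Suc n" n])
      also have "\<dots> = T (\<lambda>u v. if v = j then ?h u else 0) (x n) j"
        using confs_upd[OF x n] by (intro local_cong[OF T(1) xn j]) (simp add: alg_op_delta_last[OF f x])
      finally show ?thesis .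
    qed
    then have "(\<Sum>j\<in>I. pivots (Suc n) (x(Suc n := j)) * alg_op (g * f) (\<lambda>y. if y = x(Suc n := j) then 1 else 0) (x(Suc n := j)))
        = pivots n x * (\<Sum>j\<in>I. pivot c bar j * T (\<lambda>u v. if v = j then ?h u else 0) (x n) j)"
      by (simp add: pivots_Suc sum_distrib_left mult.assoc)
    also have "\<dots> = pivots n x * (t * ?h (x n))"
      by (simp only: T(3)[OF xn])
    finally show "(\<Sum>j\<in>I. pivots (Suc n) (x(Suc n := j)) * alg_op (g * f) (\<lambda>y. if y = x(Suc n := j) then 1 else 0) (x(Suc n := j)))
        = pivots n x * (t * alg_op f (\<lambda>y. if y = x then 1 else 0) x)" by simp
  qed
  then show ?thesis by (simp add: tr_def sum_distrib_left mult.left_commute)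
qed

lemma tr_markov:
  assumes f: "f \<in> carrier (FA n)" and g: "g \<in> carrier (FA n)" and n: "1 \<le> n"
  shows "tr (Suc n) (f * fa_gen n * g) = a * tr n (f * g)"
    and "tr (Suc n) (f * fa_gen_inv n * g) = b * tr n (f * g)"
proof -
  have fg: "g * f \<in> carrier (FA n)" using f g by (simp add: FA_closed)
  note mem = FA_gen_closed[of n "Suc n", OF n lessI]
  \<comment> \<open>Cyclicity moves f behind g, which leaves the generator at the left end as
    \<open>tr_act_last\<close> requires.\<close>
  have "tr (Suc n) (f * (s * g)) = tr (Suc n) (s * (g * f))" if "s \<in> carrier (FA (Suc n))" for s
    using tr_commute[of f "Suc n" "s * g"] that FA_Suc[OF f] FA_Suc[OF g] by (simp add: FA_closed mult.assoc)
  then show "tr (Suc n) (f * fa_gen n * g) = a * tr n (f * g)"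
    "tr (Suc n) (f * fa_gen_inv n * g) = b * tr n (f * g)"
    using tr_act_last[OF fg n mem(1) local_S alg_op_gen(1) partial_trace_S]
      tr_act_last[OF fg n mem(2) local_Sinv alg_op_gen(2) partial_trace_Sinv] mem tr_commute[OF f g]
    by (simp_all add: mult.assoc)
qed

lemma tr_0_1: "tr 0 1 = 1"
  by (simp add: tr_def confs_def pivots_def alg_op_1)

end

section \<open>Specialization of the coefficients\<close>

definition ev2 :: "complex \<Rightarrow> complex \<Rightarrow> complex poly poly \<Rightarrow> complex" where
  "ev2 \<alpha> \<theta> p = poly (poly p [:\<theta>:]) \<alpha>"

text \<open>Exactly the points at which \<open>a\<close>, \<open>q\<close> and
  \<open>q - q^(-1)\<close> are invertible, so that every element of R can be evaluated.\<close>

definition good_point :: "complex \<Rightarrow> complex \<Rightarrow> bool" where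
  "good_point \<alpha> \<theta> \<longleftrightarrow> \<alpha> \<noteq> 0 \<and> \<theta> \<noteq> 0 \<and> \<theta> * \<theta> \<noteq> 1"

text \<open>One denominator serves all good points at once, which lets
  \<open>curve_ev_faithful\<close> argue with a single numerator.\<close>

definition fraction_of :: "scalar \<Rightarrow> complex poly poly \<Rightarrow> complex poly poly \<Rightarrow> bool" where
  "fraction_of s n d \<longleftrightarrow> d \<noteq> 0 \<and> Rep_scalar s = Fract n d \<and> (\<forall>\<alpha> \<theta>. good_point \<alpha> \<theta> \<longrightarrow> ev2 \<alpha> \<theta> d \<noteq> 0)"

lemma ev2_simps: "ev2 \<alpha> \<theta> (x + y) = ev2 \<alpha> \<theta> x + ev2 \<alpha> \<theta> y" "ev2 \<alpha> \<theta> (x * y) = ev2 \<alpha> \<theta> x * ev2 \<alpha> \<theta> y"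
  "ev2 \<alpha> \<theta> 1 = 1" "ev2 \<alpha> \<theta> 0 = 0"
  by (simp_all add: ev2_def)

lemma fraction_add:
  assumes "fraction_of s n d" "fraction_of t m e"
  shows "fraction_of (s + t) (n * e + m * d) (d * e)"
  using assms by (auto simp: fraction_of_def plus_scalar.rep_eq ev2_simps)

lemma fraction_mult:
  assumes "fraction_of s n d" "fraction_of t m e"
  shows "fraction_of (s * t) (n * m) (d * e)"
  using assms by (auto simp: fraction_of_def times_scalar.rep_eq ev2_simps)

lemma fraction_1: "fraction_of 1 1 1"
  by (simp add: fraction_of_def one_scalar.rep_eq One_fract_def ev2_simps)

lemma fraction_a: "fraction_of sc_a [:[:0, 1:]:] 1"
  by (simp add: fraction_of_def sc_a.rep_eq rf_a_def ev2_simps)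

lemma fraction_q: "fraction_of sc_q [:0, 1:] 1"
  by (simp add: fraction_of_def sc_q.rep_eq rf_q_def ev2_simps)

lemma scalar_fraction:
  assumes "r \<in> scalar_set"
  shows "\<exists>n d. d \<noteq> 0 \<and> r = Fract n d \<and> (\<forall>\<alpha> \<theta>. good_point \<alpha> \<theta> \<longrightarrow> ev2 \<alpha> \<theta> d \<noteq> 0)"
  using assms
proof (induction rule: scalar_set.induct)
  case (const c)
  show ?case by (rule exI[of _ "[:[:c:]:]"], rule exI[of _ 1]) (simp add: rf_const_def ev2_simps)
next
  case a
  show ?case by (rule exI[of _ "[:[:0, 1:]:]"], rule exI[of _ 1]) (simp add: rf_a_def ev2_simps)
next
  case a_inv
  show ?case by (rule exI[of _ 1], rule exI[of _ "[:[:0, 1:]:]"]) (simp add: rf_a_def ev2_def good_point_def)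
next
  case q
  show ?case by (rule exI[of _ "[:0, 1:]"], rule exI[of _ 1]) (simp add: rf_q_def ev2_simps)
next
  case q_inv
  show ?case by (rule exI[of _ 1], rule exI[of _ "[:0, 1:]"]) (simp add: rf_q_def ev2_def good_point_def)
next
  case z_inv
  \<comment> \<open>The denominator of the inverse is \<open>q^2 - 1\<close>, nonzero at good points
    by the clause \<open>\<theta> * \<theta> \<noteq> 1\<close>.\<close>
  have "(rf_q - inverse rf_q) = Fract [:-1, 0, 1:] [:0, 1:]"
    by (simp add: rf_q_def one_pCons)
  then have "inverse (rf_q - inverse rf_q) = Fract [:0, 1:] [:-1, 0, 1:]"
    by simp
  then show ?case
    by (intro exI[of _ "[:0, 1:]"] exI[of _ "[:-1, 0, 1:]"]) (auto simp: ev2_def good_point_def)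
next
  case (add x y)
  then obtain n d m e where "d \<noteq> 0" "x = Fract n d" "\<forall>\<alpha> \<theta>. good_point \<alpha> \<theta> \<longrightarrow> ev2 \<alpha> \<theta> d \<noteq> 0"
    "e \<noteq> 0" "y = Fract m e" "\<forall>\<alpha> \<theta>. good_point \<alpha> \<theta> \<longrightarrow> ev2 \<alpha> \<theta> e \<noteq> 0" by auto
  then show ?case
    by (intro exI[of _ "n * e + m * d"] exI[of _ "d * e"]) (simp add: ev2_simps)
next
  case (mult x y)
  then obtain n d m e where "d \<noteq> 0" "x = Fract n d" "\<forall>\<alpha> \<theta>. good_point \<alpha> \<theta> \<longrightarrow> ev2 \<alpha> \<theta> d \<noteq> 0"
    "e \<noteq> 0" "y = Fract m e" "\<forall>\<alpha> \<theta>. good_point \<alpha> \<theta> \<longrightarrow> ev2 \<alpha> \<theta> e \<noteq> 0" by auto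
  then show ?case
    by (intro exI[of _ "n * m"] exI[of _ "d * e"]) (simp add: ev2_simps)
qed

lemma fraction_exists: "\<exists>n d. fraction_of s n d"
  using scalar_fraction[OF Rep_scalar[of s]] unfolding fraction_of_def .

definition ev_at :: "complex \<Rightarrow> complex \<Rightarrow> scalar \<Rightarrow> complex" where
  "ev_at \<alpha> \<theta> s = (let (n, d) = SOME (n, d). fraction_of s n d in ev2 \<alpha> \<theta> n / ev2 \<alpha> \<theta> d)"

text \<open>Independence of the chosen fraction: equality of fractions is an identity of cross
  products, which survives evaluation, and both denominators are nonzero at a good point.\<close>

lemma ev_at_fraction:
  assumes "good_point \<alpha> \<theta>" "fraction_of s n d"
  shows "ev_at \<alpha> \<theta> s = ev2 \<alpha> \<theta> n / ev2 \<alpha> \<theta> d"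
proof -
  have "fraction_of s (fst (SOME (n, d). fraction_of s n d)) (snd (SOME (n, d). fraction_of s n d))"
    by (rule someI2[of _ "(n, d)"]) (use assms in auto)
  then obtain m e where me: "(SOME (n, d). fraction_of s n d) = (m, e)" "fraction_of s m e"
    by (metis prod.collapse)
  have "Fract n d = Fract m e" "d \<noteq> 0" "e \<noteq> 0"
    using me(2) assms(2) by (auto simp: fraction_of_def)
  then have "n * e = m * d" by (simp add: eq_fract)
  then have "ev2 \<alpha> \<theta> n * ev2 \<alpha> \<theta> e = ev2 \<alpha> \<theta> m * ev2 \<alpha> \<theta> d"
    by (simp flip: ev2_simps)
  moreover have "ev2 \<alpha> \<theta> d \<noteq> 0" "ev2 \<alpha> \<theta> e \<noteq> 0"
    using me(2) assms by (auto simp: fraction_of_def)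
  ultimately show ?thesis
    by (simp add: ev_at_def me(1) field_simps)
qed

lemma ev_at_hom:
  assumes g: "good_point \<alpha> \<theta>"
  shows "ev_at \<alpha> \<theta> 1 = 1" "ev_at \<alpha> \<theta> sc_a = \<alpha>" "ev_at \<alpha> \<theta> sc_q = \<theta>"
    "ev_at \<alpha> \<theta> (s + t) = ev_at \<alpha> \<theta> s + ev_at \<alpha> \<theta> t"
    "ev_at \<alpha> \<theta> (s * t) = ev_at \<alpha> \<theta> s * ev_at \<alpha> \<theta> t"
proof -
  show "ev_at \<alpha> \<theta> 1 = 1" "ev_at \<alpha> \<theta> sc_a = \<alpha>" "ev_at \<alpha> \<theta> sc_q = \<theta>"
    using ev_at_fraction[OF g fraction_1] ev_at_fraction[OF g fraction_a] ev_at_fraction[OF g fraction_q]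
    by (simp_all add: ev2_def)
  obtain n d m e where *: "fraction_of s n d" "fraction_of t m e"
    using fraction_exists by meson
  then have "ev2 \<alpha> \<theta> d \<noteq> 0" "ev2 \<alpha> \<theta> e \<noteq> 0"
    using g by (auto simp: fraction_of_def)
  then show "ev_at \<alpha> \<theta> (s + t) = ev_at \<alpha> \<theta> s + ev_at \<alpha> \<theta> t"
    "ev_at \<alpha> \<theta> (s * t) = ev_at \<alpha> \<theta> s * ev_at \<alpha> \<theta> t"
    using ev_at_fraction[OF g] * fraction_add[OF *] fraction_mult[OF *]
    by (simp_all add: ev2_simps field_simps)
qed

lemma good_point_curve:
  fixes x :: real assumes "x > 1"
  shows "good_point (of_real x ^ m) (of_real x)"
proof -
  have "x * x > 1" using assms by (simp add: less_1_mult)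
  then have "complex_of_real (x * x) \<noteq> complex_of_real 1"
    unfolding of_real_eq_iff by simp
  then show ?thesis using assms by (auto simp: good_point_def)
qed

definition curve_ev :: "real \<Rightarrow> nat \<Rightarrow> scalar \<Rightarrow> complex" where
  "curve_ev x m = ev_at (of_real x ^ (2 * m + 1)) (of_real x)"

lemma curve_ev_hom:
  assumes "x > 1"
  shows "curve_ev x m 1 = 1" "curve_ev x m sc_a = of_real x ^ (2 * m + 1)" "curve_ev x m sc_q = of_real x"
    "curve_ev x m (s + t) = curve_ev x m s + curve_ev x m t"
    "curve_ev x m (s * t) = curve_ev x m s * curve_ev x m t"
  unfolding curve_ev_def by (rule ev_at_hom[OF good_point_curve[OF assms]])+

text \<open>Finiteness of roots is applied twice. For fixed x the numerator, as a polynomial in a,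
  vanishes at the infinitely many powers \<open>x^(2m+1)\<close>; as a polynomial in q over the
  polynomials in a, it therefore vanishes at infinitely many constants.\<close>

lemma curve_ev_faithful:
  assumes "\<And>x m. x > 1 \<Longrightarrow> curve_ev x m s = 0"
  shows "s = 0"
proof -
  obtain n d where nd: "fraction_of s n d" using fraction_exists by blast
  have "poly n [:complex_of_real x:] = 0" if x: "x > 1" for x :: real
  proof (rule ccontr)
    assume "poly n [:complex_of_real x:] \<noteq> 0"
    then have "finite {t. poly (poly n [:complex_of_real x:]) t = 0}"
      by (rule poly_roots_finite)
    moreover have "range (\<lambda>m. complex_of_real x ^ (2 * m + 1)) \<subseteq> {t. poly (poly n [:complex_of_real x:]) t = 0}"
    proof safe
      fix m
      have "ev2 (of_real x ^ (2 * m + 1)) (of_real x) n = 0"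
        using assms[OF x, of m, unfolded curve_ev_def] ev_at_fraction[OF good_point_curve[OF x] nd] good_point_curve[OF x] nd
        unfolding fraction_of_def by (metis divide_eq_0_iff)
      then show "poly (poly n [:complex_of_real x:]) (complex_of_real x ^ (2 * m + 1)) = 0"
        by (simp add: ev2_def)
    qed
    moreover have "inj (\<lambda>m. complex_of_real x ^ (2 * m + 1))"
    proof (rule injI)
      fix m m' :: nat assume "complex_of_real x ^ (2 * m + 1) = complex_of_real x ^ (2 * m' + 1)"
      then have "x ^ (2 * m + 1) = x ^ (2 * m' + 1)" by (metis of_real_eq_iff of_real_power)
      then show "m = m'" using x by (simp only: power_inject_exp)
    qed
    ultimately show False
      using finite_subset range_inj_infinite by blast
  qed
  then have "(\<lambda>x. [:complex_of_real x:]) ` {1<..} \<subseteq> {t. poly n t = 0}" by auto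
  moreover have "infinite ((\<lambda>x. [:complex_of_real x:]) ` {1<..})"
    using infinite_Ioi[of "1::real"] by (subst finite_image_iff) (auto simp: inj_on_def)
  ultimately have "n = 0"
    using poly_roots_finite[of n] finite_subset by blast
  then have "Rep_scalar s = 0" using nd by (simp add: fraction_of_def Zero_fract_def eq_fract)
  then show ?thesis by (metis Rep_scalar_inject zero_scalar.rep_eq)
qed

text \<open>The interface between one specialization and the gluing over all of them. It hides the
  space and the R-matrix, which vary with m.\<close>

locale specialized_trace =
  fixes ev :: "scalar \<Rightarrow> 'k::field" and \<phi> :: "nat \<Rightarrow> free_alg \<Rightarrow> 'k"
  assumes add: "\<phi> n (f + g) = \<phi> n f + \<phi> n g"
    and scale: "f \<in> carrier (FA n) \<Longrightarrow> \<phi> n (fa_const s * f) = ev s * \<phi> n f"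
    and ideal: "f \<in> bmw_ideal n \<Longrightarrow> \<phi> n f = 0"
    and commute: "f \<in> carrier (FA n) \<Longrightarrow> g \<in> carrier (FA n) \<Longrightarrow> \<phi> n (f * g) = \<phi> n (g * f)"
    and gen: "1 \<le> n \<Longrightarrow> f \<in> carrier (FA n) \<Longrightarrow> g \<in> carrier (FA n) \<Longrightarrow>
      \<phi> (Suc n) (f * fa_gen n * g) = ev sc_a * \<phi> n (f * g)"
    and gen_inv: "1 \<le> n \<Longrightarrow> f \<in> carrier (FA n) \<Longrightarrow> g \<in> carrier (FA n) \<Longrightarrow>
      \<phi> (Suc n) (f * fa_gen_inv n * g) = ev sc_a_inv * \<phi> n (f * g)"
    and incl: "f \<in> carrier (FA n) \<Longrightarrow> \<phi> (Suc n) f = ev bmw_delta * \<phi> n f"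
    and one: "\<phi> 1 1 = 1"

lemma specialized_trace_exists:
  fixes x :: real and m :: nat
  assumes x: "x > 1"
  shows "\<exists>\<phi>. specialized_trace (curve_ev x m) \<phi>"
proof -
  define ev where "ev = curve_ev x m"
  define q r where "q = complex_of_real x" and "r = inverse q"
  define a b where "a = q ^ (2 * m + 1)" and "b = r ^ (2 * m + 1)"
  have qr: "q * r = 1" using x by (simp add: q_def r_def)
  \<comment> \<open>With m + 1 pairs the construction yields the exponent
    \<open>2 * Suc m - 1\<close>, the required odd power.\<close>
  have ab: "q ^ (2 * Suc m) * r = a" "r ^ (2 * Suc m) * q = b"
    using qr by (simp_all add: a_def b_def algebra_simps)
  obtain I :: "nat set" and S c bar where "kauffman_matrix q r a b I S c bar"
    using kauffman_matrix_exists[OF qr infinite_UNIV_nat, of "Suc m"] unfolding ab by blast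
  moreover
  have "kauffman_specialization_axioms q a ev"
    by unfold_locales (simp_all only: ev_def curve_ev_hom[OF x] a_def q_def)
  ultimately interpret kauffman_specialization q r a b I S c bar ev
    by (simp add: kauffman_specialization_def)
  have one: "1 \<in> carrier (FA n)" for n by (simp add: FA_closed)
  \<comment> \<open>For real x > 1 both \<open>a - b\<close> and \<open>q - r\<close> are positive,
    so the quantum dimension can be divided out.\<close>
  have pos: "ev bmw_delta \<noteq> 0"
  proof
    assume "ev bmw_delta = 0"
    then have "a - b + q - r = 0" using ev_delta by simp
    then have "complex_of_real (x ^ (2 * m + 1) - inverse (x ^ (2 * m + 1)) + x - inverse x) = 0"
      by (simp add: a_def b_def q_def r_def power_inverse)
    then have "x ^ (2 * m + 1) - inverse (x ^ (2 * m + 1)) + x - inverse x = 0"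
      by (simp only: of_real_eq_0_iff)
    moreover have "inverse x < 1" "inverse (x ^ (2 * m + 1)) < 1" "1 < x ^ (2 * m + 1)"
      using x by (auto simp: inverse_less_1_iff one_less_power simp del: power_Suc)
    ultimately show False using x by linarith
  qed
  let ?\<phi> = "\<lambda>n f. tr n f / ev bmw_delta"
  \<comment> \<open>On zero strands the trace of 1 is an empty product, so on one strand it is the
    loop value; this fixes the normalizing factor.\<close>
  have "tr (Suc 0) 1 = ev bmw_delta"
    using tr_delta[OF one, of 0] tr_0_1 by simp
  then have "specialized_trace ev ?\<phi>"
    using pos
    by unfold_locales
       (simp_all add: tr_add tr_scale tr_ideal tr_markov tr_delta ev_a ev_a_inv tr_commute add_divide_distrib)
  then show ?thesis unfolding ev_def by (rule exI[of "specialized_trace (curve_ev x m)"])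
qed

section \<open>Spanning sets of Birman-Murakami-Wenzl algebras\<close>

text \<open>Two adjacent generators s, t with inverses S, T in an arbitrary ring; \<zeta>, \<alpha>
  and \<beta> stand for the images of \<open>sc_z_inv\<close>, \<open>sc_a\<close> and
  \<open>sc_a_inv\<close>. The computations on three strands thus take place without cosets.\<close>

locale bmw_pair = ring R for R (structure) +
  fixes s S t T \<zeta> \<alpha> \<beta>
  assumes car [simp, intro]: "s \<in> carrier R" "S \<in> carrier R" "t \<in> carrier R" "T \<in> carrier R"
      "\<zeta> \<in> carrier R" "\<alpha> \<in> carrier R" "\<beta> \<in> carrier R"
    and inv: "s \<otimes> S = \<one>" "S \<otimes> s = \<one>" "t \<otimes> T = \<one>" "T \<otimes> t = \<one>"
    and central: "x \<in> carrier R \<Longrightarrow> x \<otimes> \<zeta> = \<zeta> \<otimes> x" "x \<in> carrier R \<Longrightarrow> x \<otimes> \<alpha> = \<alpha> \<otimes> x"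
      "x \<in> carrier R \<Longrightarrow> x \<otimes> \<beta> = \<beta> \<otimes> x"
    and \<alpha>\<beta>: "\<alpha> \<otimes> \<beta> = \<one>"
    and braid: "s \<otimes> (t \<otimes> s) = t \<otimes> (s \<otimes> t)"
begin

definition e where "e = \<zeta> \<otimes> (S \<ominus> s) \<oplus> \<one>"
definition f where "f = \<zeta> \<otimes> (T \<ominus> t) \<oplus> \<one>"

lemma ef_car [simp, intro]: "e \<in> carrier R" "f \<in> carrier R"
  by (auto simp: e_def f_def)

lemma inv': "x \<in> carrier R \<Longrightarrow> s \<otimes> (S \<otimes> x) = x" "x \<in> carrier R \<Longrightarrow> S \<otimes> (s \<otimes> x) = x"
  "x \<in> carrier R \<Longrightarrow> t \<otimes> (T \<otimes> x) = x" "x \<in> carrier R \<Longrightarrow> T \<otimes> (t \<otimes> x) = x"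
  by (simp_all add: inv flip: m_assoc)

lemma central': "x \<in> carrier R \<Longrightarrow> y \<in> carrier R \<Longrightarrow> x \<otimes> (\<zeta> \<otimes> y) = \<zeta> \<otimes> (x \<otimes> y)"
  "x \<in> carrier R \<Longrightarrow> y \<in> carrier R \<Longrightarrow> x \<otimes> (\<alpha> \<otimes> y) = \<alpha> \<otimes> (x \<otimes> y)"
  "x \<in> carrier R \<Longrightarrow> y \<in> carrier R \<Longrightarrow> x \<otimes> (\<beta> \<otimes> y) = \<beta> \<otimes> (x \<otimes> y)"
  by (simp_all add: central flip: m_assoc)

lemma intertwine_gen:
  assumes "g \<in> carrier R" "x \<in> carrier R" "X \<in> carrier R" "y \<in> carrier R" "Y \<in> carrier R"
    and "g \<otimes> x = y \<otimes> g" "g \<otimes> X = Y \<otimes> g"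
  shows "g \<otimes> (\<zeta> \<otimes> (X \<ominus> x) \<oplus> \<one>) = (\<zeta> \<otimes> (Y \<ominus> y) \<oplus> \<one>) \<otimes> g"
  using assms by (simp add: r_distr l_distr central' m_assoc minus_eq r_minus l_minus)

lemma braid_inv:
  "s \<otimes> (t \<otimes> S) = T \<otimes> (s \<otimes> t)" "t \<otimes> (s \<otimes> T) = S \<otimes> (t \<otimes> s)"
  "S \<otimes> (T \<otimes> s) = t \<otimes> (S \<otimes> T)" "T \<otimes> (S \<otimes> t) = s \<otimes> (T \<otimes> S)"
  "S \<otimes> (T \<otimes> S) = T \<otimes> (S \<otimes> T)"
proof -
  have 1: "t \<otimes> (s \<otimes> t) \<otimes> S = s \<otimes> t"
    using braid inv by (simp add: m_assoc flip: braid)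
  then show a: "s \<otimes> (t \<otimes> S) = T \<otimes> (s \<otimes> t)"
    by (metis inv'(4) m_assoc car m_closed)
  have 2: "s \<otimes> (t \<otimes> s) \<otimes> T = t \<otimes> s"
    using inv by (simp add: m_assoc braid)
  then show b: "t \<otimes> (s \<otimes> T) = S \<otimes> (t \<otimes> s)"
    by (metis inv'(2) m_assoc car m_closed)
  have "S \<otimes> (T \<otimes> s) = S \<otimes> ((T \<otimes> (s \<otimes> t)) \<otimes> T)"
    by (simp add: m_assoc inv)
  also have "\<dots> = t \<otimes> (S \<otimes> T)"
    unfolding a[symmetric] by (simp add: m_assoc inv')
  finally show "S \<otimes> (T \<otimes> s) = t \<otimes> (S \<otimes> T)" .
  have "T \<otimes> (S \<otimes> t) = T \<otimes> ((S \<otimes> (t \<otimes> s)) \<otimes> S)"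
    by (simp add: m_assoc inv)
  also have "\<dots> = s \<otimes> (T \<otimes> S)"
    unfolding b[symmetric] by (simp add: m_assoc inv')
  finally show "T \<otimes> (S \<otimes> t) = s \<otimes> (T \<otimes> S)" .
  have "S \<otimes> (T \<otimes> S) = (S \<otimes> (T \<otimes> S)) \<otimes> ((t \<otimes> (s \<otimes> t)) \<otimes> (T \<otimes> (S \<otimes> T)))"
    by (simp add: m_assoc inv inv')
  also have "\<dots> = T \<otimes> (S \<otimes> T)"
    unfolding braid[symmetric] by (simp add: m_assoc inv')
  finally show "S \<otimes> (T \<otimes> S) = T \<otimes> (S \<otimes> T)" .
qed

text \<open>The half twist and its inverse: conjugation by D exchanges s and t.\<close>

definition D where "D = s \<otimes> (t \<otimes> s)"
definition Dinv where "Dinv = S \<otimes> (T \<otimes> S)"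

lemma D_car [simp, intro]: "D \<in> carrier R" "Dinv \<in> carrier R" by (auto simp: D_def Dinv_def)

lemma D_inv: "x \<in> carrier R \<Longrightarrow> D \<otimes> (Dinv \<otimes> x) = x"  "D \<otimes> Dinv = \<one>"
  by (simp_all add: D_def Dinv_def m_assoc inv' inv)

lemma D_swap: "D \<otimes> s = t \<otimes> D" "D \<otimes> t = s \<otimes> D"
proof -
  show "D \<otimes> s = t \<otimes> D" by (simp add: D_def m_assoc braid)
  show "D \<otimes> t = s \<otimes> D" by (simp add: D_def m_assoc flip: braid)
qed

lemma D_swap_inv: "D \<otimes> S = T \<otimes> D" "D \<otimes> T = S \<otimes> D"
proof -
  have "T \<otimes> ((D \<otimes> s) \<otimes> S) = T \<otimes> ((t \<otimes> D) \<otimes> S)" by (simp only: D_swap)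
  then show "D \<otimes> S = T \<otimes> D" by (simp add: m_assoc inv inv')
  have "S \<otimes> ((D \<otimes> t) \<otimes> T) = S \<otimes> ((s \<otimes> D) \<otimes> T)" by (simp only: D_swap)
  then show "D \<otimes> T = S \<otimes> D" by (simp add: m_assoc inv inv')
qed

lemma D_ef: "D \<otimes> e = f \<otimes> D" "D \<otimes> f = e \<otimes> D"
  unfolding e_def f_def by (rule intertwine_gen; simp add: D_swap D_swap_inv)+

text \<open>By the braid relation, conjugation by the product of s and t carries s to t and S to T,
  hence e to f.\<close>

lemma ste: "s \<otimes> (t \<otimes> e) = f \<otimes> (s \<otimes> t)"
proof -
  have "(s \<otimes> t) \<otimes> e = f \<otimes> (s \<otimes> t)"
    unfolding e_def f_def by (rule intertwine_gen; simp add: braid_inv braid m_assoc)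
  then show ?thesis by (simp add: m_assoc)
qed

lemma tf: "t \<otimes> f = f \<otimes> t"
  unfolding f_def by (rule intertwine_gen; simp add: inv)

end

locale bmw_pair_rel = bmw_pair +
  assumes es: "e \<otimes> s = \<beta> \<otimes> e" and ft: "f \<otimes> t = \<beta> \<otimes> f"
    and ete: "e \<otimes> (t \<otimes> e) = \<alpha> \<otimes> e" and eTe: "e \<otimes> (T \<otimes> e) = \<beta> \<otimes> e"
begin

lemma \<alpha>\<beta>': "x \<in> carrier R \<Longrightarrow> \<alpha> \<otimes> (\<beta> \<otimes> x) = x" "x \<in> carrier R \<Longrightarrow> \<beta> \<otimes> (\<alpha> \<otimes> x) = x"
  using \<alpha>\<beta> central(2)[of \<beta>] by (simp_all flip: m_assoc)

lemma eS: "e \<otimes> S = \<alpha> \<otimes> e"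
proof -
  have "\<alpha> \<otimes> (e \<otimes> s) \<otimes> S = \<alpha> \<otimes> (\<beta> \<otimes> e) \<otimes> S" using es by simp
  then show ?thesis by (simp add: m_assoc \<alpha>\<beta>' inv)
qed

text \<open>After expanding the middle f, the contributions of \<open>eTe\<close> and
  \<open>ete\<close> cancel against those of the quadratic relation for e, and a single e
  remains.\<close>

lemma efe: "e \<otimes> (f \<otimes> e) = e"
proof -
  let ?w = "\<zeta> \<otimes> (\<alpha> \<otimes> e \<ominus> \<beta> \<otimes> e)"
  have ee: "e \<otimes> e = ?w \<oplus> e"
  proof -
    have "e \<otimes> (\<zeta> \<otimes> (S \<ominus> s) \<oplus> \<one>) = \<zeta> \<otimes> (e \<otimes> S \<ominus> e \<otimes> s) \<oplus> e"
      by (simp add: r_distr central' minus_eq r_minus)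
    then show ?thesis by (simp only: eS es e_def[symmetric])
  qed
  have "e \<otimes> (f \<otimes> e) = \<zeta> \<otimes> (e \<otimes> (T \<otimes> e) \<ominus> e \<otimes> (t \<otimes> e)) \<oplus> e \<otimes> e"
    unfolding f_def by (simp add: r_distr l_distr central' m_assoc minus_eq r_minus l_minus)
  also have "\<dots> = \<ominus> ?w \<oplus> (?w \<oplus> e)"
    unfolding eTe ete ee by (simp add: minus_eq minus_add a_comm flip: r_minus)
  also have "\<dots> = e"
    by (simp add: r_neg1)
  finally show ?thesis .
qed

lemma D_cancel: "x \<in> carrier R \<Longrightarrow> y \<in> carrier R \<Longrightarrow> x \<otimes> D = y \<otimes> D \<Longrightarrow> x = y"
  by (metis D_car D_inv(2) m_assoc r_one)

text \<open>The given relations sandwich only the generator t and its inverse between copies of e;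
  conjugating \<open>ete\<close> by the half twist \<open>D\<close> yields the mirrored relation.
  Together with \<open>fSf\<close> this makes the setting symmetric, as recorded in
  \<open>swapped\<close>.\<close>

lemma fsf: "f \<otimes> (s \<otimes> f) = \<alpha> \<otimes> f"
proof (rule D_cancel)
  show "f \<otimes> (s \<otimes> f) \<otimes> D = \<alpha> \<otimes> f \<otimes> D"
    using D_ef D_swap ete
    by (smt (verit) D_car car ef_car m_assoc m_closed central'(2))
qed auto

lemma fSf: "f \<otimes> (S \<otimes> f) = \<beta> \<otimes> f"
proof (rule D_cancel)
  show "f \<otimes> (S \<otimes> f) \<otimes> D = \<beta> \<otimes> f \<otimes> D"
    using D_ef D_swap_inv eTe
    by (smt (verit) D_car car ef_car m_assoc m_closed central'(3))
qed auto

text \<open>By \<open>ste\<close> the left side is s t e. Writing this e as e f e and applying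
  \<open>ste\<close> again produces a second f next to t; then \<open>ft\<close> and
  \<open>fsf\<close> contribute \<beta> and \<alpha>, which cancel.\<close>

lemma fst_eq: "f \<otimes> (s \<otimes> t) = f \<otimes> e"
proof -
  have "f \<otimes> (s \<otimes> t) = s \<otimes> (t \<otimes> (e \<otimes> (f \<otimes> e)))"
    using efe ste by simp
  also have "\<dots> = (s \<otimes> (t \<otimes> e)) \<otimes> (f \<otimes> e)"
    by (simp add: m_assoc)
  also have "\<dots> = f \<otimes> (s \<otimes> (t \<otimes> f)) \<otimes> e"
    unfolding ste by (simp add: m_assoc)
  also have "\<dots> = \<beta> \<otimes> (f \<otimes> (s \<otimes> f)) \<otimes> e"
    unfolding tf ft by (simp add: central')
  also have "\<dots> = f \<otimes> e"
    unfolding fsf by (simp add: \<alpha>\<beta>')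
  finally show ?thesis .
qed

lemma swapped: "bmw_pair_rel R t T s S \<zeta> \<alpha> \<beta>"
proof -
  interpret sw: bmw_pair R t T s S \<zeta> \<alpha> \<beta>
    by unfold_locales (simp_all add: inv central \<alpha>\<beta> braid)
  have "sw.e = f" "sw.f = e" by (simp_all add: sw.e_def sw.f_def e_def f_def)
  then show ?thesis
    by unfold_locales (simp_all add: es ft fsf fSf)
qed

lemma ets: "e \<otimes> (t \<otimes> s) = e \<otimes> f"
proof -
  interpret sw: bmw_pair_rel R t T s S \<zeta> \<alpha> \<beta> by (rule swapped)
  have "sw.e = f" "sw.f = e" by (simp_all add: sw.e_def sw.f_def e_def f_def)
  then show ?thesis using sw.fst_eq by simp
qed

lemma fef: "f \<otimes> (e \<otimes> f) = f"
proof -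
  interpret sw: bmw_pair_rel R t T s S \<zeta> \<alpha> \<beta> by (rule swapped)
  have "sw.e = f" "sw.f = e" by (simp_all add: sw.e_def sw.f_def e_def f_def)
  then show ?thesis using sw.efe by simp
qed

text \<open>Made for the products t S t and T s T, which none of the braid relations above rewrites.
  The skein relation reduces them to e between letters t or T; such a product becomes f between
  letters s or S, because f e f collapses to f.\<close>

lemma tet: "t \<otimes> (e \<otimes> t) = S \<otimes> (f \<otimes> S)"
proof -
  have "t \<otimes> (e \<otimes> t) = S \<otimes> (s \<otimes> (t \<otimes> e)) \<otimes> t"
    by (simp add: inv' m_assoc)
  also have "\<dots> = S \<otimes> (f \<otimes> e) \<otimes> t"
    by (simp only: ste fst_eq)
  also have "\<dots> = S \<otimes> (f \<otimes> ((e \<otimes> (t \<otimes> s)) \<otimes> S))"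
    by (simp add: m_assoc inv)
  also have "\<dots> = S \<otimes> ((f \<otimes> (e \<otimes> f)) \<otimes> S)"
    by (simp add: ets m_assoc)
  finally show ?thesis by (simp only: fef)
qed

lemma TeT: "T \<otimes> (e \<otimes> T) = s \<otimes> (f \<otimes> s)"
proof -
  interpret sw: bmw_pair_rel R t T s S \<zeta> \<alpha> \<beta> by (rule swapped)
  have "sw.e = f" "sw.f = e" by (simp_all add: sw.e_def sw.f_def e_def f_def)
  then show ?thesis using sw.tet by simp
qed

end

section \<open>Relations among classes in the quotient algebra\<close>

context fixes N :: nat begin

interpretation B: ring "BMW N" by (rule BMW_ring)

lemma class_closed: "x \<in> carrier (FA N) \<Longrightarrow> bmw_class N x \<in> carrier (BMW N)"
  by (rule ring_hom_closed[OF bmw_class_hom])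

lemma class_mult: "x \<in> carrier (FA N) \<Longrightarrow> y \<in> carrier (FA N) \<Longrightarrow>
    bmw_class N (x * y) = bmw_class N x \<otimes>\<^bsub>BMW N\<^esub> bmw_class N y"
  using ring_hom_mult[OF bmw_class_hom, of x N y] by simp

lemma class_add: "x \<in> carrier (FA N) \<Longrightarrow> y \<in> carrier (FA N) \<Longrightarrow>
    bmw_class N (x + y) = bmw_class N x \<oplus>\<^bsub>BMW N\<^esub> bmw_class N y"
  using ring_hom_add[OF bmw_class_hom, of x N y] by simp

lemma class_one: "bmw_class N 1 = \<one>\<^bsub>BMW N\<^esub>"
  using ring_hom_one[OF bmw_class_hom, of N] by simp

lemma class_diff:
  assumes "x \<in> carrier (FA N)" "y \<in> carrier (FA N)"
  shows "bmw_class N (x - y) = bmw_class N x \<ominus>\<^bsub>BMW N\<^esub> bmw_class N y"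
proof -
  have "bmw_class N x = bmw_class N (x - y) \<oplus>\<^bsub>BMW N\<^esub> bmw_class N y"
    using assms class_add[of "x - y" y] by (simp add: FA_closed)
  then show ?thesis
    using assms by (simp add: B.minus_eq B.a_assoc B.r_neg class_closed FA_closed)
qed

lemma class_eq_iff:
  assumes "x \<in> carrier (FA N)" "y \<in> carrier (FA N)"
  shows "bmw_class N x = bmw_class N y \<longleftrightarrow> x - y \<in> bmw_ideal N"
proof -
  interpret I: ideal "bmw_ideal N" "FA N" by (rule bmw_ideal_ideal)
  show ?thesis
  proof
    assume "bmw_class N x = bmw_class N y"
    then have "x \<in> bmw_class N y"
      using I.a_rcos_self[OF assms(1)] by (simp add: bmw_class_def)
    then show "x - y \<in> bmw_ideal N"
      by (auto simp: bmw_class_def a_r_coset_def r_coset_def)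
  next
    assume "x - y \<in> bmw_ideal N"
    then have "x \<in> bmw_class N y"
      by (force simp: bmw_class_def a_r_coset_def r_coset_def)
    then show "bmw_class N x = bmw_class N y"
      unfolding bmw_class_def using I.a_repr_independence'[OF _ assms(2)] by simp
  qed
qed

lemma class_relator:
  assumes "x - y \<in> bmw_relators N" "x \<in> carrier (FA N)" "y \<in> carrier (FA N)"
  shows "bmw_class N x = bmw_class N y"
  using assms bmw_relators_ideal class_eq_iff by blast

lemma fa_const_commute:
  assumes "f \<in> carrier (FA N)" shows "f * fa_const s = fa_const s * f"
  using assms
  by (induction rule: FA_induct) (simp_all add: distrib_left distrib_right fa_const_def mult_single mult.commute)

lemma class_inverse:
  assumes "1 \<le> i" "i < N"
  shows "bmw_class N (fa_gen i) \<otimes>\<^bsub>BMW N\<^esub> bmw_class N (fa_gen_inv i) = \<one>\<^bsub>BMW N\<^esub>"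
    "bmw_class N (fa_gen_inv i) \<otimes>\<^bsub>BMW N\<^esub> bmw_class N (fa_gen i) = \<one>\<^bsub>BMW N\<^esub>"
proof -
  have "fa_gen i * fa_gen_inv i - 1 \<in> bmw_relators N" "fa_gen_inv i * fa_gen i - 1 \<in> bmw_relators N"
    using assms by (auto simp: bmw_relators_def)
  from this[THEN class_relator] show
    "bmw_class N (fa_gen i) \<otimes>\<^bsub>BMW N\<^esub> bmw_class N (fa_gen_inv i) = \<one>\<^bsub>BMW N\<^esub>"
    "bmw_class N (fa_gen_inv i) \<otimes>\<^bsub>BMW N\<^esub> bmw_class N (fa_gen i) = \<one>\<^bsub>BMW N\<^esub>"
    using FA_gen_closed[OF assms] by (simp_all add: class_mult class_one FA_closed)
qed

lemma class_e:
  assumes "1 \<le> i" "i < N"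
  shows "bmw_class N (fa_e i) = bmw_class N (fa_const sc_z_inv) \<otimes>\<^bsub>BMW N\<^esub>
     (bmw_class N (fa_gen_inv i) \<ominus>\<^bsub>BMW N\<^esub> bmw_class N (fa_gen i)) \<oplus>\<^bsub>BMW N\<^esub> \<one>\<^bsub>BMW N\<^esub>"
  using FA_gen_closed[OF assms]
  by (simp add: fa_e_def class_add class_mult class_diff class_one FA_closed)

lemma class_e_gen:
  assumes "1 \<le> i" "i < N"
  shows "bmw_class N (fa_e i) \<otimes>\<^bsub>BMW N\<^esub> bmw_class N (fa_gen i)
    = bmw_class N (fa_const sc_a_inv) \<otimes>\<^bsub>BMW N\<^esub> bmw_class N (fa_e i)"
proof -
  have "fa_e i * fa_gen i - fa_const sc_a_inv * fa_e i \<in> bmw_relators N"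
    using assms unfolding bmw_relators_def by blast
  from class_relator[OF this] show ?thesis
    using FA_gen_closed[OF assms] by (simp add: class_mult FA_closed)
qed

lemma bmw_pair_rel_class:
  assumes i: "1 \<le> i" "i + 1 < N"
  defines "cl \<equiv> bmw_class N"
  shows "bmw_pair_rel (BMW N) (cl (fa_gen i)) (cl (fa_gen_inv i)) (cl (fa_gen (i + 1))) (cl (fa_gen_inv (i + 1)))
     (cl (fa_const sc_z_inv)) (cl (fa_const sc_a)) (cl (fa_const sc_a_inv))"
proof -
  note mem = FA_gen_closed[of i N] FA_gen_closed[of "i + 1" N]
  note cl = class_closed[folded cl_def] class_mult[folded cl_def] class_one[folded cl_def]
  have const: "fa_const s * fa_const t = fa_const (s * t)" for s t
    by (simp add: fa_const_def mult_single)
  have one: "fa_const 1 = 1" by (simp add: fa_const_def)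
  have central: "x \<otimes>\<^bsub>BMW N\<^esub> cl (fa_const s) = cl (fa_const s) \<otimes>\<^bsub>BMW N\<^esub> x"
    if x: "x \<in> carrier (BMW N)" for x s
  proof -
    obtain y where y: "y \<in> carrier (FA N)" "x = cl y"
      using x unfolding bmw_carrier cl_def by blast
    show ?thesis
      unfolding y(2) cl(2)[OF y(1) FA_closed(3), symmetric] cl(2)[OF FA_closed(3) y(1), symmetric]
      by (simp only: fa_const_commute[OF y(1)])
  qed
  have rel: "fa_gen i * fa_gen (i + 1) * fa_gen i - fa_gen (i + 1) * fa_gen i * fa_gen (i + 1) \<in> bmw_relators N"
    "fa_e i * fa_gen (i + 1) * fa_e i - fa_const sc_a * fa_e i \<in> bmw_relators N"
    "fa_e i * fa_gen_inv (i + 1) * fa_e i - fa_const sc_a_inv * fa_e i \<in> bmw_relators N"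
    using i unfolding bmw_relators_def by blast+
  have braid: "cl (fa_gen i) \<otimes>\<^bsub>BMW N\<^esub> (cl (fa_gen (i + 1)) \<otimes>\<^bsub>BMW N\<^esub> cl (fa_gen i)) =
     cl (fa_gen (i + 1)) \<otimes>\<^bsub>BMW N\<^esub> (cl (fa_gen i) \<otimes>\<^bsub>BMW N\<^esub> cl (fa_gen (i + 1)))"
    using class_relator[OF rel(1)] mem i by (simp add: cl FA_closed B.m_assoc flip: cl_def)
  interpret bmw_pair "BMW N" "cl (fa_gen i)" "cl (fa_gen_inv i)" "cl (fa_gen (i + 1))" "cl (fa_gen_inv (i + 1))"
     "cl (fa_const sc_z_inv)" "cl (fa_const sc_a)" "cl (fa_const sc_a_inv)"
    using mem i class_inverse[folded cl_def, of i] class_inverse[folded cl_def, of "i + 1"] braid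
      cl(2)[of "fa_const sc_a" "fa_const sc_a_inv"]
    by unfold_locales (erule central | simp add: cl FA_closed const sc_a_inverse one)+
  have ef: "e = cl (fa_e i)" "f = cl (fa_e (i + 1))"
    unfolding e_def f_def using class_e[of i, folded cl_def] class_e[of "i + 1", folded cl_def] i by simp_all
  show ?thesis
  proof unfold_locales
    show "e \<otimes>\<^bsub>BMW N\<^esub> cl (fa_gen i) = cl (fa_const sc_a_inv) \<otimes>\<^bsub>BMW N\<^esub> e"
      "f \<otimes>\<^bsub>BMW N\<^esub> cl (fa_gen (i + 1)) = cl (fa_const sc_a_inv) \<otimes>\<^bsub>BMW N\<^esub> f"
      unfolding ef using class_e_gen[of i, folded cl_def] class_e_gen[of "i + 1", folded cl_def] i by simp_all
    show "e \<otimes>\<^bsub>BMW N\<^esub> (cl (fa_gen (i + 1)) \<otimes>\<^bsub>BMW N\<^esub> e) = cl (fa_const sc_a) \<otimes>\<^bsub>BMW N\<^esub> e"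
      "e \<otimes>\<^bsub>BMW N\<^esub> (cl (fa_gen_inv (i + 1)) \<otimes>\<^bsub>BMW N\<^esub> e) = cl (fa_const sc_a_inv) \<otimes>\<^bsub>BMW N\<^esub> e"
      unfolding ef using class_relator[OF rel(2)] class_relator[OF rel(3)] mem i
      by (simp_all add: cl FA_closed B.m_assoc flip: cl_def)
  qed
qed

end

section \<open>Spanning of n + 1 strands over n strands\<close>

lemma FA_gen_induct [consumes 1, case_names const add gen gen_inv]:
  assumes "f \<in> carrier (FA n)"
    and const: "\<And>s. P (fa_const s)"
    and add: "\<And>f g. f \<in> carrier (FA n) \<Longrightarrow> g \<in> carrier (FA n) \<Longrightarrow> P f \<Longrightarrow> P g \<Longrightarrow> P (f + g)"
    and gen: "\<And>i f. 1 \<le> i \<Longrightarrow> i < n \<Longrightarrow> f \<in> carrier (FA n) \<Longrightarrow> P f \<Longrightarrow> P (fa_gen i * f)"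
    and gen_inv: "\<And>i f. 1 \<le> i \<Longrightarrow> i < n \<Longrightarrow> f \<in> carrier (FA n) \<Longrightarrow> P f \<Longrightarrow> P (fa_gen_inv i * f)"
  shows "P f"
  using assms(1)
proof (induction rule: FA_induct)
  case zero
  show ?case using const[of 0] by (simp add: fa_const_def)
next
  case (add f g)
  then show ?case by (rule assms(3))
next
  case (single w s)
  have "P (Poly_Mapping.single (BWord ls) s) \<and> Poly_Mapping.single (BWord ls) s \<in> carrier (FA n)"
    if "\<forall>l\<in>set ls. letter_index l \<in> {1..<n}" for ls
    using that
  proof (induction ls)
    case Nil
    show ?case using const[of s] FA_closed(3)[of s n] by (simp add: fa_const_def zero_braid_word_def)
  next
    case (Cons l ls)
    have "Poly_Mapping.single (BWord (Gen i # ls)) s = fa_gen i * Poly_Mapping.single (BWord ls) s"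
      "Poly_Mapping.single (BWord (GenInv i # ls)) s = fa_gen_inv i * Poly_Mapping.single (BWord ls) s" for i
      by (simp_all add: fa_gen_def fa_gen_inv_def mult_single plus_braid_word_def)
    then show ?case
      using Cons gen gen_inv FA_gen_closed by (cases l) (auto simp: FA_closed)
  qed
  then show ?case using single by (cases w) (auto simp: words_def)
qed

text \<open>Formulated on representatives, with \<open>cong\<close> for the passage to the quotient,
  so that its induction rule is the recipe for trace values. Scalars are absorbed by u, and
  \<open>u * fa_e n * v\<close> is a combination of the listed forms.\<close>

inductive_set bmw_span :: "nat \<Rightarrow> free_alg set" for n where
  base: "u \<in> carrier (FA n) \<Longrightarrow> u \<in> bmw_span n"
| gen: "u \<in> carrier (FA n) \<Longrightarrow> v \<in> carrier (FA n) \<Longrightarrow> u * fa_gen n * v \<in> bmw_span n"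
| gen_inv: "u \<in> carrier (FA n) \<Longrightarrow> v \<in> carrier (FA n) \<Longrightarrow> u * fa_gen_inv n * v \<in> bmw_span n"
| add: "x \<in> bmw_span n \<Longrightarrow> y \<in> bmw_span n \<Longrightarrow> x + y \<in> bmw_span n"
| cong: "x \<in> bmw_span n \<Longrightarrow> y \<in> carrier (FA (Suc n)) \<Longrightarrow> x - y \<in> bmw_ideal (Suc n) \<Longrightarrow> y \<in> bmw_span n"

context fixes n :: nat assumes n: "1 \<le> n" begin

lemma gens_Suc: "fa_gen n \<in> carrier (FA (Suc n))" "fa_gen_inv n \<in> carrier (FA (Suc n))" "fa_e n \<in> carrier (FA (Suc n))"
  using FA_gen_closed[of n "Suc n"] n by auto

lemma span_closed: "x \<in> bmw_span n \<Longrightarrow> x \<in> carrier (FA (Suc n))"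
  by (induction rule: bmw_span.induct) (auto simp: FA_closed gens_Suc FA_Suc)

lemma span_cong:
  "x \<in> bmw_span n \<Longrightarrow> y \<in> carrier (FA (Suc n)) \<Longrightarrow> bmw_class (Suc n) x = bmw_class (Suc n) y \<Longrightarrow> y \<in> bmw_span n"
  using bmw_span.cong class_eq_iff span_closed by blast

lemma span_left: "x \<in> bmw_span n \<Longrightarrow> w \<in> carrier (FA n) \<Longrightarrow> w * x \<in> bmw_span n"
proof (induction rule: bmw_span.induct)
  case (gen u v)
  then show ?case using bmw_span.gen[of "w * u" n v] by (simp add: FA_closed mult.assoc)
next
  case (gen_inv u v)
  then show ?case using bmw_span.gen_inv[of "w * u" n v] by (simp add: FA_closed mult.assoc)
next
  case (cong x y)
  have w: "w \<in> carrier (FA (Suc n))" using cong FA_Suc by auto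
  have "bmw_class (Suc n) x = bmw_class (Suc n) y"
    using cong span_closed[of x] by (simp add: class_eq_iff)
  then have eq: "bmw_class (Suc n) (w * x) = bmw_class (Suc n) (w * y)"
    using cong w span_closed[of x] by (simp add: class_mult)
  show ?case
    by (rule span_cong[OF _ _ eq]) (use cong w in \<open>auto simp: FA_closed\<close>)
qed (auto simp: distrib_left intro: bmw_span.base bmw_span.add FA_closed)

lemma span_right: "x \<in> bmw_span n \<Longrightarrow> w \<in> carrier (FA n) \<Longrightarrow> x * w \<in> bmw_span n"
proof (induction rule: bmw_span.induct)
  case (gen u v)
  then show ?case using bmw_span.gen[of u n "v * w"] by (simp add: FA_closed mult.assoc)
next
  case (gen_inv u v)
  then show ?case using bmw_span.gen_inv[of u n "v * w"] by (simp add: FA_closed mult.assoc)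
next
  case (cong x y)
  have w: "w \<in> carrier (FA (Suc n))" using cong FA_Suc by auto
  have "bmw_class (Suc n) x = bmw_class (Suc n) y"
    using cong span_closed[of x] by (simp add: class_eq_iff)
  then have eq: "bmw_class (Suc n) (x * w) = bmw_class (Suc n) (y * w)"
    using cong w span_closed[of x] by (simp add: class_mult)
  show ?case
    by (rule span_cong[OF _ _ eq]) (use cong w in \<open>auto simp: FA_closed\<close>)
qed (auto simp: distrib_right intro: bmw_span.base bmw_span.add FA_closed)

lemma span_uminus: "x \<in> bmw_span n \<Longrightarrow> - x \<in> bmw_span n"
  using span_left[of x "- 1"] by (simp add: FA_closed)

lemma span_diff: "x \<in> bmw_span n \<Longrightarrow> y \<in> bmw_span n \<Longrightarrow> x - y \<in> bmw_span n"
  using bmw_span.add[of x n "- y"] span_uminus[of y] by simp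

lemma span_const: "x \<in> bmw_span n \<Longrightarrow> fa_const s * x \<in> bmw_span n"
  by (rule span_left) (simp_all add: FA_closed)

lemma span_gens: "fa_gen n \<in> bmw_span n" "fa_gen_inv n \<in> bmw_span n" "fa_e n \<in> bmw_span n"
proof -
  show *: "fa_gen n \<in> bmw_span n" "fa_gen_inv n \<in> bmw_span n"
    using bmw_span.gen[of 1 n 1] bmw_span.gen_inv[of 1 n 1] by (simp_all add: FA_closed)
  show "fa_e n \<in> bmw_span n"
    unfolding fa_e_def
    by (intro bmw_span.add span_const span_diff * bmw_span.base) (simp add: FA_closed)
qed

text \<open>The skein relation holds already in the free algebra, because \<open>fa_e\<close> is
  defined by solving it.\<close>

lemma gen_inv_eq: "fa_gen_inv i = fa_gen i + fa_const (sc_q - sc_q_inv) * fa_e i - fa_const (sc_q - sc_q_inv)"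
proof -
  have "fa_const (sc_q - sc_q_inv) * fa_const sc_z_inv = 1"
    by (simp add: fa_const_def mult_single sc_z_inverse)
  then have "fa_const (sc_q - sc_q_inv) * (fa_const sc_z_inv * x) = x" for x
    by (simp flip: mult.assoc)
  then show ?thesis by (simp add: fa_e_def distrib_left)
qed

text \<open>The skein relation trades a square for a mixed product, which is 1 in the quotient, a
  multiple of a single letter, and \<open>fa_e n\<close> times a letter, which is a scalar multiple
  of \<open>fa_e n\<close>.\<close>

lemma span_square:
  assumes "g \<in> {fa_gen n, fa_gen_inv n}" "h \<in> {fa_gen n, fa_gen_inv n}"
  shows "g * h \<in> bmw_span n"
proof -
  let ?c = "bmw_class (Suc n)"
  let ?z = "fa_const (sc_q - sc_q_inv)"
  have nS: "n < Suc n" by simp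
  note cls = class_mult class_one FA_closed gens_Suc
  interpret B: ring "BMW (Suc n)" by (rule BMW_ring)
  have one: "1 \<in> bmw_span n" by (rule bmw_span.base) (simp add: FA_closed)
  have mixed: "fa_gen n * fa_gen_inv n \<in> bmw_span n" "fa_gen_inv n * fa_gen n \<in> bmw_span n"
    by (rule span_cong[OF one]; simp add: cls class_inverse[OF n nS])+
  have eg: "fa_e n * fa_gen n \<in> bmw_span n"
    by (rule span_cong[OF span_const[OF span_gens(3), of sc_a_inv]]) (simp_all add: cls class_e_gen[OF n nS])
  have "?c (fa_e n) \<otimes>\<^bsub>BMW (Suc n)\<^esub> ?c (fa_gen_inv n) = ?c (fa_const sc_a) \<otimes>\<^bsub>BMW (Suc n)\<^esub> ?c (fa_e n)"
  proof -
    have "fa_const sc_a * fa_const sc_a_inv = 1" by (simp add: fa_const_def mult_single sc_a_inverse)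
    then have "fa_const sc_a * (fa_const sc_a_inv * x) = x" for x by (simp flip: mult.assoc)
    then have "?c (fa_e n) = ?c (fa_const sc_a) \<otimes>\<^bsub>BMW (Suc n)\<^esub> (?c (fa_e n) \<otimes>\<^bsub>BMW (Suc n)\<^esub> ?c (fa_gen n))"
      unfolding class_e_gen[OF n nS] by (simp add: FA_closed gens_Suc flip: class_mult)
    note eq = this
    have "?c (fa_e n) \<otimes>\<^bsub>BMW (Suc n)\<^esub> ?c (fa_gen_inv n) =
        (?c (fa_const sc_a) \<otimes>\<^bsub>BMW (Suc n)\<^esub> (?c (fa_e n) \<otimes>\<^bsub>BMW (Suc n)\<^esub> ?c (fa_gen n))) \<otimes>\<^bsub>BMW (Suc n)\<^esub> ?c (fa_gen_inv n)"
      by (rule arg_cong[OF eq])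
    also have "\<dots> = ?c (fa_const sc_a) \<otimes>\<^bsub>BMW (Suc n)\<^esub> ?c (fa_e n)"
      by (simp add: B.m_assoc class_inverse[OF n nS] class_closed FA_closed gens_Suc)
    finally show ?thesis .
  qed
  then have eG: "fa_e n * fa_gen_inv n \<in> bmw_span n"
    by (intro span_cong[OF span_const[OF span_gens(3), of sc_a]]) (simp_all add: cls)
  have G: "fa_gen_inv n * x = fa_gen n * x + ?z * (fa_e n * x) - ?z * x" for x
    by (subst gen_inv_eq) (simp only: distrib_right left_diff_distrib mult.assoc)
  have "fa_gen n * fa_gen n = fa_gen_inv n * fa_gen n - ?z * (fa_e n * fa_gen n) + ?z * fa_gen n"
    unfolding G by simp
  moreover have "fa_gen_inv n * fa_gen_inv n = fa_gen n * fa_gen_inv n + ?z * (fa_e n * fa_gen_inv n) - ?z * fa_gen_inv n"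
    by (rule G)
  ultimately have "fa_gen n * fa_gen n \<in> bmw_span n" "fa_gen_inv n * fa_gen_inv n \<in> bmw_span n"
    using mixed eg eG by (auto intro!: bmw_span.add span_diff span_const span_gens)
  then show ?thesis using mixed assms by auto
qed

text \<open>On \<open>n - 1\<close> strands the letters have index at most \<open>n - 2\<close>,
  hence distance at least 2 from n. The relators speak of the generators only; commutation with
  inverses is deduced by conjugation.\<close>

lemma class_commute:
  assumes "g \<in> {fa_gen n, fa_gen_inv n}" "u \<in> carrier (FA (n - 1))"
  shows "bmw_class (Suc n) (g * u) = bmw_class (Suc n) (u * g)"
proof -
  let ?c = "bmw_class (Suc n)"
  interpret B: ring "BMW (Suc n)" by (rule BMW_ring)
  have inv_comm: "X \<otimes>\<^bsub>BMW (Suc n)\<^esub> y = y \<otimes>\<^bsub>BMW (Suc n)\<^esub> X"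
    if "x \<otimes>\<^bsub>BMW (Suc n)\<^esub> X = \<one>\<^bsub>BMW (Suc n)\<^esub>" "X \<otimes>\<^bsub>BMW (Suc n)\<^esub> x = \<one>\<^bsub>BMW (Suc n)\<^esub>"
      "x \<otimes>\<^bsub>BMW (Suc n)\<^esub> y = y \<otimes>\<^bsub>BMW (Suc n)\<^esub> x"
      "x \<in> carrier (BMW (Suc n))" "X \<in> carrier (BMW (Suc n))" "y \<in> carrier (BMW (Suc n))" for x X y
  proof -
    have "X \<otimes>\<^bsub>BMW (Suc n)\<^esub> y = X \<otimes>\<^bsub>BMW (Suc n)\<^esub> (y \<otimes>\<^bsub>BMW (Suc n)\<^esub> x) \<otimes>\<^bsub>BMW (Suc n)\<^esub> X"
      using that by (simp add: B.m_assoc)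
    also have "\<dots> = X \<otimes>\<^bsub>BMW (Suc n)\<^esub> (x \<otimes>\<^bsub>BMW (Suc n)\<^esub> y) \<otimes>\<^bsub>BMW (Suc n)\<^esub> X"
      by (simp only: that(3))
    also have "\<dots> = (X \<otimes>\<^bsub>BMW (Suc n)\<^esub> x) \<otimes>\<^bsub>BMW (Suc n)\<^esub> y \<otimes>\<^bsub>BMW (Suc n)\<^esub> X"
      using that(4-6) by (simp add: B.m_assoc)
    finally show ?thesis using that by simp
  qed
  have mem: "fa_gen j \<in> carrier (FA (Suc n))" "fa_gen_inv j \<in> carrier (FA (Suc n))" if "1 \<le> j" "j < n - 1" for j
    using that FA_gen_closed[of j "Suc n"] by auto
  note cl = class_closed[OF mem(1)] class_closed[OF mem(2)] class_closed[OF gens_Suc(1)] class_closed[OF gens_Suc(2)]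
  note inv = class_inverse[OF n lessI]
  have 1: "?c (fa_gen n) \<otimes>\<^bsub>BMW (Suc n)\<^esub> ?c (fa_gen j) = ?c (fa_gen j) \<otimes>\<^bsub>BMW (Suc n)\<^esub> ?c (fa_gen n)"
    if j: "1 \<le> j" "j < n - 1" for j
  proof -
    have "2 \<le> \<bar>int n - int j\<bar>" "j < Suc n" using j by auto
    then have "fa_gen n * fa_gen j - fa_gen j * fa_gen n \<in> bmw_relators (Suc n)"
      using j n unfolding bmw_relators_def by blast
    from class_relator[OF this] show ?thesis
      using mem[OF j] gens_Suc by (simp add: FA_closed class_mult)
  qed
  have 2: "?c (fa_gen_inv n) \<otimes>\<^bsub>BMW (Suc n)\<^esub> ?c (fa_gen j) = ?c (fa_gen j) \<otimes>\<^bsub>BMW (Suc n)\<^esub> ?c (fa_gen_inv n)"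
    if j: "1 \<le> j" "j < n - 1" for j
    by (rule inv_comm[OF inv 1[OF j]]) (use cl(1)[OF j] cl(3,4) in simp_all)
  have 3: "?c g \<otimes>\<^bsub>BMW (Suc n)\<^esub> ?c (fa_gen j) = ?c (fa_gen j) \<otimes>\<^bsub>BMW (Suc n)\<^esub> ?c g"
    if j: "1 \<le> j" "j < n - 1" for j
    using 1[OF j] 2[OF j] assms(1) by auto
  have g: "g \<in> carrier (FA (Suc n))" using assms(1) gens_Suc by auto
  have 4: "?c g \<otimes>\<^bsub>BMW (Suc n)\<^esub> ?c (fa_gen_inv j) = ?c (fa_gen_inv j) \<otimes>\<^bsub>BMW (Suc n)\<^esub> ?c g"
    if j: "1 \<le> j" "j < n - 1" for j
    by (rule inv_comm[OF class_inverse 3[OF j, symmetric], symmetric]) (use j cl(1)[OF j] cl(2)[OF j] class_closed[OF g] in auto)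
  have FA: "f \<in> carrier (FA (Suc n))" if "f \<in> carrier (FA (n - 1))" for f
    using FA_Suc[OF FA_Suc[OF that]] FA_Suc[of f n] that n by (cases "n = 1") auto
  show ?thesis using assms(2)
  proof (induction rule: FA_gen_induct)
    case (const s)
    then show ?case using fa_const_commute[OF g] by simp
  next
    case (add f h)
    then show ?case using g FA by (simp add: distrib_left distrib_right class_add FA_closed)
  next
    case (gen i f)
    then have "?c (g * (fa_gen i * f)) = (?c g \<otimes>\<^bsub>BMW (Suc n)\<^esub> ?c (fa_gen i)) \<otimes>\<^bsub>BMW (Suc n)\<^esub> ?c f"
      using g FA mem by (simp add: class_mult FA_closed B.m_assoc class_closed)
    also have "\<dots> = ?c (fa_gen i) \<otimes>\<^bsub>BMW (Suc n)\<^esub> ?c (g * f)"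
      using gen g FA mem by (simp add: 3 class_mult FA_closed B.m_assoc class_closed)
    also have "\<dots> = ?c (fa_gen i * f * g)"
      unfolding gen using gen(1-3) g FA mem by (simp add: class_mult FA_closed B.m_assoc class_closed)
    finally show ?case .
  next
    case (gen_inv i f)
    then have "?c (g * (fa_gen_inv i * f)) = (?c g \<otimes>\<^bsub>BMW (Suc n)\<^esub> ?c (fa_gen_inv i)) \<otimes>\<^bsub>BMW (Suc n)\<^esub> ?c f"
      using g FA mem by (simp add: class_mult FA_closed B.m_assoc class_closed)
    also have "\<dots> = ?c (fa_gen_inv i) \<otimes>\<^bsub>BMW (Suc n)\<^esub> ?c (g * f)"
      using gen_inv g FA mem by (simp add: 4 class_mult FA_closed B.m_assoc class_closed)
    also have "\<dots> = ?c (fa_gen_inv i * f * g)"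
      unfolding gen_inv using gen_inv(1-3) g FA mem by (simp add: class_mult FA_closed B.m_assoc class_closed)
    finally show ?case .
  qed
qed

text \<open>Of the eight sign patterns, six become words with index n only in the middle by a form
  of the braid relation. The other two, t S t and T s T, need the skein relation on the middle
  letter together with \<open>tet\<close> and \<open>TeT\<close>.\<close>

lemma span_triple:
  assumes "g \<in> {fa_gen n, fa_gen_inv n}" "k \<in> {fa_gen n, fa_gen_inv n}" "h \<in> {fa_gen i, fa_gen_inv i}"
    and i: "1 \<le> i" "n = i + 1"
  shows "g * h * k \<in> bmw_span n"
proof -
  let ?c = "bmw_class (Suc n)"
  let ?s = "fa_gen i" and ?S = "fa_gen_inv i" and ?t = "fa_gen n" and ?T = "fa_gen_inv n" and ?e = "fa_e i" and ?f = "fa_e n"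
  let ?z = "fa_const (sc_q - sc_q_inv)"
  interpret P: bmw_pair_rel "BMW (Suc n)" "?c ?s" "?c ?S" "?c ?t" "?c ?T"
     "?c (fa_const sc_z_inv)" "?c (fa_const sc_a)" "?c (fa_const sc_a_inv)"
    using bmw_pair_rel_class[of i "Suc n"] i by simp
  have ef: "P.e = ?c ?e" "P.f = ?c ?f"
    unfolding P.e_def P.f_def using class_e[of i "Suc n"] class_e[of n "Suc n"] i by simp_all
  have mem: "?s \<in> carrier (FA n)" "?S \<in> carrier (FA n)" "?e \<in> carrier (FA n)"
    using FA_gen_closed[of i n] i by auto
  note memS = mem[THEN FA_Suc] gens_Suc
  note cl = class_mult FA_closed memS P.m_assoc class_closed
  have B: "u * y * v \<in> bmw_span n" if "u \<in> carrier (FA n)" "v \<in> carrier (FA n)" "y \<in> bmw_span n" for u y v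
    using that span_left span_right by blast
  have "?t * ?s * ?t \<in> bmw_span n"
    by (rule span_cong[OF B[OF mem(1) mem(1) span_gens(1)]]) (simp_all add: cl P.braid)
  moreover have "?t * ?s * ?T \<in> bmw_span n"
    by (rule span_cong[OF B[OF mem(2) mem(1) span_gens(1)]]) (simp_all add: cl P.braid_inv)
  moreover have "?T * ?s * ?t \<in> bmw_span n"
    by (rule span_cong[OF B[OF mem(1) mem(2) span_gens(1)]]) (simp_all add: cl P.braid_inv)
  moreover have "?t * ?S * ?T \<in> bmw_span n"
    by (rule span_cong[OF B[OF mem(2) mem(1) span_gens(2)]]) (simp_all add: cl P.braid_inv)
  moreover have "?T * ?S * ?t \<in> bmw_span n"
    by (rule span_cong[OF B[OF mem(1) mem(2) span_gens(2)]]) (simp_all add: cl P.braid_inv)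
  moreover have "?T * ?S * ?T \<in> bmw_span n"
    by (rule span_cong[OF B[OF mem(2) mem(2) span_gens(2)]]) (simp_all add: cl P.braid_inv)
  moreover have "?t * ?S * ?t \<in> bmw_span n"
  proof -
    have "?t * ?e * ?t \<in> bmw_span n"
      by (rule span_cong[OF B[OF mem(2) mem(2) span_gens(3)]]) (simp_all add: cl P.tet[unfolded ef])
    moreover have "?t * ?S * ?t = ?t * ?s * ?t + ?z * (?t * ?e * ?t) - ?z * (?t * ?t)"
      by (simp add: gen_inv_eq[of i] distrib_left distrib_right left_diff_distrib right_diff_distrib mult.assoc
          fa_const_commute[OF gens_Suc(1)] fa_const_commute[OF gens_Suc(1), THEN arg_cong[of _ _ "\<lambda>x. x * _"], unfolded mult.assoc])
    ultimately show ?thesis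
      using \<open>?t * ?s * ?t \<in> bmw_span n\<close> span_square
      by (auto intro!: bmw_span.add span_diff span_const)
  qed
  moreover have "?T * ?s * ?T \<in> bmw_span n"
  proof -
    have "?T * ?e * ?T \<in> bmw_span n"
      by (rule span_cong[OF B[OF mem(1) mem(1) span_gens(3)]]) (simp_all add: cl P.TeT[unfolded ef])
    moreover have "?T * ?S * ?T = ?T * ?s * ?T + ?z * (?T * ?e * ?T) - ?z * (?T * ?T)"
      by (simp add: gen_inv_eq[of i] distrib_left distrib_right left_diff_distrib right_diff_distrib mult.assoc
          fa_const_commute[OF gens_Suc(2)] fa_const_commute[OF gens_Suc(2), THEN arg_cong[of _ _ "\<lambda>x. x * _"], unfolded mult.assoc])
    then have "?T * ?s * ?T = ?T * ?S * ?T - ?z * (?T * ?e * ?T) + ?z * (?T * ?T)"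
      by simp
    ultimately show ?thesis
      using \<open>?T * ?S * ?T \<in> bmw_span n\<close> span_square
      by (auto intro!: bmw_span.add span_diff span_const)
  qed
  ultimately show ?thesis using assms(1-3) by auto
qed

text \<open>The span contains the scalars, so it is everything once it is closed under left
  multiplication by letters. Only the letters of index n are problematic, and they lead to the
  products \<open>g * u * h\<close>.\<close>

lemma span_all:
  assumes sandwich: "\<And>g h u. g \<in> {fa_gen n, fa_gen_inv n} \<Longrightarrow> h \<in> {fa_gen n, fa_gen_inv n} \<Longrightarrow> u \<in> carrier (FA n) \<Longrightarrow>
      g * u * h \<in> bmw_span n"
    and f: "f \<in> carrier (FA (Suc n))"
  shows "f \<in> bmw_span n"
proof -
  have left: "g * x \<in> bmw_span n" if x: "x \<in> bmw_span n" and g: "g \<in> {fa_gen n, fa_gen_inv n}" for g x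
    using x
  proof (induction rule: bmw_span.induct)
    case (base u)
    then show ?case using g bmw_span.gen[of 1 n u] bmw_span.gen_inv[of 1 n u] by (auto simp: FA_closed)
  next
    case (gen u v)
    then show ?case using span_right[OF sandwich[OF g, of "fa_gen n" u], of v] by (simp add: mult.assoc)
  next
    case (gen_inv u v)
    then show ?case using span_right[OF sandwich[OF g, of "fa_gen_inv n" u], of v] by (simp add: mult.assoc)
  next
    case (add x y)
    then show ?case by (simp add: distrib_left bmw_span.add)
  next
    case (cong x y)
    have gc: "g \<in> carrier (FA (Suc n))" using g gens_Suc by auto
    have "bmw_class (Suc n) x = bmw_class (Suc n) y"
      using cong span_closed[of x] by (simp add: class_eq_iff)
    then have eq: "bmw_class (Suc n) (g * x) = bmw_class (Suc n) (g * y)"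
      using cong gc span_closed[of x] by (simp add: class_mult)
    show ?case
      by (rule span_cong[OF _ _ eq]) (use cong gc in \<open>auto simp: FA_closed\<close>)
  qed
  show ?thesis using f
  proof (induction rule: FA_gen_induct)
    case (const s)
    then show ?case by (intro bmw_span.base) (simp add: FA_closed)
  next
    case (gen i f)
    then show ?case using left[of f "fa_gen i"] span_left[of f "fa_gen i"] FA_gen_closed[of i n] by (cases "i = n") auto
  next
    case (gen_inv i f)
    then show ?case using left[of f "fa_gen_inv i"] span_left[of f "fa_gen_inv i"] FA_gen_closed[of i n] by (cases "i = n") auto
  qed (rule bmw_span.add)
qed

lemma sandwich_commute:
  assumes g: "g \<in> {fa_gen n, fa_gen_inv n}" and h: "h \<in> carrier (FA (Suc n))" and u: "u \<in> carrier (FA (n - 1))"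
    and "g * h \<in> bmw_span n"
  shows "g * (u * h) \<in> bmw_span n"
proof -
  have uS: "u \<in> carrier (FA n)" using FA_Suc[OF u] n by simp
  note mem = g h uS FA_Suc[OF uS]
  interpret B: ring "BMW (Suc n)" by (rule BMW_ring)
  have gc: "g \<in> carrier (FA (Suc n))" using g gens_Suc by auto
  have "bmw_class (Suc n) (u * (g * h)) = bmw_class (Suc n) (u * g) \<otimes>\<^bsub>BMW (Suc n)\<^esub> bmw_class (Suc n) h"
    using mem gc by (simp add: FA_closed flip: class_mult mult.assoc)
  also have "\<dots> = bmw_class (Suc n) (g * (u * h))"
    unfolding class_commute[OF g u, symmetric] using mem gc by (simp add: FA_closed mult.assoc flip: class_mult)
  finally show ?thesis
    by (intro span_cong[OF span_left[OF assms(4) uS]]) (use mem gc in \<open>simp_all add: FA_closed\<close>)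
qed

end

text \<open>In a product \<open>g * u * h\<close> with outer letters of index \<open>Suc n\<close>,
  the level below writes u with at most one letter k of index n. Factors from n strands commute with
  g and h, so they move outwards; what remains is \<open>g * h\<close> or \<open>g * k * h\<close>,
  settled by \<open>span_square\<close> and \<open>span_triple\<close>.\<close>

lemma FA_span:
  assumes "1 \<le> n" "f \<in> carrier (FA (Suc n))"
  shows "f \<in> bmw_span n"
  using assms
proof (induction n arbitrary: f rule: nat_induct_at_least)
  case base
  show ?case
  proof (rule span_all[OF _ _ base])
    fix g h u assume *: "g \<in> {fa_gen 1, fa_gen_inv 1}" "h \<in> {fa_gen 1, fa_gen_inv 1}" "u \<in> carrier (FA 1)"
    \<comment> \<open>One strand carries no letters, so u also belongs to \<open>1 - 1\<close>
      strands, as \<open>sandwich_commute\<close> demands.\<close>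
    have "words 1 = words 0" by (auto simp: words_def)
    then have "u \<in> carrier (FA (1 - 1))" using * by (simp add: FA_carrier)
    moreover have "h \<in> carrier (FA (Suc 1))" using * gens_Suc[of 1] by auto
    ultimately show "g * u * h \<in> bmw_span 1"
      using sandwich_commute[of 1 g h u] span_square[of 1 g h] * by (simp add: mult.assoc)
  qed simp
next
  case (Suc n)
  let ?N = "Suc n"
  have N: "1 \<le> ?N" by simp
  show ?case
  proof (rule span_all[OF N _ Suc.prems])
    fix g h u assume g: "g \<in> {fa_gen ?N, fa_gen_inv ?N}" and h: "h \<in> {fa_gen ?N, fa_gen_inv ?N}" and "u \<in> carrier (FA ?N)"
    have gc: "g \<in> carrier (FA (Suc ?N))" and hc: "h \<in> carrier (FA (Suc ?N))"
      using g h gens_Suc[OF N] by auto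
    have triple: "g * (u * k * v) * h \<in> bmw_span ?N"
      if "u \<in> carrier (FA n)" "v \<in> carrier (FA n)" "k \<in> {fa_gen n, fa_gen_inv n}" for u v k
    proof -
      have k: "k \<in> carrier (FA ?N)" using that(3) gens_Suc[OF Suc.hyps] by auto
      have v: "v \<in> carrier (FA ?N)" by (rule FA_Suc[OF that(2)])
      have "g * k * h \<in> bmw_span ?N"
        by (rule span_triple[OF N g h that(3) Suc.hyps]) simp
      then have "g * k * h * v \<in> bmw_span ?N" using v by (rule span_right[OF N])
      have hv: "bmw_class (Suc ?N) (h * v) = bmw_class (Suc ?N) (v * h)"
        using class_commute[OF N h, of v] that(2) by simp
      have "bmw_class (Suc ?N) (g * k * h * v) = bmw_class (Suc ?N) (g * k) \<otimes>\<^bsub>BMW (Suc ?N)\<^esub> bmw_class (Suc ?N) (h * v)"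
        using gc hc k v FA_Suc by (simp add: FA_closed mult.assoc flip: class_mult)
      also have "\<dots> = bmw_class (Suc ?N) (g * (k * v * h))"
        unfolding hv using gc hc k v FA_Suc by (simp add: FA_closed mult.assoc flip: class_mult)
      finally have "g * (k * v * h) \<in> bmw_span ?N"
        by (intro span_cong[OF N \<open>g * k * h * v \<in> bmw_span ?N\<close>]) (use gc hc k v FA_Suc in \<open>simp_all add: FA_closed\<close>)
      then have "g * (u * (k * v * h)) \<in> bmw_span ?N"
        by (intro sandwich_commute[OF N g, of "k * v * h" u]) (use that hc k v FA_Suc in \<open>simp_all add: FA_closed\<close>)
      then show ?thesis by (simp add: mult.assoc)
    qed
    have "u \<in> bmw_span n" by (rule Suc.IH) fact
    then show "g * u * h \<in> bmw_span ?N"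
    proof (induction rule: bmw_span.induct)
      case (base u)
      then show ?case
        using sandwich_commute[OF N g hc, of u] span_square[OF N g h] by (simp add: mult.assoc)
    next
      case (add x y)
      then show ?case using bmw_span.add by (simp add: distrib_left distrib_right)
    next
      case (cong x y)
      have x: "x \<in> carrier (FA ?N)" by (rule span_closed[OF Suc.hyps]) fact
      have "x - y \<in> bmw_ideal (Suc ?N)" using cong(3) bmw_ideal_mono[of ?N] by auto
      then have "bmw_class (Suc ?N) x = bmw_class (Suc ?N) y"
        using x cong(2) FA_Suc by (simp add: class_eq_iff)
      then have eq: "bmw_class (Suc ?N) (g * x * h) = bmw_class (Suc ?N) (g * y * h)"
        using x cong(2) gc hc FA_Suc by (simp add: class_mult FA_closed)
      show ?case
        by (rule span_cong[OF N cong(4) _ eq]) (use gc hc cong(2) FA_Suc in \<open>simp add: FA_closed\<close>)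
    qed (use triple in auto)
  qed
qed

section \<open>Uniqueness, and existence by gluing the specialized traces\<close>

lemma class_representative:
  assumes "X \<in> carrier (BMW n)"
  obtains f where "f \<in> carrier (FA n)" "X = bmw_class n f"
  using assms by (auto simp: bmw_carrier)

lemma FA_1_const:
  assumes "f \<in> carrier (FA 1)"
  obtains s where "f = fa_const s"
proof -
  have "\<exists>s. f = fa_const s"
    using assms
  proof (induction rule: FA_gen_induct)
    case (add f g)
    then show ?case by (auto simp: fa_const_def simp flip: single_add)
  qed auto
  then show ?thesis using that by blast
qed

lemma markov_trace_step:
  assumes t: "markov_trace t" "inclusion_property d t" and n: "1 \<le> n"
    and u: "u \<in> carrier (FA n)" and v: "v \<in> carrier (FA n)"
  shows "t (Suc n) (bmw_class (Suc n) (u * fa_gen n * v)) = sc_a * t n (bmw_class n (u * v))"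
    and "t (Suc n) (bmw_class (Suc n) (u * fa_gen_inv n * v)) = sc_a_inv * t n (bmw_class n (u * v))"
    and "t (Suc n) (bmw_class (Suc n) u) = d * t n (bmw_class n u)"
proof -
  have stab: "stabilization_property n (t n) (t (n + 1))"
    using t(1) n by (simp add: markov_trace_def)
  have cl: "bmw_class n u \<in> carrier (BMW n)" "bmw_class n v \<in> carrier (BMW n)"
    using u v by (simp_all add: class_closed)
  note mem = u v FA_Suc[OF u] FA_Suc[OF v] gens_Suc[OF n]
  have gen: "bmw_gen (n + 1) n = bmw_class (n + 1) (fa_gen n)"
    "inv\<^bsub>BMW (n + 1)\<^esub> (bmw_gen (n + 1) n) = bmw_class (n + 1) (fa_gen_inv n)"
    using n bmw_gen_inverse(2)[of n "n + 1"] by (simp_all add: bmw_gen_def)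
  from stab[unfolded stabilization_property_def gen(2), unfolded gen(1), rule_format, OF cl] show "t (Suc n) (bmw_class (Suc n) (u * fa_gen n * v)) = sc_a * t n (bmw_class n (u * v))"
    "t (Suc n) (bmw_class (Suc n) (u * fa_gen_inv n * v)) = sc_a_inv * t n (bmw_class n (u * v))"
    using mem by (simp_all add: bmw_incl_class class_mult FA_closed)
  show "t (Suc n) (bmw_class (Suc n) u) = d * t n (bmw_class n u)"
    using t(2)[unfolded inclusion_property_def, rule_format, OF n cl(1)] u by (simp add: bmw_incl_class)
qed

lemma linear_functional_class:
  assumes "linear_functional n \<phi>" "f \<in> carrier (FA n)" "g \<in> carrier (FA n)"
  shows "\<phi> (bmw_class n (f + g)) = \<phi> (bmw_class n f) + \<phi> (bmw_class n g)"
    and "\<phi> (bmw_class n (fa_const s * f)) = s * \<phi> (bmw_class n f)"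
  using assms unfolding linear_functional_def
  by (simp_all add: class_closed class_add flip: bmw_smult_class)

lemma markov_trace_unique:
  assumes t: "markov_trace t" "inclusion_property d t" and t': "markov_trace t'" "inclusion_property d t'"
    and eq: "t 1 \<one>\<^bsub>BMW 1\<^esub> = t' 1 \<one>\<^bsub>BMW 1\<^esub>" and "1 \<le> n" and "f \<in> carrier (FA n)"
  shows "t n (bmw_class n f) = t' n (bmw_class n f)"
  using \<open>1 \<le> n\<close> \<open>f \<in> carrier (FA n)\<close>
proof (induction n arbitrary: f rule: nat_induct_at_least)
  case base
  obtain s where s: "f = fa_const s * 1" using FA_1_const[OF base] by auto
  have "linear_functional 1 (t 1)" "linear_functional 1 (t' 1)"
    using t(1) t'(1) by (auto simp: markov_trace_def)
  from this[THEN linear_functional_class(2), of 1 1 s] show ?case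
    using eq by (simp add: s FA_closed class_one)
next
  case (Suc n)
  have lin: "linear_functional (Suc n) (t (Suc n))" "linear_functional (Suc n) (t' (Suc n))"
    using t(1) t'(1) by (auto simp: markov_trace_def)
  note step = markov_trace_step[OF t Suc.hyps] markov_trace_step[OF t' Suc.hyps]
  have "f \<in> bmw_span n" by (rule FA_span) fact+
  then show ?case
  proof (induction rule: bmw_span.induct)
    case (add x y)
    then show ?case
      using lin[THEN linear_functional_class(1), of x y] span_closed[OF Suc.hyps] by simp
  next
    case (cong x y)
    then have "bmw_class (Suc n) x = bmw_class (Suc n) y"
      using span_closed[OF Suc.hyps, of x] by (simp add: class_eq_iff)
    then show ?case using cong by simp
  qed (simp_all add: step Suc.IH FA_closed)
qed

theorem theorem2p3:
  fixes c :: scalar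
  shows "\<exists>!t. t \<in> (\<Pi>\<^sub>E n\<in>{1..}. carrier (BMW n) \<rightarrow>\<^sub>E (UNIV :: scalar set)) \<and>
              markov_trace t \<and> inclusion_property bmw_delta t \<and> t 1 \<one>\<^bsub>BMW 1\<^esub> = c"
proof (rule ex_ex1I)
  \<comment> \<open>Chosen for all x, but meaningful only for x > 1.\<close>
  define \<phi> where "\<phi> x m = (SOME \<phi>. specialized_trace (curve_ev x m) \<phi>)" for x m
  have \<phi>: "specialized_trace (curve_ev x m) (\<phi> x m)" if "1 < x" for x m
    unfolding \<phi>_def by (rule someI_ex[OF specialized_trace_exists[OF that]])
  \<comment> \<open>A scalar s is a value of f if it specializes correctly at every point of the
    curves. Each trace axiom passes to this relation pointwise, with no recipe involved.\<close>
  define val where "val n f s \<longleftrightarrow> (\<forall>x>1. \<forall>m. curve_ev x m s = \<phi> x m n f)" for n f s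
  note hom = curve_ev_hom
  have \<phi>_cong: "\<phi> x m n f = \<phi> x m n g" if "1 < x" "f - g \<in> bmw_ideal n" for x m n f g
  proof -
    have "\<phi> x m n ((f - g) + g) = \<phi> x m n (f - g) + \<phi> x m n g"
      by (rule specialized_trace.add[OF \<phi>[OF that(1)]])
    then show ?thesis using specialized_trace.ideal[OF \<phi>[OF that(1)] that(2)] by simp
  qed
  have val_add: "val n (f + g) (s + t)" if "val n f s" "val n g t" for n f g s t
    using that by (simp add: val_def hom specialized_trace.add[OF \<phi>])
  have val_scale: "val n (fa_const s * f) (s * t)" if "val n f t" "f \<in> carrier (FA n)" for n f s t
    using that by (simp add: val_def hom specialized_trace.scale[OF \<phi>])
  have val_gen: "val (Suc n) (f * fa_gen n * g) (sc_a * s)" "val (Suc n) (f * fa_gen_inv n * g) (sc_a_inv * s)"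
    if "val n (f * g) s" "1 \<le> n" "f \<in> carrier (FA n)" "g \<in> carrier (FA n)" for n f g s
    using that by (simp_all add: val_def hom specialized_trace.gen[OF \<phi>] specialized_trace.gen_inv[OF \<phi>])
  have val_incl: "val (Suc n) f (bmw_delta * s)" if "val n f s" "f \<in> carrier (FA n)" for n f s
    using that by (simp add: val_def hom specialized_trace.incl[OF \<phi>])
  have val_1: "val 1 1 1"
    by (simp add: val_def hom specialized_trace.one[OF \<phi>, unfolded One_nat_def])
  have val_cong: "val n g s" if "val n f s" "f - g \<in> bmw_ideal n" for n f g s
    using that \<phi>_cong by (simp add: val_def)
  have val_comm: "val n (g * f) s" if "val n (f * g) s" "f \<in> carrier (FA n)" "g \<in> carrier (FA n)" for n f g s
    using that specialized_trace.commute[OF \<phi>] by (simp add: val_def)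
  have val_unique: "s = t" if "val n f s" "val n f t" for n f s t
  proof -
    have "curve_ev x m (s - t) = 0" if x: "1 < x" for x :: real and m
    proof -
      have "curve_ev x m (s - t) + curve_ev x m t
        = curve_ev x m s"
        by (simp only: diff_add_cancel flip: hom(4)[OF x])
      moreover have "curve_ev x m s = curve_ev x m t"
        using \<open>val n f s\<close> \<open>val n f t\<close> x unfolding val_def by metis
      ultimately show ?thesis by (metis add_cancel_left_left)
    qed
    then have "s - t = 0" by (rule curve_ev_faithful)
    then show ?thesis by simp
  qed
  \<comment> \<open>The span induction evaluates the recipe by ring operations, which is why the
    value lies in R.\<close>
  have val_ex: "\<exists>s. val n f s" if "1 \<le> n" "f \<in> carrier (FA n)" for n f
    using that
  proof (induction n arbitrary: f rule: nat_induct_at_least)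
    case base
    obtain s where "f = fa_const s * 1" using FA_1_const[OF base] by auto
    then show ?case using val_scale[OF val_1, of s] by (auto simp: FA_closed)
  next
    case (Suc n)
    have "f \<in> bmw_span n" by (rule FA_span) fact+
    then show ?case
    proof (induction rule: bmw_span.induct)
      case (base u)
      then obtain s where "val n u s" using Suc.IH by auto
      from val_incl[OF this base] show ?case ..
    next
      case (gen u v)
      then obtain s where "val n (u * v) s" using Suc.IH[of "u * v"] by (auto simp: FA_closed)
      from val_gen(1)[OF this Suc.hyps gen] show ?case ..
    next
      case (gen_inv u v)
      then obtain s where "val n (u * v) s" using Suc.IH[of "u * v"] by (auto simp: FA_closed)
      from val_gen(2)[OF this Suc.hyps gen_inv] show ?case ..
    next
      case (add x y)
      then obtain s s' where "val (Suc n) x s" "val (Suc n) y s'" by auto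
      from val_add[OF this] show ?case ..
    next
      case (cong x y)
      then obtain s where "val (Suc n) x s" by auto
      from val_cong[OF this cong(3)] show ?case ..
    qed
  qed
  \<comment> \<open>Since values are unique, every closure rule for \<open>val\<close> becomes an
    equation for T, whatever recipe produced the value.\<close>
  define T where "T n f = (THE s. val n f s)" for n f
  have T: "T n f = s" if "val n f s" for n f s
    unfolding T_def using that val_unique by blast
  have val_T: "val n f (T n f)" if "1 \<le> n" "f \<in> carrier (FA n)" for n f
    using val_ex[OF that] T[of n f] by auto
  define rep where "rep n X = (SOME f. f \<in> carrier (FA n) \<and> X = bmw_class n f)" for n X
  \<comment> \<open>T has value 1 at the unit on one strand, so the factor c gives the prescribed
    normalization. The restrictions make t extensional, so that uniqueness can be equality of
    functions.\<close>
  define t where "t = (\<lambda>n\<in>{1..}. \<lambda>X\<in>carrier (BMW n). c * T n (rep n X))"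
  have t: "t n (bmw_class n f) = c * T n f" if "1 \<le> n" "f \<in> carrier (FA n)" for n f
  proof -
    have "rep n (bmw_class n f) \<in> carrier (FA n) \<and> bmw_class n f = bmw_class n (rep n (bmw_class n f))"
      unfolding rep_def by (rule someI[of _ f]) (simp add: that)
    then have "f - rep n (bmw_class n f) \<in> bmw_ideal n"
      using that class_eq_iff by blast
    from T[OF val_cong[OF val_T[OF that] this]] have "T n (rep n (bmw_class n f)) = T n f" .
    then show ?thesis using that by (simp add: t_def class_closed)
  qed
  have "markov_trace t"
    unfolding markov_trace_def
  proof (intro allI impI conjI)
    fix n :: nat assume n: "1 \<le> n"
    show "linear_functional n (t n)"
      unfolding linear_functional_def
    proof (intro conjI ballI allI)
      fix X Y assume "X \<in> carrier (BMW n)" "Y \<in> carrier (BMW n)"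
      then obtain f g where fg: "f \<in> carrier (FA n)" "X = bmw_class n f" "g \<in> carrier (FA n)" "Y = bmw_class n g"
        by (metis class_representative)
      show "t n (X \<oplus>\<^bsub>BMW n\<^esub> Y) = t n X + t n Y"
        using fg T[OF val_add[OF val_T[OF n fg(1)] val_T[OF n fg(3)]]] n by (simp add: t FA_closed distrib_left flip: class_add)
    next
      fix s X assume "X \<in> carrier (BMW n)"
      then obtain f where f: "f \<in> carrier (FA n)" "X = bmw_class n f"
        by (metis class_representative)
      show "t n (bmw_smult n s X) = s * t n X"
        using f T[OF val_scale[OF val_T[OF n f(1)] f(1)]] n by (simp add: t FA_closed bmw_smult_class mult.left_commute)
    qed
    show "trace_property n (t n)"
      unfolding trace_property_def
    proof (intro ballI)
      fix X Y assume "X \<in> carrier (BMW n)" "Y \<in> carrier (BMW n)"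
      then obtain f g where fg: "f \<in> carrier (FA n)" "X = bmw_class n f" "g \<in> carrier (FA n)" "Y = bmw_class n g"
        by (metis class_representative)
      have "val n (f * g) (T n (f * g))"
        by (rule val_T[OF n]) (simp add: fg FA_closed)
      from T[OF val_comm[OF this fg(1,3)]] have "T n (g * f) = T n (f * g)" .
      then show "t n (X \<otimes>\<^bsub>BMW n\<^esub> Y) = t n (Y \<otimes>\<^bsub>BMW n\<^esub> X)"
        using fg n by (simp add: t FA_closed flip: class_mult)
    qed
    show "stabilization_property n (t n) (t (n + 1))"
      unfolding stabilization_property_def
    proof (intro ballI)
      fix X Y assume "X \<in> carrier (BMW n)" "Y \<in> carrier (BMW n)"
      then obtain f g where fg: "f \<in> carrier (FA n)" "X = bmw_class n f" "g \<in> carrier (FA n)" "Y = bmw_class n g"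
        by (metis class_representative)
      note mem = fg(1,3) fg(1,3)[THEN FA_Suc] gens_Suc[OF n]
      have gen: "bmw_gen (n + 1) n = bmw_class (n + 1) (fa_gen n)"
        "inv\<^bsub>BMW (n + 1)\<^esub> (bmw_gen (n + 1) n) = bmw_class (n + 1) (fa_gen_inv n)"
        using n bmw_gen_inverse(2)[of n "n + 1"] by (simp_all add: bmw_gen_def)
      have fg_val: "val n (f * g) (T n (f * g))"
        by (rule val_T[OF n]) (simp add: fg FA_closed)
      note T_gen = T[OF val_gen(1)[OF fg_val n fg(1,3)]] T[OF val_gen(2)[OF fg_val n fg(1,3)]]
      then show "t (n + 1) (bmw_incl n X \<otimes>\<^bsub>BMW (n + 1)\<^esub> bmw_gen (n + 1) n \<otimes>\<^bsub>BMW (n + 1)\<^esub> bmw_incl n Y)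
          = sc_a * t n (X \<otimes>\<^bsub>BMW n\<^esub> Y) \<and>
        t (n + 1) (bmw_incl n X \<otimes>\<^bsub>BMW (n + 1)\<^esub> inv\<^bsub>BMW (n + 1)\<^esub> (bmw_gen (n + 1) n)
              \<otimes>\<^bsub>BMW (n + 1)\<^esub> bmw_incl n Y)
          = sc_a_inv * t n (X \<otimes>\<^bsub>BMW n\<^esub> Y)"
        unfolding gen(2) unfolding gen(1) using mem n
        by (simp add: fg bmw_incl_class t FA_closed mult.left_commute flip: class_mult)
    qed
  qed
  moreover have "inclusion_property bmw_delta t"
    unfolding inclusion_property_def
  proof (intro allI impI ballI)
    fix n X assume n: "1 \<le> n" and "X \<in> carrier (BMW n)"
    then obtain f where f: "f \<in> carrier (FA n)" "X = bmw_class n f"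
      by (metis class_representative)
    have "T (Suc n) f = bmw_delta * T n f"
      by (rule T[OF val_incl[OF val_T[OF n f(1)] f(1)]])
    then show "t (n + 1) (bmw_incl n X) = bmw_delta * t n X"
      using f n FA_Suc by (simp add: bmw_incl_class t mult.left_commute)
  qed
  moreover have "t 1 \<one>\<^bsub>BMW 1\<^esub> = c"
    using t[of 1 1] T[OF val_1] by (simp add: class_one FA_closed)
  moreover have "t \<in> (\<Pi>\<^sub>E n\<in>{1..}. carrier (BMW n) \<rightarrow>\<^sub>E (UNIV :: scalar set))"
    by (auto simp: t_def)
  ultimately show "\<exists>t. t \<in> (\<Pi>\<^sub>E n\<in>{1..}. carrier (BMW n) \<rightarrow>\<^sub>E (UNIV :: scalar set)) \<and>
      markov_trace t \<and> inclusion_property bmw_delta t \<and> t 1 \<one>\<^bsub>BMW 1\<^esub> = c"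
    by blast
next
  fix t t'
  assume t: "t \<in> (\<Pi>\<^sub>E n\<in>{1..}. carrier (BMW n) \<rightarrow>\<^sub>E (UNIV :: scalar set)) \<and>
      markov_trace t \<and> inclusion_property bmw_delta t \<and> t 1 \<one>\<^bsub>BMW 1\<^esub> = c"
    and t': "t' \<in> (\<Pi>\<^sub>E n\<in>{1..}. carrier (BMW n) \<rightarrow>\<^sub>E (UNIV :: scalar set)) \<and>
      markov_trace t' \<and> inclusion_property bmw_delta t' \<and> t' 1 \<one>\<^bsub>BMW 1\<^esub> = c"
  have "t n X = t' n X" if "1 \<le> n" "X \<in> carrier (BMW n)" for n X
    using that(2)
  proof (rule class_representative)
    fix f assume "f \<in> carrier (FA n)" "X = bmw_class n f"
    then show ?thesis
      using markov_trace_unique[of t bmw_delta t' n f] t t' that(1) by simp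
  qed
  then have "t n = t' n" if "1 \<le> n" for n
    using t t' that by (intro PiE_ext[of "t n" "carrier (BMW n)" "\<lambda>_. UNIV" "t' n"]) (auto dest: PiE_mem)
  then show "t = t'"
    using t t' by (intro PiE_ext[of t "{1..}" _ t']) auto
qed

end
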